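(* Let either $X$ be the set of nonzero countable ordinals and $\|\cdot\|=\|\cdot\|_\sigma$, or $X=P$ and $\|\cdot\|=\|\cdot\|_\vartheta$; let $\Theta=\Theta_X$ with corresponding fundamental sequences $\cdot[\cdot]$. If $\zeta<\xi\in\hat\varepsilon_{\Omega+1}$, $\xi$ is a limit with $\tau(\xi)<\Omega$, and $n$ is a natural number with $\|\zeta\|\le n$, then $\zeta\le\xi[n]$.
   Context: $\Omega$ is the first uncountable ordinal; $\varepsilon_{\Omega+1}$ the least $\varepsilon>\Omega$ with $\omega^\varepsilon=\varepsilon$. Every $0<\xi<\varepsilon_{\Omega+1}$ has a unique $\Omega$-normal form $\xi=\Omega^{\alpha}\beta+\gamma$ with $0<\beta<\Omega$, $\gamma<\Omega^{\alpha}$. $C(0)=\{0\}$, $C(\Omega^\alpha\beta+\gamma)=C(\alpha)\cup C(\gamma)\cup\{\beta\}$; $\xi^*=\max C(\xi)$. For $\theta<\Omega$: $0[\theta]=1[\theta]=0$; $(\Omega^\alpha\beta+\gamma)[\theta]=\Omega^\alpha\beta+\gamma[\theta]$ if $\gamma>0$; $(\Omega^\alpha\beta)[\theta]=\Omega^\alpha\theta$ if $\beta$ is a limit; $\Omega^{\alpha+1}[\theta]=\Omega^\alpha\theta$; $(\Omega^\alpha(\beta+1))[\theta]=\Omega^\alpha\beta+(\Omega^\alpha)[\theta]$ if $\beta>0$; $\Omega^\alpha[\theta]=\Omega^{\alpha[\theta]}$ if $\alpha$ is a limit. $\tau(0)=0$, $\tau(\zeta+1)=1$, $\tau(\Omega^\alpha\beta+\gamma)=\tau(\gamma)$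 if $\gamma>0$, $\tau(\Omega^\alpha\beta)=\beta$ if $\beta$ limit, $\tau(\Omega^\alpha(\beta+1))=\tau(\alpha)$ if $\alpha$ limit, $\tau(\Omega^{\alpha+1}(\beta+1))=\Omega$. For $X\subseteq\Omega$ club in $\Omega$ with $0\notin X$: $\Theta_X(\xi)$ is the least $\theta\in X$ with $\theta>\xi^*$ such that all $\zeta<\xi$ with $\zeta^*<\theta$ have $\Theta_X(\zeta)<\theta$. $\Omega_0=1$, $\Omega_{n+1}=\Omega^{\Omega_n}$, $\Theta_X(\varepsilon_{\Omega+1})=\sup_n\Theta_X(\Omega_n)$, $\hat\varepsilon_{\Omega+1}=\{\xi<\varepsilon_{\Omega+1}:\xi^*<\Theta_X(\varepsilon_{\Omega+1})\}$; $X'$ = limit points of $X$. $P$ = countable ordinals of the form $\omega^\xi$; $\vartheta=\Theta_P$; $\sigma=\Theta_X$ for $X$ the nonzero countable ordinals. $\mathrm{FIX}(X)=\{\xi:(\xi[1])^*<\xi^*=\tau(\xi)=\Theta_X(\gamma)\text{ for some }\gamma>\xi\}$; $\mathrm{JUMP}(X)=\{0\}\cup\{\text{successors}\}\cup\mathrm{FIX}(X)$; $\Theta^*(\xi)=\Theta_X(\zeta)$ if $\xi=\zeta+1$, $\tau(\xi)$ if $\xi\in\mathrm{FIX}(X)$, $0$ otherwise. Write $\xi=\alpha+\beta$ with $\alpha$ a multiple of $\Omega$ and $\beta<\Omega$; $\check\xi=\alpha$ if $\Theta^*(\xi)>0$, else $\xi$; $\Theta^{(0)}(\xi)=\Theta^*(\xi)$,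 $\Theta^{(i+1)}(\xi)=\Theta(\check\xi[\Theta^{(i)}(\xi)])$. Each element of $X$ below $\Theta(\varepsilon_{\Omega+1})$ is $\Theta(\zeta)$ for a unique $\zeta\in\hat\varepsilon_{\Omega+1}$. Define $\xi[n]$ ($n<\omega$) for $\xi<\Theta(\varepsilon_{\Omega+1})$ and for $\Omega\le\xi\in\hat\varepsilon_{\Omega+1}$ with $\tau(\xi)<\Omega$ recursively: $0[n]=0$; if $\xi\ge\Omega$, $\xi[n]=\xi[\tau(\xi)[n]]$; if $\xi=\Theta(\zeta)\in X'$: $\xi[n]=\Theta(\check\zeta[n]+\Theta^*(\zeta))$ when $\tau(\check\zeta)<\Omega$, $\xi[n]=\Theta^{(n)}(\zeta)$ when $\tau(\check\zeta)=\Omega$; for $\Theta=\sigma$: $\sigma(\beta)[n]=\beta$ for $\beta<\Omega$; for $\Theta=\vartheta$: $(\omega^{\alpha_1}+\dots+\omega^{\alpha_k})[n]=\omega^{\alpha_1}+\dots+\omega^{\alpha_{k-1}}+(\omega^{\alpha_k})[n]$ for $k\ge2$, $\alpha_1\ge\dots\ge\alpha_k$, and $\vartheta(\beta)[n]=\Theta^*(\beta)\cdot n$ for $\beta<\Omega$, $\beta\in\mathrm{JUMP}(P)$. Norms: the size of a closed term is $\|f(t_1,\dots,t_k)\|=1+\|t_1\|+\dots+\|t_k\|$ (constants have size 1); $\|\alpha\|$ is the least size of a closed term with value $\alpha$. $\|\cdot\|_\sigma$ uses the functions $0$, $\sigma$, $(x,y,z)\mapsto\Omega^xy+z$; $\|\cdot\|_\vartheta$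 uses $0$, $+$, $\vartheta$, $(x,y,z)\mapsto\Omega^xy+z$. *)

theory Defs
  imports Main "HOL-Library.Extended_Nat"
begin

text \<open>The ordinals are modelled by a type carrying the initial well-order of
cardinality 2^(2^aleph0) (the cardinal order on nat set set).  Its order type is an
initial ordinal of cardinality greater than aleph1, hence it is (much) longer than
the ordinals below epsilon_{Omega+1} the statement talks about.\<close>

typedef ord = "UNIV :: nat set set set" by blast

definition ord_rel :: "(nat set set \<times> nat set set) set" where
  "ord_rel = card_of (UNIV :: nat set set set)"

lemma ord_rel_wo: "well_order_on UNIV ord_rel"
  unfolding ord_rel_def by (rule card_of_well_order_on)

instantiation ord :: linorder
begin
definition less_eq_ord :: "ord \<Rightarrow> ord \<Rightarrow> bool" where
  "less_eq_ord x y \<longleftrightarrow> (Rep_ord x, Rep_ord y) \<in> ord_rel"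
definition less_ord :: "ord \<Rightarrow> ord \<Rightarrow> bool" where
  "less_ord x y \<longleftrightarrow> x \<le> y \<and> x \<noteq> y"
instance
proof
  have wo: "well_order_on UNIV ord_rel" by (rule ord_rel_wo)
  hence lo: "linear_order_on UNIV ord_rel" by (simp add: well_order_on_def)
  hence po: "partial_order_on UNIV ord_rel" and tot: "total_on UNIV ord_rel"
    by (auto simp: linear_order_on_def)
  hence pre: "preorder_on UNIV ord_rel" and anti: "antisym ord_rel"
    by (auto simp: partial_order_on_def)
  hence rf: "refl_on UNIV ord_rel" and tr: "trans ord_rel"
    by (auto simp: preorder_on_def)
  fix x y z :: ord
  show "(x < y) = (x \<le> y \<and> \<not> y \<le> x)"
    unfolding less_ord_def less_eq_ord_def using anti Rep_ord_inject
    by (metis antisymD)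
  show "x \<le> x" unfolding less_eq_ord_def using rf by (simp add: refl_on_def)
  show "x \<le> y \<Longrightarrow> y \<le> z \<Longrightarrow> x \<le> z" unfolding less_eq_ord_def
    using tr by (meson transD)
  show "x \<le> y \<Longrightarrow> y \<le> x \<Longrightarrow> x = y" unfolding less_eq_ord_def
    using anti Rep_ord_inject by (metis antisymD)
  show "x \<le> y \<or> y \<le> x" unfolding less_eq_ord_def
    using tot rf Rep_ord_inject by (metis UNIV_I refl_onD total_on_def)
qed
end

instance ord :: wellorder
proof
  fix P :: "ord \<Rightarrow> bool" and a :: ord
  assume step: "\<And>x. (\<And>y. y < x \<Longrightarrow> P y) \<Longrightarrow> P x"
  have "Well_order ord_rel" using ord_rel_wo
    by (metis card_of_Field_ordIso card_of_Well_order ord_rel_def)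
  hence wf0: "wf (ord_rel - Id)" by (simp add: wo_rel.WF wo_rel_def)
  have wf1: "wf (inv_image (ord_rel - Id) Rep_ord)" using wf0 by (rule wf_inv_image)
  show "P a"
  proof (induct a rule: wf_induct[OF wf1])
    case (1 x)
    show ?case
    proof (rule step)
      fix y assume "y < x"
      hence "(y, x) \<in> inv_image (ord_rel - Id) Rep_ord"
        by (auto simp: less_ord_def less_eq_ord_def Rep_ord_inject)
      thus "P y" using 1 by blast
    qed
  qed
qed

definition osucc :: "ord \<Rightarrow> ord" where
  "osucc x = (LEAST y. x < y)"

definition is_succ :: "ord \<Rightarrow> bool" where
  "is_succ x \<longleftrightarrow> (\<exists>y. x = osucc y)"

definition opred :: "ord \<Rightarrow> ord" where
  "opred x = (THE y. x = osucc y)"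

text \<open>Least upper bound of a (bounded) set of ordinals; the sup of the empty set is 0.\<close>
definition osup :: "ord set \<Rightarrow> ord" where
  "osup A = (LEAST y. \<forall>x\<in>A. x \<le> y)"

definition ordrec :: "((ord \<Rightarrow> 'b) \<Rightarrow> ord \<Rightarrow> 'b) \<Rightarrow> ord \<Rightarrow> 'b" where
  "ordrec F = wfrec {(x, y). x < y} F"

instantiation ord :: "{zero, one, plus, times}"
begin
definition zero_ord :: ord where "zero_ord = (LEAST x. True)"
definition one_ord :: ord where "one_ord = osucc 0"
definition plus_ord :: "ord \<Rightarrow> ord \<Rightarrow> ord" where
  "plus_ord a = ordrec (\<lambda>f b. osup ({a} \<union> (\<lambda>c. osucc (f c)) ` {c. c < b}))"
definition times_ord :: "ord \<Rightarrow> ord \<Rightarrow> ord" where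
  "times_ord a = ordrec (\<lambda>f b. osup ((\<lambda>c. f c + a) ` {c. c < b}))"
instance ..
end

definition opow :: "ord \<Rightarrow> ord \<Rightarrow> ord" where
  "opow a = ordrec (\<lambda>f b. if a = 0 then (if b = 0 then 1 else 0)
                          else osup ({1} \<union> (\<lambda>c. f c * a) ` {c. c < b}))"

definition olimit :: "ord \<Rightarrow> bool" where
  "olimit x \<longleftrightarrow> x \<noteq> 0 \<and> \<not> is_succ x"

definition onat :: "nat \<Rightarrow> ord" where
  "onat n = (osucc ^^ n) 0"

definition omega :: ord where
  "omega = (LEAST x. olimit x)"

definition Omega :: ord where
  "Omega = (LEAST x. \<not> countable {y. y < x})"

definition epsOm :: ord where
  "epsOm = (LEAST e. Omega < e \<and> opow omega e = e)"

text \<open>xi = Omega^alpha * beta + gamma with 0 < beta < Omega and gamma < Omega^alpha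
  (for 0 < xi < epsilon_{Omega+1}); returned as the triple (alpha, beta, gamma).\<close>
definition nf :: "ord \<Rightarrow> ord \<times> ord \<times> ord" where
  "nf xi = (THE p. case p of (a, b, c) \<Rightarrow>
      xi = opow Omega a * b + c \<and> 0 < b \<and> b < Omega \<and> c < opow Omega a)"

definition nfE :: "ord \<Rightarrow> ord" where "nfE xi = fst (nf xi)"
definition nfC :: "ord \<Rightarrow> ord" where "nfC xi = fst (snd (nf xi))"
definition nfR :: "ord \<Rightarrow> ord" where "nfR xi = snd (snd (nf xi))"

definition Cset :: "ord \<Rightarrow> ord set" where
  "Cset = ordrec (\<lambda>f xi. if xi = 0 then {0}
                         else f (nfE xi) \<union> f (nfR xi) \<union> {nfC xi})"

definition ostar :: "ord \<Rightarrow> ord" where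
  "ostar xi = Max (Cset xi)"

definition fsO :: "ord \<Rightarrow> ord \<Rightarrow> ord" where
  "fsO xi0 th = ordrec (\<lambda>f xi.
     if xi = 0 \<or> xi = 1 then 0
     else if nfR xi \<noteq> 0 then opow Omega (nfE xi) * nfC xi + f (nfR xi)
     else if olimit (nfC xi) then opow Omega (nfE xi) * th
     else if nfC xi = 1 \<and> is_succ (nfE xi) then opow Omega (opred (nfE xi)) * th
     else if is_succ (nfC xi) \<and> opred (nfC xi) \<noteq> 0
       then opow Omega (nfE xi) * opred (nfC xi) + f (opow Omega (nfE xi))
     else if nfC xi = 1 \<and> olimit (nfE xi) then opow Omega (f (nfE xi))
     else 0) xi0"

definition tau :: "ord \<Rightarrow> ord" where
  "tau = ordrec (\<lambda>f xi.
     if xi = 0 then 0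
     else if is_succ xi then 1
     else if nfR xi \<noteq> 0 then f (nfR xi)
     else if olimit (nfC xi) then nfC xi
     else if olimit (nfE xi) then f (nfE xi)
     else Omega)"

definition Theta :: "ord set \<Rightarrow> ord \<Rightarrow> ord" where
  "Theta X = ordrec (\<lambda>f xi. LEAST th. th \<in> X \<and> ostar xi < th \<and>
                      (\<forall>z<xi. ostar z < th \<longrightarrow> f z < th))"

primrec OmN :: "nat \<Rightarrow> ord" where
  "OmN 0 = 1"
| "OmN (Suc n) = opow Omega (OmN n)"

definition ThetaEps :: "ord set \<Rightarrow> ord" where
  "ThetaEps X = osup (range (\<lambda>n. Theta X (OmN n)))"

definition epshat :: "ord set \<Rightarrow> ord set" where
  "epshat X = {xi. xi < epsOm \<and> ostar xi < ThetaEps X}"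

definition lim_pts :: "ord set \<Rightarrow> ord set" where
  "lim_pts X = {x. 0 < x \<and> x < Omega \<and> (\<forall>y<x. \<exists>z\<in>X. y < z \<and> z < x)}"

definition Pset :: "ord set" where
  "Pset = {x. x < Omega \<and> (\<exists>xi. x = opow omega xi)}"

definition Xsig :: "ord set" where
  "Xsig = {x. 0 < x \<and> x < Omega}"

definition FIX :: "ord set \<Rightarrow> ord set" where
  "FIX X = {xi. ostar (fsO xi 1) < ostar xi \<and> ostar xi = tau xi \<and>
                (\<exists>g. xi < g \<and> g < epsOm \<and> tau xi = Theta X g)}"

definition JUMP :: "ord set \<Rightarrow> ord set" where
  "JUMP X = {0} \<union> {x. is_succ x} \<union> FIX X"

definition ThetaStar :: "ord set \<Rightarrow> ord \<Rightarrow> ord" where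
  "ThetaStar X xi = (if is_succ xi then Theta X (opred xi)
                     else if xi \<in> FIX X then tau xi else 0)"

definition omul :: "ord \<Rightarrow> ord" where
  "omul xi = (THE a. \<exists>d b. a = Omega * d \<and> b < Omega \<and> xi = a + b)"

definition check :: "ord set \<Rightarrow> ord \<Rightarrow> ord" where
  "check X xi = (if 0 < ThetaStar X xi then omul xi else xi)"

primrec ThetaIter :: "ord set \<Rightarrow> ord \<Rightarrow> nat \<Rightarrow> ord" where
  "ThetaIter X xi 0 = ThetaStar X xi"
| "ThetaIter X xi (Suc i) = Theta X (fsO (check X xi) (ThetaIter X xi i))"

definition Theta_inv :: "ord set \<Rightarrow> ord \<Rightarrow> ord" where
  "Theta_inv X xi = (THE z. z \<in> epshat X \<and> Theta X z = xi)"

datatype system = SigmaSys | VarthetaSys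

fun Xof :: "system \<Rightarrow> ord set" where
  "Xof SigmaSys = Xsig"
| "Xof VarthetaSys = Pset"

definition osum_list :: "ord list \<Rightarrow> ord" where
  "osum_list xs = foldl (+) 0 xs"

text \<open>fsN_rel s n xi eta means xi[n] = eta; the clauses follow the recursive definition,
  each guarded by the failure of the preceding clauses.\<close>
inductive fsN_rel :: "system \<Rightarrow> nat \<Rightarrow> ord \<Rightarrow> ord \<Rightarrow> bool" where
  fs_zero: "fsN_rel s n 0 0"
| fs_big: "\<lbrakk> Omega \<le> xi; xi \<in> epshat (Xof s); tau xi < Omega;
             fsN_rel s n (tau xi) t \<rbrakk> \<Longrightarrow> fsN_rel s n xi (fsO xi t)"
| fs_limA: "\<lbrakk> xi \<noteq> 0; xi < Omega; xi < ThetaEps (Xof s); xi \<in> lim_pts (Xof s);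
              z = Theta_inv (Xof s) xi; tau (check (Xof s) z) < Omega;
              fsN_rel s n (check (Xof s) z) t \<rbrakk>
           \<Longrightarrow> fsN_rel s n xi (Theta (Xof s) (t + ThetaStar (Xof s) z))"
| fs_limB: "\<lbrakk> xi \<noteq> 0; xi < Omega; xi < ThetaEps (Xof s); xi \<in> lim_pts (Xof s);
              z = Theta_inv (Xof s) xi; tau (check (Xof s) z) = Omega \<rbrakk>
           \<Longrightarrow> fsN_rel s n xi (ThetaIter (Xof s) z n)"
| fs_sig: "\<lbrakk> s = SigmaSys; xi \<noteq> 0; xi < Omega; xi < ThetaEps (Xof s);
             xi \<notin> lim_pts (Xof s); b < Omega; xi = Theta (Xof s) b \<rbrakk>
           \<Longrightarrow> fsN_rel s n xi b"
| fs_vsum: "\<lbrakk> s = VarthetaSys; xi \<noteq> 0; xi < Omega; xi < ThetaEps (Xof s);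
              xi \<notin> lim_pts (Xof s); sorted_wrt (\<lambda>a b. b \<le> a) as; 2 \<le> length as;
              xi = osum_list (map (opow omega) as);
              fsN_rel s n (opow omega (last as)) t \<rbrakk>
           \<Longrightarrow> fsN_rel s n xi (osum_list (map (opow omega) (butlast as)) + t)"
| fs_vth: "\<lbrakk> s = VarthetaSys; xi \<noteq> 0; xi < Omega; xi < ThetaEps (Xof s);
             xi \<notin> lim_pts (Xof s); b < Omega; b \<in> JUMP (Xof s); xi = Theta (Xof s) b \<rbrakk>
           \<Longrightarrow> fsN_rel s n xi (ThetaStar (Xof s) b * onat n)"

definition fsN :: "system \<Rightarrow> nat \<Rightarrow> ord \<Rightarrow> ord" where
  "fsN s n xi = (THE e. fsN_rel s n xi e)"

datatype tm = TZero | TTheta tm | TOm tm tm tm | TPlus tm tm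

fun tsize :: "tm \<Rightarrow> nat" where
  "tsize TZero = 1"
| "tsize (TTheta t) = 1 + tsize t"
| "tsize (TOm a b c) = 1 + tsize a + tsize b + tsize c"
| "tsize (TPlus a b) = 1 + tsize a + tsize b"

fun allowed :: "system \<Rightarrow> tm \<Rightarrow> bool" where
  "allowed s TZero = True"
| "allowed s (TTheta t) = allowed s t"
| "allowed s (TOm a b c) = (allowed s a \<and> allowed s b \<and> allowed s c)"
| "allowed s (TPlus a b) = (s = VarthetaSys \<and> allowed s a \<and> allowed s b)"

fun teval :: "ord set \<Rightarrow> tm \<Rightarrow> ord" where
  "teval X TZero = 0"
| "teval X (TTheta t) = Theta X (teval X t)"
| "teval X (TOm a b c) = opow Omega (teval X a) * teval X b + teval X c"
| "teval X (TPlus a b) = teval X a + teval X b"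

text \<open>||alpha|| (infinite if no closed term denotes alpha).\<close>
definition onorm :: "system \<Rightarrow> ord \<Rightarrow> enat" where
  "onorm s a = (INF t \<in> {t. allowed s t \<and> teval (Xof s) t = a}. enat (tsize t))"

end

theory Submission
  imports Defs
begin

text \<open>The strict form is proved: a term of size at most n with value zeta < xi has zeta < xi[n].
  If xi is uncountable, passing to xi[n] only affects the coefficient tau(xi), so that it suffices
  to compare the coefficients of zeta, whose norms are no larger, with tau(xi)[n].

  Let xi = Theta(z) be countable and zeta = Theta(h) < xi, and let w be z with its countable part
  removed when Theta*(z) > 0. If h < w, induction on the norm bounds h and its coefficients by the
  next member of the sequence. If w <= h < z, then zeta <= Theta*(z). If h > z, then zeta is at
  most the largest coefficient of z. Either that coefficient survives in z[n], or it equals tau(z);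
  in the latter case zeta = tau(z) would put z into FIX, hence zeta < tau(z), and induction on xi
  applies.

  It remains to treat sums. For vartheta, Cantor normal forms reduce them to additive principal xi.
  For sigma, everything above Omega^2 has additively closed values, while t |-> sigma(Omega c + t)
  runs through ordinals closed under sigma below Omega c; such ordinals are closed under
  remainders, and under sums of ordinals that are at least c. This determines where b + sigma(h)
  lies relative to the members of a fundamental sequence.\<close>


text \<open>Strictness lets the induction run: \<open>less_fsO\<close> compares coefficients
  strictly, so a bound by \<le> for them would not carry over to z < x[th]. The main obstacle is the
  system for sigma. Its terms Omega^0 b + c denote sums, but x[n] is in general not closed under
  addition (the sequence for sigma(Omega) is 0, 1, 2, ...), so separate bounds for b and sigma(h)
  say nothing about b + sigma(h). The induction therefore also proves a statement about b + c in
  which b enters only through an index m from which on b \<le> x[q]; the index allowed for the sum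
  is m plus the size of the term for c. Moving b into an argument of sigma produces successors, as
  in b + sigma(Omega c + t) \<le> sigma(Omega c + b + 1 + t), and each of them costs one index.
  These are paid for by the outer symbol sigma and by the fact that the coefficients of an
  uncountable ordinal of norm k have norm at most k - 1.\<close>

unbundle cardinal_syntax

section \<open>The order on the type and bounds by cardinality\<close>

lemma ord_not_less_0 [simp]: "\<not> x < (0::ord)"
  unfolding zero_ord_def by (metis (full_types) Least_le linorder_not_less)

lemma ord_zero_le [simp]: "(0::ord) \<le> x"
  by (simp add: leI)

lemma ord_le_0 [simp]: "x \<le> (0::ord) \<longleftrightarrow> x = 0"
  by (metis order_antisym ord_zero_le)

lemma ord_pos_iff [simp]: "(0::ord) < x \<longleftrightarrow> x \<noteq> 0"
  by (metis order_le_less ord_zero_le order_less_irrefl)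

lemma ord_neq_0_conv: "x \<noteq> (0::ord) \<longleftrightarrow> 0 < x"
  by (simp add: ord_pos_iff)

lemma inj_Rep_ord: "inj Rep_ord"
  by (simp add: inj_def Rep_ord_inject)

text \<open>\<open>ord_rel\<close> is of the form \<open>card_of\<close>, and proper initial
  segments of a cardinal order are strictly smaller than the whole; hence a set of ordinals can be
  shown bounded by counting.\<close>

lemma card_seg_ord: "|{y. y < (x::ord)}| <o |UNIV :: ord set|"
proof -
  let ?r = "|UNIV :: nat set set set|"
  have bij: "bij Rep_ord"
    by (metis Abs_ord_inverse UNIV_I bij_def inj_Rep_ord surj_def)
  have 1: "|underS ?r (Rep_ord x)| <o ?r"
    by (rule card_of_underS) (auto simp: card_of_Card_order card_of_card_order_on Field_card_of)
  have "Rep_ord ` {y. y < x} \<subseteq> underS ?r (Rep_ord x)"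
    by (auto simp: underS_def less_ord_def less_eq_ord_def ord_rel_def Rep_ord_inject)
  then have "|Rep_ord ` {y. y < x}| \<le>o |underS ?r (Rep_ord x)|"
    by (rule card_of_mono1)
  moreover have "|{y. y < x}| =o |Rep_ord ` {y. y < x}|"
    using card_of_ordIsoI inj_on_imp_bij_betw inj_Rep_ord
    by (metis inj_on_subset top_greatest)
  ultimately have "|{y. y < x}| <o ?r"
    using 1 by (meson ordIso_ordLeq_trans ordLeq_ordLess_trans)
  moreover have "?r =o |UNIV :: ord set|"
    using bij by (metis card_of_ordIsoI ordIso_symmetric)
  ultimately show ?thesis by (rule ordLess_ordIso_trans)
qed

lemma infinite_ord: "infinite (UNIV :: ord set)"
proof -
  have "infinite (range Abs_ord)"
  proof -
    have "inj Abs_ord" by (metis Abs_ord_inverse UNIV_I injI)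
    moreover have "infinite (UNIV :: nat set set set)"
      by (simp add: Finite_Set.finite_set)
    ultimately show ?thesis by (metis finite_imageD Finite_Set.finite_set infinite_UNIV_nat)
  qed
  then show ?thesis using finite_subset[OF subset_UNIV] by blast
qed

text \<open>A supremum formed with LEAST is junk unless the set is bounded. The recursion equations
  for the arithmetic operations are therefore obtained by counting: the ordinals with at most
  |A| predecessors are closed under suprema of at most |A| elements.\<close>

definition seg_le :: "ord set \<Rightarrow> ord \<Rightarrow> bool" where
  "seg_le A x \<longleftrightarrow> |{y. y < x}| \<le>o |A|"

lemma seg_le_mono: "seg_le A x \<Longrightarrow> y \<le> x \<Longrightarrow> seg_le A y"
  unfolding seg_le_def
  by (rule ordLeq_transitive[OF card_of_mono1]) auto

text \<open>Infinite, so that a union of at most |A| segments with at most |A| elements each again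
  has at most |A| elements; smaller than the type, so that such a union leaves an ordinal
  out.\<close>

definition big :: "ord set \<Rightarrow> bool" where
  "big A \<longleftrightarrow> infinite A \<and> |A| <o |UNIV :: ord set|"

lemma card_insert_le: "infinite A \<Longrightarrow> |B| \<le>o |A| \<Longrightarrow> |insert x B| \<le>o |A|"
proof -
  assume A: "infinite A" and B: "|B| \<le>o |A|"
  have "|{x}| \<le>o |A|" using A by (intro card_of_singl_ordLeq) auto
  then have "|{x} \<union> B| \<le>o |A|"
    using A B by (intro card_of_Un_ordLeq_infinite_Field) (simp_all add: Field_card_of card_of_card_order_on)
  then show ?thesis by simp
qed

text \<open>It suffices to treat the larger of the two. An infinite segment serves as its own A; for
  a finite one a copy of the natural numbers does, which is smaller than the type by Cantor's
  theorem applied twice.\<close>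

lemma big_ex: "\<exists>A. big A \<and> seg_le A a \<and> seg_le A b"
proof -
  have 1: "\<exists>A. big A \<and> seg_le A c" for c
  proof (cases "infinite {y. y < c}")
    case True
    then show ?thesis using card_seg_ord[of c] ordLeq_refl[OF card_of_Card_order]
      by (auto simp: big_def seg_le_def intro!: exI[of _ "{y. y < c}"])
  next
    case False
    have "|UNIV :: nat set| <o |UNIV :: ord set|"
    proof -
      have "|UNIV :: nat set| <o |UNIV :: nat set set|" by (rule card_of_Pow[of UNIV, unfolded Pow_UNIV])
      also have "|UNIV :: nat set set| <o |UNIV :: nat set set set|" by (rule card_of_Pow[of UNIV, unfolded Pow_UNIV])
      also have "|UNIV :: nat set set set| \<le>o |UNIV :: ord set|"
        by (rule card_of_ordLeqI[of Abs_ord]) (auto simp: inj_on_def Abs_ord_inject)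
      finally show ?thesis .
    qed
    obtain f :: "nat \<Rightarrow> ord" where f: "inj f"
      using infinite_ord unfolding infinite_iff_countable_subset by auto
    have eq: "|range f| =o |UNIV :: nat set|"
      using f by (metis card_of_ordIsoI inj_on_imp_bij_betw ordIso_symmetric)
    have "infinite (range f)" using f by (simp add: finite_image_iff)
    moreover have "|range f| <o |UNIV :: ord set|"
      using eq \<open>|UNIV :: nat set| <o |UNIV :: ord set|\<close> ordIso_ordLess_trans by blast
    moreover have "|{y. y < c}| \<le>o |range f|"
      using False \<open>infinite (range f)\<close>
      using finite_ordLess_infinite[of "|{y. y < c}|" "|range f|"]
      by (simp add: Field_card_of card_of_well_order_on ordLess_imp_ordLeq)
    ultimately show ?thesis by (auto simp: big_def seg_le_def)
  qed
  obtain c where "a \<le> c" "b \<le> c" by (metis le_cases order_refl)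
  then show ?thesis using 1[of c] seg_le_mono by blast
qed

text \<open>The union of the segments below members of S has at most |A| elements, so it misses an
  ordinal. The least one missed bounds S, and its own segment lies in the union.\<close>

lemma seg_bounded:
  assumes A: "big A" and S: "|S| \<le>o |A|" and le: "\<And>x. x \<in> S \<Longrightarrow> seg_le A x"
  shows "\<exists>u. seg_le A u \<and> (\<forall>x\<in>S. x \<le> u)"
proof -
  define U where "U = (\<Union>x\<in>S. {y. y < x})"
  have "|U| \<le>o |A|"
    unfolding U_def using A S le
    by (intro card_of_UNION_ordLeq_infinite) (auto simp: big_def seg_le_def)
  then have "|U| <o |UNIV :: ord set|"
    using A ordLeq_ordLess_trans by (auto simp: big_def)
  then have "U \<noteq> UNIV" using ordLess_irreflexive by metis
  define u where "u = (LEAST u. u \<notin> U)"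
  obtain v where "v \<notin> U" using \<open>U \<noteq> UNIV\<close> by auto
  then have u: "u \<notin> U" unfolding u_def by (rule LeastI)
  have "{y. y < u} \<subseteq> U" unfolding u_def using not_less_Least by blast
  then have "seg_le A u" unfolding seg_le_def
    using \<open>|U| \<le>o |A|\<close> card_of_mono1 ordLeq_transitive by blast
  moreover have "\<forall>x\<in>S. x \<le> u" using u by (auto simp: U_def not_less)
  ultimately show ?thesis by blast
qed

lemma seg_sup:
  assumes A: "big A" and S: "|S| \<le>o |A|" and le: "\<And>x. x \<in> S \<Longrightarrow> seg_le A x"
  shows "seg_le A (osup S)"
proof -
  obtain u where u: "seg_le A u" "\<forall>x\<in>S. x \<le> u" using seg_bounded[OF assms] by blast
  then have "osup S \<le> u" unfolding osup_def by (intro Least_le) auto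
  then show ?thesis using u seg_le_mono by blast
qed

lemma osup_upper: "bdd_above S \<Longrightarrow> x \<in> S \<Longrightarrow> x \<le> osup S"
proof -
  assume "bdd_above S" and x: "x \<in> S"
  then obtain u where "\<forall>x\<in>S. x \<le> u" unfolding bdd_above_def by blast
  then have "\<forall>x\<in>S. x \<le> osup S" unfolding osup_def by (rule LeastI)
  then show "x \<le> osup S" using x by blast
qed

lemma osup_least: "(\<And>x. x \<in> S \<Longrightarrow> x \<le> u) \<Longrightarrow> osup S \<le> u"
  unfolding osup_def by (rule Least_le) auto

lemma less_osup_iff: "bdd_above S \<Longrightarrow> x < osup S \<longleftrightarrow> (\<exists>y\<in>S. x < y)"
  by (meson linorder_not_less order_less_le_trans osup_least osup_upper)

lemma seg_bdd: "big A \<Longrightarrow> |S| \<le>o |A| \<Longrightarrow> (\<And>x. x \<in> S \<Longrightarrow> seg_le A x) \<Longrightarrow> bdd_above S"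
  using seg_bounded by (meson bdd_above.I)

lemma ord_no_top: "\<exists>y. (x::ord) < y"
proof -
  obtain A where A: "big A" "seg_le A x" using big_ex by blast
  have "|{y. y \<le> x}| \<le>o |A|"
  proof -
    have "{y. y \<le> x} = insert x {y. y < x}" by auto
    moreover have "infinite A" using A by (simp add: big_def)
    ultimately show ?thesis using A by (simp add: card_insert_le seg_le_def)
  qed
  then have "|{y. y \<le> x}| <o |UNIV :: ord set|" using A ordLeq_ordLess_trans by (auto simp: big_def)
  then have "{y. y \<le> x} \<noteq> UNIV" using ordLess_irreflexive by metis
  then show ?thesis by (auto simp: not_le)
qed

section \<open>Successors, limits and recursion\<close>

lemma less_osucc [simp]: "x < osucc x"
  unfolding osucc_def by (rule LeastI_ex) (rule ord_no_top)

lemma osucc_le_iff: "osucc x \<le> y \<longleftrightarrow> x < y"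
  using less_osucc by (metis Least_le order_less_le_trans osucc_def)

lemma less_osucc_iff: "y < osucc x \<longleftrightarrow> y \<le> x"
  by (metis linorder_not_less osucc_le_iff)

lemma osucc_inject [simp]: "osucc x = osucc y \<longleftrightarrow> x = y"
  by (metis less_osucc less_osucc_iff order_antisym)

lemma osucc_less_iff [simp]: "osucc x < osucc y \<longleftrightarrow> x < y"
  by (metis less_osucc_iff osucc_le_iff)

lemma osucc_le_osucc_iff [simp]: "osucc x \<le> osucc y \<longleftrightarrow> x \<le> y"
  by (simp add: linorder_not_less [symmetric])

lemma osucc_neq_0 [simp]: "osucc x \<noteq> 0"
  by (metis less_osucc ord_not_less_0)

lemma opred_osucc [simp]: "opred (osucc x) = x"
  unfolding opred_def by simp

lemma is_succ_osucc [simp]: "is_succ (osucc x)"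
  unfolding is_succ_def by blast

lemma is_succ_0 [simp]: "\<not> is_succ 0"
  unfolding is_succ_def by (metis osucc_neq_0)

lemma seg_le_osucc:
  assumes "big A" "seg_le A x" shows "seg_le A (osucc x)"
proof -
  have "{y. y < osucc x} = insert x {y. y < x}" by (auto simp: less_osucc_iff)
  then show ?thesis using assms by (simp add: card_insert_le seg_le_def big_def)
qed

lemma ordrec_eq:
  assumes "\<And>f g x. (\<And>y. y < x \<Longrightarrow> f y = g y) \<Longrightarrow> F f x = F g x"
  shows "ordrec F x = F (ordrec F) (x::ord)"
proof -
  have wf: "wf {(x, y). x < (y::ord)}" by (rule wf)
  show ?thesis unfolding ordrec_def
    by (subst wfrec[OF wf]) (rule assms, simp add: cut_apply)
qed

text \<open>Equations between ordinals are proved by comparing predecessors;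
  \<open>less_plus_iff\<close>, \<open>less_times_iff'\<close> and \<open>less_opow_iff\<close>
  supply the predecessors of sums, products and powers.\<close>

lemma ord_eqI: "(\<And>z. z < x \<longleftrightarrow> z < y) \<Longrightarrow> x = (y::ord)"
  by (meson linorder_neqE order_less_irrefl)

lemma ord_cases: "(x = 0 \<Longrightarrow> P) \<Longrightarrow> (\<And>y. x = osucc y \<Longrightarrow> P) \<Longrightarrow> (olimit x \<Longrightarrow> P) \<Longrightarrow> P"
  unfolding olimit_def is_succ_def by blast

lemma olimit_osucc [simp]: "\<not> olimit (osucc x)"
  by (simp add: olimit_def)

lemma olimit_0 [simp]: "\<not> olimit 0"
  by (simp add: olimit_def)

lemma olimit_succ_less: "olimit x \<Longrightarrow> y < x \<Longrightarrow> osucc y < x"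
  by (metis olimit_osucc order_le_less osucc_le_iff)

lemma olimitI: "0 < x \<Longrightarrow> (\<And>y. y < x \<Longrightarrow> osucc y < x) \<Longrightarrow> olimit x"
  unfolding olimit_def is_succ_def using less_osucc by fastforce

lemma olimit_neq_0: "olimit x \<Longrightarrow> x \<noteq> 0"
  by (simp add: olimit_def)

lemma olimit_pos: "olimit x \<Longrightarrow> 0 < x"
  by (simp add: olimit_def)

subsection \<open>Addition\<close>

lemma plus_rec: "a + b = osup ({a} \<union> (\<lambda>c. osucc (a + c)) ` {c. c < (b::ord)})"
proof -
  have "ordrec (\<lambda>f b. osup ({a} \<union> (\<lambda>c. osucc (f c)) ` {c. c < b})) b
    = osup ({a} \<union> (\<lambda>c. osucc (ordrec (\<lambda>f b. osup ({a} \<union> (\<lambda>c. osucc (f c)) ` {c. c < b})) c)) ` {c. c < b})"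
    by (rule ordrec_eq) (auto intro!: arg_cong[where f = osup])
  then show ?thesis unfolding plus_ord_def .
qed

lemma card_image_seg: "big A \<Longrightarrow> seg_le A b \<Longrightarrow> |f ` {c. c < b}| \<le>o |A|"
  unfolding seg_le_def using card_of_image ordLeq_transitive by blast

lemma card_insert_image_seg: "big A \<Longrightarrow> seg_le A b \<Longrightarrow> |{a} \<union> f ` {c. c < b}| \<le>o |A|"
  by (simp add: card_insert_le big_def card_image_seg)

unbundle no cardinal_syntax

lemma seg_le_plus: "big A \<Longrightarrow> seg_le A a \<Longrightarrow> seg_le A b \<Longrightarrow> seg_le A (a + b)"
proof (induction b rule: less_induct)
  case (less b)
  have "seg_le A (osucc (a + c))" if "c < b" for c
    using that less by (meson order_less_imp_le seg_le_mono seg_le_osucc)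
  then have "seg_le A x" if "x \<in> {a} \<union> (\<lambda>c. osucc (a + c)) ` {c. c < b}" for x
    using that less.prems(2) by blast
  then have "seg_le A (osup ({a} \<union> (\<lambda>c. osucc (a + c)) ` {c. c < b}))"
    by (rule seg_sup[OF less.prems(1) card_insert_image_seg[OF less.prems(1,3)]])
  then show ?case by (simp only: plus_rec[of a b])
qed

lemma plus_bdd: "bdd_above ({a} \<union> (\<lambda>c. osucc (a + c)) ` {c. c < (b::ord)})"
proof -
  obtain A where A: "big A" "seg_le A a" "seg_le A b" using big_ex by blast
  have "seg_le A (osucc (a + c))" if "c < b" for c
    using that A by (meson order_less_imp_le seg_le_mono seg_le_osucc seg_le_plus)
  then have "seg_le A x" if "x \<in> {a} \<union> (\<lambda>c. osucc (a + c)) ` {c. c < b}" for x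
    using that A(2) by blast
  then show ?thesis by (rule seg_bdd[OF A(1) card_insert_image_seg[OF A(1,3)]])
qed

lemma less_plus_iff': "x < a + b \<longleftrightarrow> x < a \<or> (\<exists>c<b. x \<le> a + (c::ord))"
proof -
  have "x < a + b \<longleftrightarrow> x < osup ({a} \<union> (\<lambda>c. osucc (a + c)) ` {c. c < b})"
    using plus_rec[of a b] by (rule arg_cong)
  also have "\<dots> \<longleftrightarrow> (\<exists>y\<in>{a} \<union> (\<lambda>c. osucc (a + c)) ` {c. c < b}. x < y)"
    by (rule less_osup_iff[OF plus_bdd])
  also have "\<dots> \<longleftrightarrow> x < a \<or> (\<exists>c<b. x \<le> a + c)" by (auto simp: less_osucc_iff)
  finally show ?thesis .
qed

lemma ord_add_strict_left_mono: "b < c \<Longrightarrow> a + b < a + (c::ord)"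
  by (metis less_plus_iff' order_refl)

lemma ord_add_less_cancel_left [simp]: "a + b < a + (c::ord) \<longleftrightarrow> b < c"
  by (metis ord_add_strict_left_mono linorder_neqE order_less_asym order_less_irrefl)

lemma ord_add_le_cancel_left [simp]: "a + b \<le> a + (c::ord) \<longleftrightarrow> b \<le> c"
  by (simp add: linorder_not_less [symmetric])

lemma ord_add_left_cancel [simp]: "a + b = a + (c::ord) \<longleftrightarrow> b = c"
  by (metis order_antisym ord_add_le_cancel_left order_refl)

lemma ord_le_add1 [simp]: "a \<le> a + (b::ord)"
  by (meson less_plus_iff' linorder_not_less order_less_irrefl)

lemma ord_add_0_right: "a + 0 = (a::ord)"
  by (rule ord_eqI) (simp add: less_plus_iff')

lemma ord_le_iff_add: "a \<le> x \<longleftrightarrow> (\<exists>c. x = a + (c::ord))"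
proof
  assume ax: "a \<le> x"
  have "x \<le> a + x"
  proof (induction x rule: less_induct)
    case (less x)
    then show ?case using ord_add_strict_left_mono
      by (meson linorder_not_less order_le_less_trans order_less_irrefl)
  qed
  \<comment> \<open>The least c reaching x cannot overshoot: x < a + c would already give x \<le> a
    + d for some d < c.\<close>
  define c where "c = (LEAST c. x \<le> a + c)"
  have c: "x \<le> a + c" unfolding c_def by (rule LeastI) fact
  have "\<not> x < a + c"
  proof
    assume "x < a + c"
    then obtain d where "d < c" "x \<le> a + d" using ax less_plus_iff' by (meson linorder_not_less)
    then show False unfolding c_def using not_less_Least by blast
  qed
  then show "\<exists>c. x = a + c" using c by (metis order_le_less)
next
  show "\<exists>c. x = a + c \<Longrightarrow> a \<le> x" by auto
qed

lemma less_plus_iff: "x < a + b \<longleftrightarrow> x < a \<or> (\<exists>c<b. x = a + (c::ord))"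
  by (metis less_plus_iff' linorder_not_less ord_add_less_cancel_left ord_le_iff_add order_refl order_le_less_trans)

lemma ord_add_assoc: "(a + b) + c = a + (b + (c::ord))"
proof (induction c rule: less_induct)
  case (less c)
  show ?case
  proof (rule ord_eqI)
    fix z
    show "z < a + b + c \<longleftrightarrow> z < a + (b + c)"
      unfolding less_plus_iff[of z "a + b" c] less_plus_iff[of z a "b + c"] less_plus_iff[of z a b]
      using less by (auto simp: less_plus_iff[of _ b c])
  qed
qed

lemma ord_add_0_left: "0 + b = (b::ord)"
proof (induction b rule: less_induct)
  case (less b) then show ?case by (intro ord_eqI) (auto simp: less_plus_iff[of _ 0 b])
qed

instance ord :: monoid_add
  by standard (simp_all add: ord_add_assoc ord_add_0_left ord_add_0_right)

lemma ord_add_osucc [simp]: "a + osucc b = osucc (a + (b::ord))"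
  by (rule ord_eqI) (auto simp: less_plus_iff' less_osucc_iff intro: order_trans order_less_imp_le ord_le_add1)

lemma osucc_0: "osucc 0 = (1::ord)"
  by (simp add: one_ord_def)

lemma ord_add_1 [simp]: "a + 1 = osucc (a::ord)"
  by (metis osucc_0 ord_add_osucc add_0_right)

lemma ord_one_neq_zero [simp]: "(1::ord) \<noteq> 0"
  by (simp add: one_ord_def)

lemma ord_zero_less_one: "0 < (1::ord)"
  by simp

lemma ord_less_one [simp]: "x < (1::ord) \<longleftrightarrow> x = 0"
  by (simp add: one_ord_def less_osucc_iff)

lemma ord_one_le: "1 \<le> x \<longleftrightarrow> 0 < (x::ord)"
  by (simp add: one_ord_def osucc_le_iff)

lemma is_succ_1 [simp]: "is_succ 1" by (simp add: one_ord_def)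

lemma opred_1 [simp]: "opred 1 = 0" by (simp add: one_ord_def)

lemma ord_less_add_iff [simp]: "a < a + b \<longleftrightarrow> 0 < (b::ord)"
  by (metis add_0_right ord_add_less_cancel_left)

lemma ord_add_eq_self [simp]: "a + b = a \<longleftrightarrow> b = (0::ord)"
  by (metis add_0_right ord_add_left_cancel)

lemma ord_add_right_mono: "a \<le> b \<Longrightarrow> a + c \<le> b + (c::ord)"
proof (induction c rule: less_induct)
  case (less c)
  show ?case
  proof (rule leI, rule notI)
    assume h: "b + c < a + c"
    have "\<not> b + c < a" using less.prems
      by (meson linorder_not_less ord_le_add1 order_trans)
    then obtain d where "d < c" "b + c = a + d" using h less_plus_iff by blast
    then show False using less.IH[of d] less.prems by (metis linorder_not_less ord_add_less_cancel_left)
  qed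
qed

lemma ord_add_mono: "a \<le> b \<Longrightarrow> c \<le> d \<Longrightarrow> a + c \<le> b + (d::ord)"
  by (meson ord_add_right_mono ord_add_le_cancel_left order_trans)

lemma ord_le_add2 [simp]: "b \<le> a + (b::ord)"
  using ord_add_right_mono[of 0 a b] by simp

lemma ord_add_eq_0 [simp]: "a + b = 0 \<longleftrightarrow> a = 0 \<and> b = (0::ord)"
  by (metis add_0_left ord_le_0 ord_le_add1)

lemma ord_add_pos: "0 < a + b \<longleftrightarrow> 0 < a \<or> 0 < (b::ord)"
  by (metis ord_add_eq_0 ord_pos_iff)

lemma ord_less_add_imp: "x < a + b \<Longrightarrow> a \<le> x \<Longrightarrow> \<exists>c<b. x = a + (c::ord)"
  by (meson less_plus_iff linorder_not_less)

lemma olimit_add: "olimit b \<Longrightarrow> olimit (a + b)"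
proof (rule olimitI)
  assume b: "olimit b"
  then show "0 < a + b" by (auto dest: olimit_neq_0)
  fix y assume "y < a + b"
  then consider "y < a" | c where "c < b" "y = a + c" using less_plus_iff by blast
  then show "osucc y < a + b"
  proof cases
    case 1 then show ?thesis
      by (meson b olimit_pos ord_less_add_iff order_le_less_trans osucc_le_iff)
  next
    case 2 then show ?thesis using b olimit_succ_less by (metis ord_add_less_cancel_left ord_add_osucc)
  qed
qed

lemma is_succ_add: "0 < b \<Longrightarrow> is_succ (a + b) \<longleftrightarrow> is_succ b"
  by (metis is_succ_def olimit_add olimit_def ord_add_osucc ord_neq_0_conv)

lemma olimit_add_iff: "0 < b \<Longrightarrow> olimit (a + b) \<longleftrightarrow> olimit b"
  by (metis is_succ_add olimit_def ord_add_pos ord_neq_0_conv)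

subsection \<open>Multiplication\<close>

lemma times_rec: "a * b = osup ((\<lambda>c. a * c + a) ` {c. c < (b::ord)})"
proof -
  have "ordrec (\<lambda>f b. osup ((\<lambda>c. f c + a) ` {c. c < b})) b
    = osup ((\<lambda>c. ordrec (\<lambda>f b. osup ((\<lambda>c. f c + a) ` {c. c < b})) c + a) ` {c. c < b})"
    by (rule ordrec_eq) (auto intro!: arg_cong[where f = osup])
  then show ?thesis unfolding times_ord_def .
qed

lemma seg_le_times: "big A \<Longrightarrow> seg_le A a \<Longrightarrow> seg_le A b \<Longrightarrow> seg_le A (a * b)"
proof (induction b rule: less_induct)
  case (less b)
  have "seg_le A (a * c + a)" if "c < b" for c
    using that less by (meson order_less_imp_le seg_le_mono seg_le_plus)
  then have "seg_le A x" if "x \<in> (\<lambda>c. a * c + a) ` {c. c < b}" for x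
    using that less.prems(2) by blast
  then have "seg_le A (osup ((\<lambda>c. a * c + a) ` {c. c < b}))"
    by (rule seg_sup[OF less.prems(1) card_image_seg[OF less.prems(1,3)]])
  then show ?case by (simp only: times_rec[of a b])
qed

lemma times_bdd: "bdd_above ((\<lambda>c. a * c + a) ` {c. c < (b::ord)})"
proof -
  obtain A where A: "big A" "seg_le A a" "seg_le A b" using big_ex by blast
  have "seg_le A (a * c + a)" if "c < b" for c
    using that A by (meson order_less_imp_le seg_le_mono seg_le_plus seg_le_times)
  then have "seg_le A x" if "x \<in> (\<lambda>c. a * c + a) ` {c. c < b}" for x
    using that A(2) by blast
  then show ?thesis by (rule seg_bdd[OF A(1) card_image_seg[OF A(1,3)]])
qed

lemma less_times_iff': "x < a * b \<longleftrightarrow> (\<exists>c<b. x < a * c + (a::ord))"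
proof -
  have "x < a * b \<longleftrightarrow> x < osup ((\<lambda>c. a * c + a) ` {c. c < b})"
    using times_rec[of a b] by (rule arg_cong)
  also have "\<dots> \<longleftrightarrow> (\<exists>y\<in>(\<lambda>c. a * c + a) ` {c. c < b}. x < y)"
    by (rule less_osup_iff[OF times_bdd])
  finally show ?thesis by auto
qed

lemma ord_mult_0_right [simp]: "a * 0 = (0::ord)"
  by (rule ord_eqI) (simp add: less_times_iff')

lemma ord_mult_left_mono: "b \<le> c \<Longrightarrow> a * b \<le> a * (c::ord)"
proof -
  assume "b \<le> c"
  then have "z < a * c" if "z < a * b" for z
    using that unfolding less_times_iff'[of z] by (blast intro: order_less_le_trans)
  then show ?thesis by (meson leI order_less_irrefl)
qed

lemma ord_mult_osucc [simp]: "a * osucc b = a * b + (a::ord)"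
proof (rule ord_eqI)
  fix z
  have "z < a * b + a" if "c \<le> b" "z < a * c + a" for c
    using that ord_add_right_mono[OF ord_mult_left_mono[OF that(1)], of a a]
    by (meson order_less_le_trans)
  then show "z < a * osucc b \<longleftrightarrow> z < a * b + a"
    by (auto simp: less_times_iff'[of z a "osucc b"] less_osucc_iff)
qed

lemma ord_mult_strict_left_mono: "b < c \<Longrightarrow> 0 < a \<Longrightarrow> a * b < a * (c::ord)"
  using ord_mult_left_mono[of "osucc b" c a]
  by (simp add: osucc_le_iff order_less_le_trans[OF iffD2[OF ord_less_add_iff]])

lemma ord_mult_less_cancel_left [simp]: "0 < a \<Longrightarrow> a * b < a * c \<longleftrightarrow> b < (c::ord)"
  by (meson linorder_not_less ord_mult_left_mono ord_mult_strict_left_mono)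

lemma ord_mult_le_cancel_left [simp]: "0 < a \<Longrightarrow> a * b \<le> a * c \<longleftrightarrow> b \<le> (c::ord)"
  by (simp add: linorder_not_less [symmetric])

lemma ord_mult_0_left [simp]: "0 * b = (0::ord)"
proof (induction b rule: less_induct)
  case (less b) then show ?case by (intro ord_eqI) (auto simp: less_times_iff'[of _ 0 b])
qed

lemma ord_mult_eq_0 [simp]: "a * b = 0 \<longleftrightarrow> a = 0 \<or> b = (0::ord)"
  using ord_mult_strict_left_mono[of 0 b a] by (cases "a = 0"; cases "b = 0") auto

lemma less_times_iff: "x < a * b \<longleftrightarrow> (\<exists>c d. c < b \<and> d < a \<and> x = a * c + (d::ord))"
proof
  assume "x < a * b"
  define c where "c = (LEAST c. x < a * c + a)"
  obtain c' where c': "c' < b" "x < a * c' + a" using \<open>x < a * b\<close> less_times_iff' by blast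
  then have c: "x < a * c + a" unfolding c_def by (metis (mono_tags, lifting) LeastI)
  have "c \<le> c'" unfolding c_def using c' by (intro Least_le)
  have "\<not> x < a * c"
  proof
    assume "x < a * c"
    then obtain d where "d < c" "x < a * d + a" using less_times_iff' by blast
    then show False unfolding c_def using not_less_Least by blast
  qed
  then obtain d where "d < a" "x = a * c + d" using c ord_less_add_imp by (meson linorder_not_less)
  moreover have "c < b" using \<open>c \<le> c'\<close> c' by simp
  ultimately show "\<exists>c d. c < b \<and> d < a \<and> x = a * c + d" by blast
next
  assume "\<exists>c d. c < b \<and> d < a \<and> x = a * c + d"
  then show "x < a * b" by (auto simp: less_times_iff'[of x])
qed

lemma ord_distrib_left: "a * (b + c) = a * b + a * (c::ord)"
proof (induction c rule: less_induct)
  case (less c)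
  show ?case
  proof (rule ord_eqI)
    fix z
    have 1: "z < a * c' + a \<longleftrightarrow> z < a * b + (a * d + a)" if "c' = b + d" "d < c" for c' d
      using less[OF that(2)] that by (simp add: add.assoc)
    have "z < a * (b + c) \<longleftrightarrow> (\<exists>c'<b. z < a * c' + a) \<or> (\<exists>d<c. z < a * b + (a * d + a))"
      unfolding less_times_iff'[of z a "b + c"] less_plus_iff[of _ b c] using 1 by blast
    also have "\<dots> \<longleftrightarrow> z < a * b \<or> (\<exists>d<c. z < a * b + (a * d + a))"
      by (simp add: less_times_iff'[of z a b])
    also have "\<dots> \<longleftrightarrow> z < a * b + a * c"
    proof -
      have "(\<exists>d<c. z < a * b + (a * d + a)) \<longrightarrow> z < a * b \<or> (\<exists>e<a * c. z = a * b + e)"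
        unfolding less_plus_iff[of z "a * b" "a * _ + a"] using less_times_iff'[of _ a c] by blast
      moreover have "(\<exists>e<a * c. z = a * b + e) \<longrightarrow> (\<exists>d<c. z < a * b + (a * d + a))"
        unfolding less_times_iff'[of _ a c] by auto
      ultimately show ?thesis unfolding less_plus_iff[of z "a * b" "a * c"] by blast
    qed
    finally show "z < a * (b + c) \<longleftrightarrow> z < a * b + a * c" .
  qed
qed

lemma ord_mult_1_left: "1 * b = (b::ord)"
proof (induction b rule: less_induct)
  case (less b) then show ?case
    by (intro ord_eqI) (auto simp: less_times_iff'[of _ 1 b] less_osucc_iff intro: order_le_less_trans)
qed

lemma ord_mult_1_right: "b * 1 = (b::ord)"
  using ord_mult_osucc[of b 0] by (simp add: osucc_0)

lemma ord_mult_assoc: "(a * b) * c = a * (b * (c::ord))"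
proof (cases "a = 0 \<or> b = 0")
  case False
  then have pos: "0 < a" "0 < b" by auto
  show ?thesis
  proof (induction c rule: less_induct)
    case (less c)
    show ?case
    proof (rule ord_eqI)
      fix z
      have "z < a * b * c \<longleftrightarrow> (\<exists>d<c. z < a * b * d + a * b)" by (rule less_times_iff')
      also have "\<dots> \<longleftrightarrow> (\<exists>d<c. z < a * (b * d + b))"
        by (rule ex_cong1) (auto simp: less ord_distrib_left)
      also have "\<dots> \<longleftrightarrow> z < a * (b * c)"
      proof
        assume "\<exists>d<c. z < a * (b * d + b)"
        then obtain d where d: "d < c" "z < a * (b * d + b)" by blast
        have "b * d + b \<le> b * c" using ord_mult_left_mono[of "osucc d" c b] d by (simp add: osucc_le_iff)
        then show "z < a * (b * c)" using d ord_mult_left_mono order_less_le_trans by blast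
      next
        assume "z < a * (b * c)"
        then obtain e where e: "e < b * c" "z < a * e + a" using less_times_iff' by blast
        then obtain d where "d < c" "e < b * d + b" using less_times_iff' by blast
        then show "\<exists>d<c. z < a * (b * d + b)" using e ord_mult_left_mono[of "osucc e" "b * d + b" a]
          by (auto simp: osucc_le_iff intro: order_less_le_trans)
      qed
      finally show "z < a * b * c \<longleftrightarrow> z < a * (b * c)" .
    qed
  qed
qed auto

instance ord :: monoid_mult
  by standard (simp_all add: ord_mult_assoc ord_mult_1_left ord_mult_1_right)

lemma ord_mult_right_mono: "a \<le> b \<Longrightarrow> a * c \<le> b * (c::ord)"
proof (induction c rule: less_induct)
  case (less c)
  have "z < b * c" if z: "z < a * c" for z
  proof -
    obtain d where "d < c" "z < a * d + a" using z less_times_iff' by blast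
    then show ?thesis unfolding less_times_iff'[of z b c]
      using less ord_add_mono order_less_le_trans by meson
  qed
  then show ?case by (meson leI order_less_irrefl)
qed

lemma ord_mult_mono: "a \<le> b \<Longrightarrow> c \<le> d \<Longrightarrow> a * c \<le> b * (d::ord)"
  by (meson ord_mult_right_mono ord_mult_left_mono order_trans)

lemma ord_le_mult_right [simp]: "0 < b \<Longrightarrow> a \<le> a * (b::ord)"
  using ord_mult_left_mono[of 1 b a] by (simp add: ord_one_le)

lemma ord_le_mult_left [simp]: "0 < a \<Longrightarrow> b \<le> a * (b::ord)"
  using ord_mult_right_mono[of 1 a b] by (simp add: ord_one_le)

lemma ord_div_ex: "0 < a \<Longrightarrow> \<exists>q r. x = a * q + r \<and> r < (a::ord)"
proof -
  assume "0 < a"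
  then have "x < a * osucc x" by (meson less_osucc ord_le_mult_left order_less_le_trans)
  then show ?thesis using less_times_iff by blast
qed

lemma ord_mult_add_less: "q < q' \<Longrightarrow> r < a \<Longrightarrow> a * q + r < a * q' + (r'::ord)"
  using ord_mult_left_mono[of "osucc q" q' a]
  by (metis ord_add_less_cancel_left ord_le_add1 ord_mult_osucc order_less_le_trans osucc_le_iff)

lemma ord_div_unique:
  "a * q + r = a * q' + r' \<Longrightarrow> r < a \<Longrightarrow> r' < a \<Longrightarrow> q = q' \<and> r = (r'::ord)"
  by (metis linorder_neqE ord_add_left_cancel ord_mult_add_less order_less_irrefl)

lemma olimit_mult_right: "0 < a \<Longrightarrow> olimit b \<Longrightarrow> olimit (a * b)"
proof (rule olimitI)
  assume a: "0 < a" and b: "olimit b"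
  then show "0 < a * b" by (auto dest: olimit_neq_0)
  fix y assume "y < a * b"
  then obtain c where c: "c < b" "y < a * c + a" using less_times_iff' by blast
  have "osucc y \<le> a * osucc c" using c by (simp add: osucc_le_iff)
  also have "\<dots> < a * b" using a b c olimit_succ_less by (intro ord_mult_strict_left_mono)
  finally show "osucc y < a * b" .
qed

lemma olimit_mult_left: "olimit a \<Longrightarrow> 0 < b \<Longrightarrow> olimit (a * b)"
proof (cases b rule: ord_cases)
  fix c assume "olimit a" "b = osucc c"
  then show ?thesis by (simp add: olimit_add)
qed (auto intro: olimit_mult_right olimit_pos)

subsection \<open>Exponentiation\<close>

lemma opow_rec: "a \<noteq> 0 \<Longrightarrow> opow a b = osup ({1} \<union> (\<lambda>c. opow a c * a) ` {c. c < b})"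
proof -
  let ?F = "\<lambda>f b. if a = 0 then (if b = 0 then 1 else 0)
                          else osup ({1} \<union> (\<lambda>c. f c * a) ` {c. c < (b::ord)})"
  have "ordrec ?F b = ?F (ordrec ?F) b"
    by (rule ordrec_eq) (auto intro!: arg_cong[where f = osup])
  then show "a \<noteq> 0 \<Longrightarrow> ?thesis" unfolding opow_def by simp
qed

lemma seg_le_opow: "big A \<Longrightarrow> a \<noteq> 0 \<Longrightarrow> seg_le A a \<Longrightarrow> seg_le A b \<Longrightarrow> seg_le A (opow a b)"
proof (induction b rule: less_induct)
  case (less b)
  have 1: "seg_le A 1" by (metis less.prems(2,3) ord_one_le ord_pos_iff seg_le_mono)
  have "seg_le A (opow a c * a)" if "c < b" for c
    using that less by (meson order_less_imp_le seg_le_mono seg_le_times)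
  then have "seg_le A x" if "x \<in> {1} \<union> (\<lambda>c. opow a c * a) ` {c. c < b}" for x
    using that 1 by blast
  then have "seg_le A (osup ({1} \<union> (\<lambda>c. opow a c * a) ` {c. c < b}))"
    by (rule seg_sup[OF less.prems(1) card_insert_image_seg[OF less.prems(1,4)]])
  then show ?case by (simp only: opow_rec[OF less.prems(2), of b])
qed

lemma opow_bdd: "a \<noteq> 0 \<Longrightarrow> bdd_above ({1} \<union> (\<lambda>c. opow a c * a) ` {c. c < b})"
proof -
  assume a: "a \<noteq> 0"
  obtain A where A: "big A" "seg_le A a" "seg_le A b" using big_ex by blast
  have 1: "seg_le A 1" by (metis a A(2) ord_one_le ord_pos_iff seg_le_mono)
  have "seg_le A (opow a c * a)" if "c < b" for c
    using that A a by (meson order_less_imp_le seg_le_mono seg_le_times seg_le_opow)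
  then have "seg_le A x" if "x \<in> {1} \<union> (\<lambda>c. opow a c * a) ` {c. c < b}" for x
    using that 1 by blast
  then show ?thesis by (rule seg_bdd[OF A(1) card_insert_image_seg[OF A(1,3)]])
qed

lemma less_opow_iff: "0 < a \<Longrightarrow> x < opow a b \<longleftrightarrow> x = 0 \<or> (\<exists>c<b. x < opow a c * a)"
proof -
  assume a: "0 < a"
  then have "x < opow a b \<longleftrightarrow> x < osup ({1} \<union> (\<lambda>c. opow a c * a) ` {c. c < b})"
    using opow_rec[of a b] by (metis ord_pos_iff)
  also have "\<dots> \<longleftrightarrow> (\<exists>y\<in>{1} \<union> (\<lambda>c. opow a c * a) ` {c. c < b}. x < y)"
    using a by (intro less_osup_iff opow_bdd) auto
  finally show ?thesis by auto
qed

lemma opow_0 [simp]: "0 < a \<Longrightarrow> opow a 0 = 1"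
  by (rule ord_eqI) (simp add: less_opow_iff)

lemma opow_pos: "0 < a \<Longrightarrow> 0 < opow a b"
  using less_opow_iff[of a 0 b] by blast

lemma opow_neq_0 [simp]: "a \<noteq> 0 \<Longrightarrow> opow a b \<noteq> 0"
  using opow_pos ord_pos_iff by metis

lemma opow_mono: "0 < a \<Longrightarrow> b \<le> c \<Longrightarrow> opow a b \<le> opow a c"
  by (metis leI less_opow_iff order_less_irrefl order_less_le_trans)

lemma opow_osucc: "0 < a \<Longrightarrow> opow a (osucc b) = opow a b * a"
proof (rule ord_eqI)
  fix z assume a: "0 < a"
  have "z < opow a b * a" if "c \<le> b" "z < opow a c * a" for c
    using that ord_mult_right_mono[OF opow_mono[OF a that(1)], of a] by (meson order_less_le_trans)
  then show "z < opow a (osucc b) \<longleftrightarrow> z < opow a b * a"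
    using a by (auto simp: less_opow_iff[of a z "osucc b"] less_osucc_iff)
qed

lemma opow_1 [simp]: "0 < a \<Longrightarrow> opow a 1 = a"
  using opow_osucc[of a 0] by (simp add: osucc_0)

lemma opow_strict_mono: "1 < a \<Longrightarrow> b < c \<Longrightarrow> opow a b < opow a c"
proof -
  assume a: "1 < a" and "b < c"
  then have "0 < a" using ord_zero_less_one order_less_trans by blast
  then have "opow a b * 1 < opow a b * a" using a by (simp only: ord_mult_less_cancel_left opow_pos)
  also have "\<dots> \<le> opow a c" using opow_mono[of a "osucc b" c] \<open>b < c\<close> \<open>0 < a\<close>
    by (simp add: opow_osucc osucc_le_iff)
  finally show ?thesis by simp
qed

lemma opow_less_iff: "1 < a \<Longrightarrow> opow a b < opow a c \<longleftrightarrow> b < c"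
  by (metis linorder_neqE opow_strict_mono order_less_asym order_less_irrefl)

lemma opow_le_iff: "1 < a \<Longrightarrow> opow a b \<le> opow a c \<longleftrightarrow> b \<le> c"
  by (simp add: opow_less_iff linorder_not_less [symmetric])

lemma opow_eq_iff: "1 < a \<Longrightarrow> opow a b = opow a c \<longleftrightarrow> b = c"
  by (metis linorder_neqE opow_strict_mono order_less_irrefl)

lemma le_opow: "1 < a \<Longrightarrow> b \<le> opow a b"
proof (induction b rule: less_induct)
  case (less b)
  then show ?case by (meson leI opow_strict_mono order_le_less_trans order_less_irrefl)
qed

lemma opow_limit: "0 < a \<Longrightarrow> olimit b \<Longrightarrow> x < opow a b \<longleftrightarrow> (\<exists>c<b. x < opow a c)"
proof
  assume a: "0 < a" and b: "olimit b" and "x < opow a b"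
  then consider "x = 0" | c where "c < b" "x < opow a (osucc c)"
    by (auto simp: less_opow_iff[of a x b] opow_osucc)
  then show "\<exists>c<b. x < opow a c" using a b olimit_pos opow_pos olimit_succ_less by cases blast+
qed (meson opow_mono order_less_imp_le order_less_le_trans)

lemma ord_mult_limit: "olimit b \<Longrightarrow> x < a * b \<longleftrightarrow> (\<exists>c<b. x < a * (c::ord))"
proof
  assume b: "olimit b" and "x < a * b"
  then obtain c where "c < b" "x < a * osucc c" by (auto simp: less_times_iff'[of x a b])
  then show "\<exists>c<b. x < a * c" using b olimit_succ_less by blast
qed (meson ord_mult_left_mono order_less_imp_le order_less_le_trans)

lemma opow_add: "0 < a \<Longrightarrow> opow a (b + c) = opow a b * opow a c"
proof (induction c rule: less_induct)
  case (less c)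
  show ?case
  proof (cases c rule: ord_cases)
    case (2 d)
    then show ?thesis using less.IH[of d] less.prems by (simp add: opow_osucc mult.assoc)
  next
    case 3
    \<comment> \<open>Needed to evaluate the product by \<open>ord_mult_limit\<close>; it fails for
      base 1, which is treated separately.\<close>
    have lim: "olimit (opow a c)" if "1 < a"
    proof (rule olimitI)
      fix y assume "y < opow a c"
      then obtain d where d: "d < c" "y < opow a d" using 3 less.prems opow_limit by blast
      then have "osucc y \<le> opow a d" by (simp add: osucc_le_iff)
      also have "\<dots> < opow a c" using that d opow_strict_mono by blast
      finally show "osucc y < opow a c" .
    qed (use less.prems in simp)
    show ?thesis
    proof (cases "1 < a")
      case True
      show ?thesis
      proof (rule ord_eqI)
        fix z
        have "z < opow a (b + c) \<longleftrightarrow> (\<exists>e<b + c. z < opow a e)"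
          using olimit_add[OF 3] less.prems by (rule opow_limit[rotated])
        also have "\<dots> \<longleftrightarrow> (\<exists>d<c. z < opow a (b + d))"
        proof
          assume "\<exists>e<b + c. z < opow a e"
          then obtain e where e: "e < b + c" "z < opow a e" by blast
          then consider "e < b" | d where "d < c" "e = b + d" using less_plus_iff by blast
          then show "\<exists>d<c. z < opow a (b + d)"
          proof cases
            case 1
            then have "z < opow a (b + 0)" using e opow_mono[OF less.prems, of e b]
              by (metis add_0_right order_less_imp_le order_less_le_trans)
            then show ?thesis using 3 olimit_pos by blast
          qed (use e in blast)
        next
          assume "\<exists>d<c. z < opow a (b + d)"
          then show "\<exists>e<b + c. z < opow a e" using ord_add_strict_left_mono by blast
        qed
        also have "\<dots> \<longleftrightarrow> (\<exists>d<c. z < opow a b * opow a d)" using less by metis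
        also have "\<dots> \<longleftrightarrow> (\<exists>e<opow a c. z < opow a b * e)"
        proof
          assume "\<exists>d<c. z < opow a b * opow a d"
          then show "\<exists>e<opow a c. z < opow a b * e" using True opow_strict_mono by blast
        next
          assume "\<exists>e<opow a c. z < opow a b * e"
          then obtain e d where "d < c" "e < opow a d" "z < opow a b * e"
            using 3 less.prems opow_limit by blast
          then show "\<exists>d<c. z < opow a b * opow a d"
            using ord_mult_left_mono order_less_imp_le order_less_le_trans by meson
        qed
        also have "\<dots> \<longleftrightarrow> z < opow a b * opow a c" using ord_mult_limit[OF lim[OF True]] by blast
        finally show "z < opow a (b + c) \<longleftrightarrow> z < opow a b * opow a c" .
      qed
    next
      case False
      then have "a = 1" using less.prems by (metis ord_one_le order_le_less)
      moreover have "opow 1 x = 1" for x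
      proof (induction x rule: less_induct)
        case (less x)
        then show ?case by (intro ord_eqI) (auto simp: less_opow_iff[of 1 _ x])
      qed
      ultimately show ?thesis by simp
    qed
  qed (use less.prems in simp)
qed

lemma olimit_opow: "1 < a \<Longrightarrow> olimit b \<Longrightarrow> olimit (opow a b)"
proof (rule olimitI)
  assume a: "1 < a" and b: "olimit b"
  then have a0: "0 < a" using ord_zero_less_one order_less_trans by blast
  then show "0 < opow a b" by simp
  fix y assume "y < opow a b"
  then obtain d where d: "d < b" "y < opow a d" using b a0 opow_limit by blast
  then have "osucc y \<le> opow a d" by (simp add: osucc_le_iff)
  also have "\<dots> < opow a b" using a d opow_strict_mono by blast
  finally show "osucc y < opow a b" .
qed

lemma olimit_opow': "olimit a \<Longrightarrow> 0 < b \<Longrightarrow> olimit (opow a b)"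
proof -
  assume a: "olimit a" and b: "0 < b"
  have a1: "1 < a" using a olimit_succ_less[of a 0] olimit_pos by (simp add: osucc_0)
  then have a0: "0 < a" using ord_zero_less_one order_less_trans by blast
  show ?thesis
  proof (cases b rule: ord_cases)
    case (2 c)
    then show ?thesis using a a0 by (simp add: opow_osucc olimit_mult_right)
  qed (use a1 b olimit_opow in auto)
qed

lemma opow_log_ex: "1 < a \<Longrightarrow> 0 < x \<Longrightarrow> \<exists>b. opow a b \<le> x \<and> x < opow a (osucc b)"
proof -
  assume a: "1 < a" and x: "0 < x"
  then have a0: "0 < a" using ord_zero_less_one order_less_trans by blast
  define c where "c = (LEAST c. x < opow a c)"
  have "x < opow a (osucc x)" using le_opow[OF a, of "osucc x"] by (simp add: osucc_le_iff)
  then have c: "x < opow a c" unfolding c_def by (rule LeastI)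
  have min: "opow a d \<le> x" if "d < c" for d
    using that unfolding c_def using not_less_Least by (meson linorder_not_less)
  show ?thesis
  proof (cases c rule: ord_cases)
    case 1 then show ?thesis using c x a0 by simp
  next
    case (2 d) then show ?thesis using c min[of d] by auto
  next
    case 3 then show ?thesis using c min opow_limit[OF a0 3] by (meson linorder_not_less)
  qed
qed

text \<open>Used with base \<open>Omega\<close> for the normal forms of the statement and with base
  \<open>omega\<close> for Cantor normal forms.\<close>

lemma opow_nf_ex: "1 < a \<Longrightarrow> 0 < x \<Longrightarrow>
  \<exists>b q r. x = opow a b * q + r \<and> 0 < q \<and> q < a \<and> r < opow a b"
proof -
  assume a: "1 < a" and x: "0 < x"
  then have a0: "0 < a" using ord_zero_less_one order_less_trans by blast
  obtain b where b: "opow a b \<le> x" "x < opow a b * a" using opow_log_ex[OF a x] a0 by (auto simp: opow_osucc)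
  obtain q r where qr: "q < a" "r < opow a b" "x = opow a b * q + r"
    using b(2) less_times_iff by blast
  then have "q \<noteq> 0" using b(1) by (metis add_0_left linorder_not_less ord_mult_0_right)
  then show ?thesis using qr by auto
qed

lemma opow_nf_bounds: "0 < a \<Longrightarrow> 0 < q \<Longrightarrow> q < a \<Longrightarrow> r < opow a b \<Longrightarrow>
   opow a b \<le> opow a b * q + r \<and> opow a b * q + r < opow a (osucc b)"
proof -
  assume h: "0 < a" "0 < q" "q < a" "r < opow a b"
  have "opow a b \<le> opow a b * q" using h by simp
  moreover have "opow a b * q + r < opow a b * a + 0" using h by (intro ord_mult_add_less)
  moreover have "opow a b * q \<le> opow a b * q + r" by simp
  ultimately show ?thesis using h by (simp only: opow_osucc add_0_right) (blast intro: order_trans)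
qed

lemma opow_nf_unique: "1 < a \<Longrightarrow> opow a b * q + r = opow a b' * q' + r' \<Longrightarrow>
  0 < q \<Longrightarrow> q < a \<Longrightarrow> r < opow a b \<Longrightarrow> 0 < q' \<Longrightarrow> q' < a \<Longrightarrow> r' < opow a b' \<Longrightarrow>
  b = b' \<and> q = q' \<and> r = r'"
proof -
  assume a: "1 < a" and eq: "opow a b * q + r = opow a b' * q' + r'"
   and h: "0 < q" "q < a" "r < opow a b" and h': "0 < q'" "q' < a" "r' < opow a b'"
  have a0: "0 < a" using a ord_zero_less_one order_less_trans by blast
  have "opow a b < opow a (osucc b')" "opow a b' < opow a (osucc b)"
    using opow_nf_bounds[OF a0 h] opow_nf_bounds[OF a0 h'] eq by (metis order_le_less_trans)+
  then have "b = b'" using a by (simp add: opow_less_iff less_osucc_iff)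
  then show ?thesis using ord_div_unique[of "opow a b" q r q' r'] eq h h' by simp
qed

lemma opow_mult: "1 < a \<Longrightarrow> opow a (b * c) = opow (opow a b) c"
proof (induction c rule: less_induct)
  case (less c)
  have a0: "0 < a" using less.prems ord_zero_less_one order_less_trans by blast
  have p: "0 < opow a b" using a0 by simp
  show ?case
  proof (cases c rule: ord_cases)
    case (2 d)
    then show ?thesis using less.IH[of d] less.prems a0 p by (simp add: opow_osucc opow_add)
  next
    case 3
    show ?thesis
    proof (cases "b = 0")
      case True
      have "opow 1 x = 1" for x
      proof (induction x rule: less_induct)
        case (less x)
        then show ?case by (intro ord_eqI) (auto simp: less_opow_iff[of 1 _ x])
      qed
      then show ?thesis using True a0 by simp
    next
      case False
      then have bc: "olimit (b * c)" using 3 olimit_mult_right by simp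
      show ?thesis
      proof (rule ord_eqI)
        fix z
        have "z < opow a (b * c) \<longleftrightarrow> (\<exists>e<b * c. z < opow a e)" by (rule opow_limit[OF a0 bc])
        also have "\<dots> \<longleftrightarrow> (\<exists>d<c. z < opow a (b * d))"
        proof
          assume "\<exists>e<b * c. z < opow a e"
          then obtain e d where "d < c" "e < b * d" "z < opow a e" using ord_mult_limit[OF 3] by blast
          then show "\<exists>d<c. z < opow a (b * d)"
            using opow_mono[OF a0] order_less_imp_le order_less_le_trans by meson
        next
          assume "\<exists>d<c. z < opow a (b * d)"
          then show "\<exists>e<b * c. z < opow a e" using False ord_mult_strict_left_mono by (metis ord_pos_iff)
        qed
        also have "\<dots> \<longleftrightarrow> (\<exists>d<c. z < opow (opow a b) d)" using less by metis
        also have "\<dots> \<longleftrightarrow> z < opow (opow a b) c" using opow_limit[OF p 3] by blast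
        finally show "z < opow a (b * c) \<longleftrightarrow> z < opow (opow a b) c" .
      qed
    qed
  qed (use a0 in simp)
qed

lemma opow_base_mono: "0 < a \<Longrightarrow> a \<le> b \<Longrightarrow> opow a c \<le> opow b c"
proof (induction c rule: less_induct)
  case (less c)
  have b0: "0 < b" using less.prems order_less_le_trans by blast
  have "z < opow b c" if z: "z < opow a c" for z
  proof -
    consider "z = 0" | d where "d < c" "z < opow a d * a" using z less.prems less_opow_iff by blast
    then show ?thesis
    proof cases
      case (2 d)
      have "opow a d * a \<le> opow b d * b" using less 2 by (intro ord_mult_mono) auto
      then show ?thesis using 2 less_opow_iff[OF b0] order_less_le_trans by blast
    qed (use b0 in simp)
  qed
  then show ?case by (meson leI order_less_irrefl)
qed

subsection \<open>Additive principal ordinals\<close>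

definition add_princ :: "ord \<Rightarrow> bool" where
  "add_princ p \<longleftrightarrow> p \<noteq> 0 \<and> (\<forall>x<p. \<forall>y<p. x + y < p)"

lemma add_princ_less: "add_princ p \<Longrightarrow> x < p \<Longrightarrow> y < p \<Longrightarrow> x + y < p"
  by (simp add: add_princ_def)

lemma add_princ_absorb: "add_princ p \<Longrightarrow> x < p \<Longrightarrow> x + p = p"
proof -
  assume p: "add_princ p" and x: "x < p"
  then obtain r where r: "p = x + r" using ord_le_iff_add order_less_imp_le by blast
  have "\<not> r < p" using p x r add_princ_less order_less_irrefl by metis
  moreover have "r \<le> p" using r by simp
  ultimately show "x + p = p" using r by (metis order_antisym linorder_not_less)
qed

lemma add_princ_absorb_le: "add_princ p \<Longrightarrow> x < p \<Longrightarrow> p \<le> y \<Longrightarrow> x + y = y"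
  by (metis add.assoc add_princ_absorb ord_le_iff_add)

text \<open>Induction on a. At a successor, summands below p^b c and p^b d with c, d < p have a sum
  below p^b (c + d), and c + d < p; at a limit both lie below a common smaller power.\<close>

lemma add_princ_opow:
  assumes p: "add_princ p" and p1: "1 < p" shows "add_princ (opow p a)"
proof -
  have p0: "0 < p" "p \<noteq> 0" using p by (auto simp: add_princ_def)
  have lim: "x + y < opow p a" if x: "x < opow p a" and y: "y < opow p a" for x y
    using that
  proof (induction a arbitrary: x y rule: less_induct)
    case (less a)
    show ?case
    proof (cases a rule: ord_cases)
      case 1 then show ?thesis using less p0 by simp
    next
      case (2 b)
      then have "x < opow p b * p" "y < opow p b * p" using less p0 by (auto simp: opow_osucc)
      then obtain c d where c: "c < p" "x < opow p b * c + opow p b"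
        and d: "d < p" "y < opow p b * d + opow p b"
        unfolding less_times_iff' by blast
      have q: "1 < p \<and> olimit p" using p p1 by (auto intro!: olimitI simp: add_princ_def simp del: ord_add_1
          simp flip: ord_add_1)
      have "x < opow p b * osucc c" "y < opow p b * osucc d" using c d by auto
      then have "x + y < opow p b * osucc c + opow p b * osucc d"
        by (meson ord_add_right_mono ord_add_strict_left_mono order_le_less_trans order_less_imp_le)
      also have "\<dots> = opow p b * (osucc c + osucc d)" by (simp only: ord_distrib_left)
      also have "\<dots> \<le> opow p b * p"
        using q c d p add_princ_less olimit_succ_less by (intro ord_mult_left_mono order_less_imp_le) blast
      finally show ?thesis using 2 p0 by (simp add: opow_osucc)
    next
      case 3
      then obtain c d where c: "c < a" "x < opow p c" and d: "d < a" "y < opow p d"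
        using less.prems opow_limit[OF p0(1)] by blast
      define e where "e = max c d"
      have e: "e < a" "x < opow p e" "y < opow p e"
        using c d opow_mono[OF p0(1), of c e] opow_mono[OF p0(1), of d e] unfolding e_def by auto
      then have "x + y < opow p e" using less.IH by blast
      then show ?thesis using e opow_strict_mono[OF p1, of e a] order_less_trans by blast
    qed
  qed
  then show ?thesis using p0 by (simp add: add_princ_def)
qed

lemma olimit_add_princ: "add_princ p \<Longrightarrow> 1 < p \<Longrightarrow> olimit p"
  using add_princ_less[of p _ 1] by (intro olimitI) (auto simp: add_princ_def)

subsection \<open>The ordinals omega and Omega\<close>

text \<open>Makes the LEAST in the definition of \<open>Omega\<close> meaningful. The cardinal order
  of \<open>nat set\<close> is isomorphic to a proper initial segment of that of
  \<open>nat set set\<close>, on which the type is built; by Cantor's theorem this segment is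
  uncountable.\<close>

lemma Omega_ex: "\<exists>x::ord. \<not> countable {y. y < x}"
proof (rule ccontr)
  assume "\<not> ?thesis"
  then have c: "countable {y. y < (x::ord)}" for x by blast
  let ?r = "card_of (UNIV :: nat set set set)"
  have "ordLess2 (card_of (UNIV :: nat set set)) ?r" by (rule card_of_Pow[of UNIV, unfolded Pow_UNIV])
  then obtain a where a: "ordIso2 (card_of (UNIV :: nat set set)) (Restr ?r (underS ?r a))"
    unfolding ordLess_iff_ordIso_Restr[OF card_of_Well_order card_of_Well_order] by (rule bexE)
  have "bij Rep_ord" by (metis Abs_ord_inverse UNIV_I bij_def inj_Rep_ord surj_def)
  have "underS ?r a \<subseteq> Rep_ord ` {y. y < Abs_ord a}"
  proof
    fix b assume "b \<in> underS ?r a"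
    then have "Abs_ord b < Abs_ord a"
      by (auto simp: underS_def less_ord_def less_eq_ord_def ord_rel_def Abs_ord_inverse Abs_ord_inject)
    then show "b \<in> Rep_ord ` {y. y < Abs_ord a}"
      by (intro image_eqI[of _ _ "Abs_ord b"]) (auto simp: Abs_ord_inverse)
  qed
  then have cu: "countable (underS ?r a)" by (rule countable_subset) (intro countable_image c)
  have "Field (Restr ?r (underS ?r a)) \<subseteq> underS ?r a" by (auto simp: Field_def)
  then have "countable (Field (Restr ?r (underS ?r a)))" using cu by (rule countable_subset)
  moreover have "\<exists>f. bij_betw f (UNIV :: nat set set) (Field (Restr ?r (underS ?r a)))"
    using a unfolding ordIso_def iso_def by (auto simp: Field_card_of)
  ultimately have "countable (UNIV :: nat set set)"
    using countable_image_inj_on unfolding bij_betw_def by (metis (no_types, lifting))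
  then obtain g :: "nat \<Rightarrow> nat set" where "range g = UNIV"
    using uncountable_def by (metis UNIV_not_empty)
  then show False using Cantors_theorem by (metis Pow_UNIV)
qed

lemma less_Omega_iff: "x < Omega \<longleftrightarrow> countable {y. y < x}"
proof
  show "x < Omega \<Longrightarrow> countable {y. y < x}" unfolding Omega_def using not_less_Least by blast
  have nc: "\<not> countable {y. y < Omega}" unfolding Omega_def using Omega_ex by (rule LeastI_ex)
  assume c: "countable {y. y < x}"
  show "x < Omega"
  proof (rule ccontr)
    assume "\<not> x < Omega"
    then have "{y. y < Omega} \<subseteq> {y. y < x}" by auto
    then have "countable {y. y < Omega}" using c by (rule countable_subset)
    then show False using nc by blast
  qed
qed

lemma uncountable_Omega: "\<not> countable {y. y < Omega}"
  using less_Omega_iff by blast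

text \<open>Regularity of \<open>Omega\<close> for countable sets: a countable union of countable
  segments cannot exhaust the uncountable segment below \<open>Omega\<close>.\<close>

lemma countable_bounded_Omega:
  assumes "countable S" "\<And>x. x \<in> S \<Longrightarrow> x < Omega"
  shows "\<exists>u<Omega. \<forall>x\<in>S. x \<le> u"
proof -
  have "countable (\<Union>x\<in>S. {y. y < x})" using assms by (auto simp: less_Omega_iff)
  then have "\<not> {y. y < Omega} \<subseteq> (\<Union>x\<in>S. {y. y < x})"
    using uncountable_Omega by (auto dest: countable_subset)
  then obtain u where "u < Omega" "u \<notin> (\<Union>x\<in>S. {y. y < x})" by auto
  then show ?thesis by (auto simp: not_less)
qed

lemma osup_less_Omega:
  assumes "countable S" "\<And>x. x \<in> S \<Longrightarrow> x < Omega" shows "osup S < Omega"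
  by (meson countable_bounded_Omega[OF assms] osup_least order_le_less_trans)

lemma bdd_above_countable:
  "countable S \<Longrightarrow> (\<And>x. x \<in> S \<Longrightarrow> x < Omega) \<Longrightarrow> bdd_above S"
  using countable_bounded_Omega unfolding bdd_above_def by blast

lemma zero_less_Omega: "0 < Omega" by (subst less_Omega_iff) simp

lemma Omega_neq_0 [simp]: "Omega \<noteq> 0" using zero_less_Omega by simp

lemma osucc_less_Omega [simp]: "osucc x < Omega \<longleftrightarrow> x < Omega"
proof -
  have "{y. y < osucc x} = insert x {y. y < x}" by (auto simp: less_osucc_iff)
  then show ?thesis by (simp add: less_Omega_iff)
qed

lemma one_less_Omega [simp]: "1 < Omega"
  by (simp add: one_ord_def)

lemma olimit_Omega [simp]: "olimit Omega"
  by (rule olimitI) simp_all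

lemma add_less_Omega: "a < Omega \<Longrightarrow> b < Omega \<Longrightarrow> a + b < Omega"
proof -
  assume "a < Omega" "b < Omega"
  moreover have "{y. y < a + b} = {y. y < a} \<union> (\<lambda>c. a + c) ` {c. c < b}"
    by (auto simp: less_plus_iff[of _ a b])
  ultimately show ?thesis by (simp add: less_Omega_iff)
qed

lemma mult_less_Omega: "a < Omega \<Longrightarrow> b < Omega \<Longrightarrow> a * b < Omega"
proof -
  assume "a < Omega" "b < Omega"
  moreover have "{y. y < a * b} \<subseteq> (\<lambda>(c, d). a * c + d) ` ({c. c < b} \<times> {d. d < a})"
    by (force simp: less_times_iff[of _ a b])
  ultimately show ?thesis unfolding less_Omega_iff
    by (meson countable_SIGMA countable_image countable_subset)
qed

lemma opow_less_Omega: "0 < a \<Longrightarrow> a < Omega \<Longrightarrow> b < Omega \<Longrightarrow> opow a b < Omega"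
proof (induction b rule: less_induct)
  case (less b)
  have "opow a c * a < Omega" if "c < b" for c
    using that less by (meson mult_less_Omega order_less_trans)
  then have "countable (insert 0 (\<Union>c\<in>{c. c < b}. {y. y < opow a c * a}))"
    using less.prems by (auto simp: less_Omega_iff)
  moreover have "{y. y < opow a b} \<subseteq> insert 0 (\<Union>c\<in>{c. c < b}. {y. y < opow a c * a})"
    using less_opow_iff[OF less.prems(1), of _ b] by auto
  ultimately show ?case unfolding less_Omega_iff by (rule countable_subset[rotated])
qed

lemma add_princ_Omega: "add_princ Omega"
  by (simp add: add_princ_def add_less_Omega)

lemma onat_0 [simp]: "onat 0 = 0" by (simp add: onat_def)
lemma onat_Suc [simp]: "onat (Suc n) = osucc (onat n)" by (simp add: onat_def)

lemma onat_add: "onat (m + n) = onat m + onat n"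
  by (induction n) simp_all

lemma olimit_omega [simp]: "olimit omega"
  unfolding omega_def using olimit_Omega by (rule LeastI)

lemma omega_neq_0 [simp]: "omega \<noteq> 0" using olimit_omega olimit_neq_0 by blast

lemma onat_less_olimit: "olimit x \<Longrightarrow> onat n < x"
  by (induction n) (auto simp: olimit_neq_0 olimit_succ_less)

lemma less_omega_iff: "x < omega \<longleftrightarrow> (\<exists>n. x = onat n)"
proof
  show "x < omega \<Longrightarrow> \<exists>n. x = onat n"
  proof (induction x rule: less_induct)
    case (less x)
    have "\<not> olimit x" using less.prems unfolding omega_def using not_less_Least by blast
    then consider "x = 0" | y where "x = osucc y" by (metis ord_cases)
    then show ?case
    proof cases
      case 1 then show ?thesis using onat_0 by metis
    next
      case (2 y)
      then obtain n where "y = onat n" using less by (metis less_osucc order_less_trans)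
      then show ?thesis using 2 onat_Suc by metis
    qed
  qed
  show "\<exists>n. x = onat n \<Longrightarrow> x < omega" using onat_less_olimit by auto
qed

lemma omega_less_Omega [simp]: "omega < Omega"
proof -
  have "{y. y < omega} = range onat" by (auto simp: less_omega_iff)
  then show ?thesis by (simp add: less_Omega_iff)
qed

lemma one_less_omega [simp]: "1 < omega"
  using onat_less_olimit[OF olimit_omega, of 1] by (simp add: osucc_0)

lemma add_princ_omega: "add_princ omega"
  unfolding add_princ_def less_omega_iff using onat_add by auto metis

abbreviation Om :: "ord \<Rightarrow> ord" where "Om \<equiv> opow Omega"

lemma Om_0 [simp]: "Om 0 = 1" and Om_1 [simp]: "Om 1 = Omega"
  and Om_neq_0 [simp]: "Om a \<noteq> 0"
  by simp_all

lemma add_princ_Om: "add_princ (Om a)"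
  by (rule add_princ_opow[OF add_princ_Omega one_less_Omega])

lemmas Om_less_iff [simp] = opow_less_iff[OF one_less_Omega]
  and Om_le_iff [simp] = opow_le_iff[OF one_less_Omega]
  and Om_eq_iff [simp] = opow_eq_iff[OF one_less_Omega]
  and le_Om [simp] = le_opow[OF one_less_Omega]

lemma olimit_Om: "a \<noteq> 0 \<Longrightarrow> olimit (Om a)"
  using olimit_opow' by simp

subsection \<open>The ordinal epsilon\<close>

lemma OmN_less_Suc: "OmN n < OmN (Suc n)"
  by (induction n) auto

lemma OmN_strict_mono: "m < n \<Longrightarrow> OmN m < OmN n"
  by (rule lift_Suc_mono_less[of OmN]) (rule OmN_less_Suc)

lemma bdd_OmN: "bdd_above (range OmN)"
proof -
  obtain A where A: "big A" "seg_le A Omega" using big_ex by blast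
  have "seg_le A (OmN n)" for n
  proof (induction n)
    case 0 then show ?case using A(2) seg_le_mono[OF A(2), of 1] order_less_imp_le[OF one_less_Omega] by simp
  next
    case (Suc n) then show ?case using A seg_le_opow by simp
  qed
  moreover have "ordLeq3 (card_of (range OmN)) (card_of A)"
  proof -
    have "ordLeq3 (card_of (UNIV :: nat set)) (card_of A)" using A infinite_iff_card_of_nat by (auto simp: big_def)
    then show ?thesis using card_of_image ordLeq_transitive by blast
  qed
  ultimately show ?thesis using A by (intro seg_bdd) auto
qed

lemma less_OmN_sup: "x < osup (range OmN) \<longleftrightarrow> (\<exists>n. x < OmN n)"
  using less_osup_iff[OF bdd_OmN] by auto

text \<open>Provides the fixed point for \<open>epsOm_props\<close>: the LEAST in
  \<open>epsOm\<close> is unspecified until some e > \<open>Omega\<close> with omega^e = e is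
  exhibited.\<close>

lemma Om_OmN_sup: "Om (osup (range OmN)) = osup (range OmN)"
proof (rule ord_eqI)
  let ?e = "osup (range OmN)"
  have lim: "olimit ?e"
  proof (rule olimitI)
    show "0 < ?e" unfolding less_OmN_sup by (intro exI[of _ 0]) simp
    fix y assume "y < ?e"
    then obtain n where "y < OmN n" using less_OmN_sup by blast
    then have "osucc y < OmN (Suc n)" using OmN_less_Suc by (meson order_le_less_trans osucc_le_iff)
    then show "osucc y < ?e" using less_OmN_sup by blast
  qed
  fix z show "z < Om ?e \<longleftrightarrow> z < ?e"
  proof
    assume "z < Om ?e"
    then obtain c where "c < ?e" "z < Om c" using opow_limit[OF zero_less_Omega lim] by blast
    then obtain n where "c < OmN n" "z < Om c" using less_OmN_sup by blast
    then have "Om c < OmN (Suc n)" by simp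
    then have "z < OmN (Suc n)" using \<open>z < Om c\<close> by (meson order_less_trans)
    then show "z < ?e" using less_OmN_sup by blast
  qed (meson le_Om order_less_le_trans)
qed

lemma Omega_less_OmN_sup: "Omega < osup (range OmN)"
  unfolding less_OmN_sup using OmN_less_Suc[of 1] by (auto intro!: exI[of _ "Suc (Suc 0)"])

lemma epsOm_props: "Omega < epsOm" "opow omega epsOm = epsOm" "epsOm \<le> osup (range OmN)"
proof -
  let ?e = "osup (range OmN)"
  have "opow omega ?e \<le> Om ?e" by (rule opow_base_mono) (auto intro: order_less_imp_le)
  then have "opow omega ?e = ?e" using Om_OmN_sup le_opow[OF one_less_omega] by (metis order_antisym)
  then have P: "Omega < ?e \<and> opow omega ?e = ?e" using Omega_less_OmN_sup by blast
  then show "epsOm \<le> ?e" unfolding epsOm_def by (rule Least_le)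
  have "Omega < epsOm \<and> opow omega epsOm = epsOm" unfolding epsOm_def using P by (rule LeastI)
  then show "Omega < epsOm" "opow omega epsOm = epsOm" by auto
qed

lemma add_princ_epsOm: "add_princ epsOm"
  using add_princ_opow[OF add_princ_omega one_less_omega, of epsOm] epsOm_props(2) by simp

text \<open>\<open>epsOm\<close> is defined through base \<open>omega\<close>, the normal forms
  through base \<open>Omega\<close>. As Omega^x \<le> omega^(Omega x) and Omega x \<le> omega^(Omega
  + x), closure under powers of \<open>omega\<close> passes to powers of
  \<open>Omega\<close>.\<close>

lemma Om_less_epsOm: "x < epsOm \<Longrightarrow> Om x < epsOm"
proof -
  assume x: "x < epsOm"
  have *: "opow omega y < epsOm" if "y < epsOm" for y
    using that epsOm_props(2) opow_strict_mono[OF one_less_omega] by metis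
  have "Om x \<le> opow (opow omega Omega) x"
    using le_opow[OF one_less_omega] by (intro opow_base_mono) auto
  also have "\<dots> = opow omega (Omega * x)" by (simp add: opow_mult)
  finally have 1: "Om x \<le> opow omega (Omega * x)" .
  have "Omega * x \<le> opow omega Omega * opow omega x"
    using le_opow[OF one_less_omega] by (intro ord_mult_mono)
  also have "\<dots> = opow omega (Omega + x)" by (simp add: opow_add)
  also have "\<dots> < epsOm" using * add_princ_less[OF add_princ_epsOm epsOm_props(1) x] by blast
  finally have "Omega * x < epsOm" .
  then show ?thesis using 1 * order_le_less_trans by blast
qed

lemma OmN_less_epsOm: "OmN n < epsOm"
proof (induction n)
  case 0 show ?case using order_less_trans[OF one_less_Omega epsOm_props(1)] by simp
qed (simp add: Om_less_epsOm)

lemma less_epsOm_iff: "x < epsOm \<longleftrightarrow> (\<exists>n. x < OmN n)"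
  using less_OmN_sup epsOm_props(3) OmN_less_epsOm order_less_le_trans order_less_trans by metis

text \<open>A fixed point of Omega^x would lie above the whole tower \<open>OmN\<close>, whose
  supremum is \<open>epsOm\<close>. Consequently the exponent of a normal form below
  \<open>epsOm\<close> is smaller than the ordinal, which makes recursion and induction along normal
  forms possible.\<close>

lemma less_Om_self: "x < epsOm \<Longrightarrow> x < Om x"
proof (rule ccontr)
  assume x: "x < epsOm" and "\<not> x < Om x"
  then have "Om x = x" by (metis le_Om order_le_less)
  then have "OmN n \<le> x" for n
  proof (induction n)
    case 0
    have "x \<noteq> 0" using \<open>Om x = x\<close> by auto
    then show ?case by (simp add: ord_one_le)
  next
    case (Suc n) then show ?case by (metis Om_le_iff OmN.simps(2))
  qed
  then show False using x less_epsOm_iff linorder_not_less by blast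
qed

lemma zero_less_epsOm [simp]: "0 < epsOm"
  using epsOm_props(1) order_le_less_trans ord_zero_le by blast

lemma less_Omega_epsOm: "x < Omega \<Longrightarrow> x < epsOm"
  using epsOm_props(1) order_less_trans by blast

lemma add_less_epsOm: "x < epsOm \<Longrightarrow> y < epsOm \<Longrightarrow> x + y < epsOm"
  by (rule add_princ_less[OF add_princ_epsOm])

lemma mult_Om_less_epsOm: "x < epsOm \<Longrightarrow> y < epsOm \<Longrightarrow> Om x * y < epsOm"
proof -
  assume h: "x < epsOm" "y < epsOm"
  have "Om x * y \<le> Om x * Om y" by (intro ord_mult_left_mono) simp
  also have "\<dots> = Om (x + y)" by (simp add: opow_add)
  also have "\<dots> < epsOm" using h by (intro Om_less_epsOm add_less_epsOm)
  finally show ?thesis .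
qed

subsection \<open>Omega-normal forms\<close>

definition is_nf :: "ord \<Rightarrow> ord \<Rightarrow> ord \<Rightarrow> bool" where
  "is_nf a b c \<longleftrightarrow> b \<noteq> 0 \<and> b < Omega \<and> c < Om a"

lemma nf_eq: "is_nf a b c \<Longrightarrow> nf (Om a * b + c) = (a, b, c)"
  unfolding nf_def
proof (rule the_equality)
  fix p assume n: "is_nf a b c"
   and p: "case p of (a', b', c') \<Rightarrow> Om a * b + c = Om a' * b' + c' \<and> 0 < b' \<and> b' < Omega \<and> c' < Om a'"
  obtain a' b' c' where [simp]: "p = (a', b', c')" by (cases p)
  show "p = (a, b, c)" using opow_nf_unique[OF one_less_Omega, of a b c a' b' c'] n p
    by (auto simp: is_nf_def)
qed (simp add: is_nf_def)

lemma nf_sel [simp]: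
  "is_nf a b c \<Longrightarrow> nfE (Om a * b + c) = a"
  "is_nf a b c \<Longrightarrow> nfC (Om a * b + c) = b"
  "is_nf a b c \<Longrightarrow> nfR (Om a * b + c) = c"
  by (simp_all add: nfE_def nfC_def nfR_def nf_eq)

lemma nf_ex: "x \<noteq> 0 \<Longrightarrow> \<exists>a b c. x = Om a * b + c \<and> is_nf a b c"
  using opow_nf_ex[OF one_less_Omega, of x] by (auto simp: is_nf_def)

lemma nf_bounds: "is_nf a b c \<Longrightarrow> Om a \<le> Om a * b + c" "is_nf a b c \<Longrightarrow> Om a * b + c < Om (osucc a)"
  using opow_nf_bounds[OF zero_less_Omega, of b c a] by (auto simp: is_nf_def)

lemma nf_neq_0: "is_nf a b c \<Longrightarrow> Om a * b + c \<noteq> 0" by (simp add: is_nf_def)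

lemma nf_E_less: "is_nf a b c \<Longrightarrow> Om a * b + c < epsOm \<Longrightarrow> a < Om a * b + c"
proof -
  assume n: "is_nf a b c" and e: "Om a * b + c < epsOm"
  have "a < epsOm" using nf_bounds(1)[OF n] e le_Om order_le_less_trans order_trans by meson
  then show ?thesis using less_Om_self nf_bounds(1)[OF n] order_less_le_trans by blast
qed

lemma nf_R_less: "is_nf a b c \<Longrightarrow> c < Om a * b + c"
  using nf_bounds(1) by (metis is_nf_def order_less_le_trans)

lemma nf_induct [consumes 1, case_names zero nf]:
  assumes "x < epsOm" and "P 0"
   and step: "\<And>a b c. is_nf a b c \<Longrightarrow> Om a * b + c < epsOm \<Longrightarrow> a < epsOm \<Longrightarrow> c < epsOm \<Longrightarrow>
     P a \<Longrightarrow> P c \<Longrightarrow> P (Om a * b + c)"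
  shows "P x"
  using assms(1)
proof (induction x rule: less_induct)
  case (less x)
  show ?case
  proof (cases "x = 0")
    case False
    then obtain a b c where x: "x = Om a * b + c" and n: "is_nf a b c" using nf_ex by blast
    have "a < x" "c < x" using nf_E_less[OF n] nf_R_less[OF n] less.prems x by auto
    then show ?thesis unfolding x using less x n by (intro step) auto
  qed (use assms in simp)
qed

lemma nf_E_le: "is_nf a b c \<Longrightarrow> Om a * b + c < Om d \<longleftrightarrow> a < d"
proof
  assume n: "is_nf a b c"
  show "Om a * b + c < Om d \<Longrightarrow> a < d" using nf_bounds(1)[OF n] by (metis Om_less_iff order_le_less_trans)
  assume "a < d"
  then have "Om (osucc a) \<le> Om d" by (simp add: osucc_le_iff)
  then show "Om a * b + c < Om d" using nf_bounds(2)[OF n] by (meson order_less_le_trans)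
qed

text \<open>The recursions of \<open>Cset\<close>, \<open>tau\<close> and \<open>fsO\<close> call
  \<open>nfE xi\<close>, which need not be smaller than xi: at a fixed point of Omega^x they call
  themselves, and \<open>ordrec_eq\<close> does not apply. The equation is therefore stated with the
  values cut off at x, and the cut is removed where the arguments are known to be smaller.\<close>

lemma ordrec_cut: "ordrec F x = F (cut (ordrec F) {(x, y). x < y} x) x"
proof -
  have wf: "wf {(x, y). x < (y::ord)}" by (rule wf)
  show ?thesis unfolding ordrec_def by (rule wfrec[OF wf])
qed

lemma Cset_0 [simp]: "Cset 0 = {0}"
  unfolding Cset_def by (subst ordrec_cut) simp

lemma Cset_nf:
  assumes n: "is_nf a b c" and e: "Om a * b + c < epsOm"
  shows "Cset (Om a * b + c) = Cset a \<union> Cset c \<union> {b}"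
proof -
  have "a < Om a * b + c" "c < Om a * b + c" using nf_E_less[OF n e] nf_R_less[OF n] by auto
  then show ?thesis
    unfolding Cset_def using n nf_neq_0[OF n] by (subst ordrec_cut) (simp add: cut_apply is_nf_def)
qed

lemma Cset_props: "x < epsOm \<Longrightarrow> finite (Cset x) \<and> 0 \<in> Cset x \<and> (\<forall>y\<in>Cset x. y < Omega)"
  by (induction x rule: nf_induct) (auto simp: Cset_nf is_nf_def)

lemma finite_Cset: "x < epsOm \<Longrightarrow> finite (Cset x)"
  and zero_in_Cset [simp]: "x < epsOm \<Longrightarrow> 0 \<in> Cset x"
  and Cset_less_Omega: "x < epsOm \<Longrightarrow> y \<in> Cset x \<Longrightarrow> y < Omega"
  using Cset_props by blast+

lemma is_nf_0: "b \<noteq> 0 \<Longrightarrow> b < Omega \<Longrightarrow> is_nf 0 b 0" by (simp add: is_nf_def)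

lemma Cset_countable: "x < Omega \<Longrightarrow> Cset x = {0, x}"
  using Cset_nf[OF is_nf_0, of x] less_Omega_epsOm[of x] by (cases "x = 0") auto

lemma ostar_in: "x < epsOm \<Longrightarrow> ostar x \<in> Cset x"
  unfolding ostar_def using finite_Cset zero_in_Cset by (metis Max_in empty_iff)

lemma ostar_ge: "x < epsOm \<Longrightarrow> y \<in> Cset x \<Longrightarrow> y \<le> ostar x"
  unfolding ostar_def using finite_Cset by simp

lemma ostar_less_iff: "x < epsOm \<Longrightarrow> ostar x < y \<longleftrightarrow> (\<forall>z\<in>Cset x. z < y)"
  using ostar_in ostar_ge order_le_less_trans by blast

lemma ostar_less_Omega: "x < epsOm \<Longrightarrow> ostar x < Omega"
  using ostar_in Cset_less_Omega by blast

lemma ostar_countable [simp]: "x < Omega \<Longrightarrow> ostar x = x"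
  by (simp add: ostar_def Cset_countable max_def)

text \<open>The ordinals with all coefficients below th arise from 0 in finitely many steps Omega^a
  b + c with countably many choices of b. This countability is why a countable value Theta(x)
  exists.\<close>

lemma countable_ostar_less:
  assumes "th < Omega" shows "countable {x. x < epsOm \<and> ostar x < th}"
proof -
  define D where "D = rec_nat {0::ord} (\<lambda>_ D. D \<union> (\<lambda>(a, b, c). Om a * b + c) ` (D \<times> {b. b < th} \<times> D))"
  have D0: "D 0 = {0}" and DS: "D (Suc n) = D n \<union> (\<lambda>(a, b, c). Om a * b + c) ` (D n \<times> {b. b < th} \<times> D n)" for n
    by (simp_all add: D_def)
  have cD: "countable (D n)" for n
  proof (induction n)
    case (Suc n)
    then show ?case unfolding DS using assms
      by (intro countable_Un countable_image countable_SIGMA) (auto simp: less_Omega_iff)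
  qed (simp add: D0)
  have mono: "D m \<subseteq> D n" if "m \<le> n" for m n
    using that by (rule lift_Suc_mono_le[rotated]) (auto simp: DS)
  have "x < epsOm \<Longrightarrow> (\<forall>y\<in>Cset x. y < th) \<longrightarrow> (\<exists>n. x \<in> D n)" for x
  proof (induction x rule: nf_induct)
    case zero then show ?case using D0 by blast
  next
    case (nf a b c)
    show ?case
    proof
      assume "\<forall>y\<in>Cset (Om a * b + c). y < th"
      then obtain m n where "a \<in> D m" "c \<in> D n" "b < th" using nf by (auto simp: Cset_nf)
      then have "a \<in> D (max m n)" "c \<in> D (max m n)" using mono[of m "max m n"] mono[of n "max m n"] by auto
      then have "Om a * b + c \<in> D (Suc (max m n))" unfolding DS using \<open>b < th\<close> by force
      then show "\<exists>n. Om a * b + c \<in> D n" ..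
    qed
  qed
  then have "{x. x < epsOm \<and> ostar x < th} \<subseteq> (\<Union>n. D n)" by (auto simp: ostar_less_iff)
  moreover have "countable (\<Union>n. D n)" using cD by simp
  ultimately show ?thesis by (rule countable_subset)
qed

subsection \<open>The functions tau and x[th]\<close>

lemma le_osucc [simp]: "x \<le> osucc x"
  by (simp add: order_less_imp_le)

lemma olimit_nf: "is_nf a b c \<Longrightarrow> c \<noteq> 0 \<Longrightarrow> olimit (Om a * b + c) \<longleftrightarrow> olimit c"
  by (simp add: olimit_add_iff)

lemma tau_0 [simp]: "tau 0 = 0"
  unfolding tau_def by (subst ordrec_cut) simp

lemma tau_succ: "is_succ x \<Longrightarrow> tau x = 1"
  unfolding tau_def by (subst ordrec_cut) auto

lemma tau_nf:
  assumes n: "is_nf a b c" and e: "Om a * b + c < epsOm" and l: "olimit (Om a * b + c)"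
  shows "tau (Om a * b + c) = (if c \<noteq> 0 then tau c else if olimit b then b
    else if olimit a then tau a else Omega)"
proof -
  have "a < Om a * b + c" "c < Om a * b + c" using nf_E_less[OF n e] nf_R_less[OF n] by auto
  define F where "F = (\<lambda>f xi. if xi = 0 then 0 else if is_succ xi then 1 else if nfR xi \<noteq> 0 then f (nfR xi)
     else if olimit (nfC xi) then nfC xi else if olimit (nfE xi) then f (nfE xi) else Omega)"
  have fs: "tau x = ordrec F x" for x unfolding tau_def F_def ..
  let ?x = "Om a * b + c"
  let ?f = "cut (ordrec F) {(x, y). x < y} ?x"
  have "nfE ?x = a" "nfC ?x = b" "nfR ?x = c" "?x \<noteq> 0" "\<not> is_succ ?x"
    using n l nf_neq_0[OF n] by (simp_all add: olimit_def)
  then have F: "F f ?x = (if c \<noteq> 0 then f c else if olimit b then b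
    else if olimit a then f a else Omega)" for f
    unfolding F_def by (simp only: if_False simp_thms)
  have "tau ?x = F ?f ?x" unfolding fs by (rule ordrec_cut)
  moreover have "?f c = tau c" "?f a = tau a" using \<open>a < ?x\<close> \<open>c < ?x\<close> by (simp_all add: cut_apply fs)
  ultimately show ?thesis unfolding F by (cases "c = 0") (simp_all only: if_True if_False simp_thms)
qed

lemma fsO_unfold:
  assumes n: "is_nf a b c" and e: "Om a * b + c < epsOm" and l: "olimit (Om a * b + c)"
  shows "fsO (Om a * b + c) th =
    (if c \<noteq> 0 then Om a * b + fsO c th
     else if olimit b then Om a * th
     else if b = 1 \<and> is_succ a then Om (opred a) * th
     else if is_succ b \<and> opred b \<noteq> 0 then Om a * opred b + fsO (Om a) th
     else if b = 1 \<and> olimit a then Om (fsO a th) else 0)"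
proof -
  have 1: "Om a * b + c \<noteq> 1" using l by (auto simp: olimit_def)
  have 2: "a < Om a * b + c" "c < Om a * b + c" using nf_E_less[OF n e] nf_R_less[OF n] by auto
  have 3: "Om a < Om a * b" if "is_succ b" "opred b \<noteq> 0"
  proof -
    have "1 < b" using that by (metis is_succ_def one_ord_def opred_osucc ord_pos_iff osucc_less_iff)
    then show ?thesis using ord_mult_strict_left_mono[of 1 b "Om a"] by simp
  qed
  define F where "F = (\<lambda>f xi. if xi = 0 \<or> xi = 1 then 0
     else if nfR xi \<noteq> 0 then Om (nfE xi) * nfC xi + f (nfR xi)
     else if olimit (nfC xi) then Om (nfE xi) * th
     else if nfC xi = 1 \<and> is_succ (nfE xi) then Om (opred (nfE xi)) * th
     else if is_succ (nfC xi) \<and> opred (nfC xi) \<noteq> 0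
       then Om (nfE xi) * opred (nfC xi) + f (Om (nfE xi))
     else if nfC xi = 1 \<and> olimit (nfE xi) then Om (f (nfE xi))
     else 0)"
  have fs: "fsO x th = ordrec F x" for x unfolding fsO_def F_def ..
  let ?x = "Om a * b + c"
  let ?f = "cut (ordrec F) {(x, y). x < y} ?x"
  have "nfE ?x = a" "nfC ?x = b" "nfR ?x = c" "?x \<noteq> 0" using n nf_neq_0[OF n] by simp_all
  then have F: "F f ?x = (if c \<noteq> 0 then Om a * b + f c
     else if olimit b then Om a * th
     else if b = 1 \<and> is_succ a then Om (opred a) * th
     else if is_succ b \<and> opred b \<noteq> 0 then Om a * opred b + f (Om a)
     else if b = 1 \<and> olimit a then Om (f a) else 0)" for f
    using 1 unfolding F_def by (simp only: if_False simp_thms)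
  have "fsO ?x th = F ?f ?x" unfolding fs by (rule ordrec_cut)
  moreover have "?f c = fsO c th" "?f a = fsO a th" using 2 by (simp_all add: cut_apply fs)
  moreover have "?f (Om a) = fsO (Om a) th" if "c = 0" "is_succ b" "opred b \<noteq> 0"
    using 3 that by (simp add: cut_apply fs)
  ultimately show ?thesis
    unfolding F by (cases "c = 0"; cases "is_succ b \<and> opred b \<noteq> 0") (simp_all only: if_True if_False simp_thms split: if_splits)
qed

lemma is_nf_Om: "is_nf a 1 0" by (simp add: is_nf_def)

text \<open>The five cases are the ways in which the normal form of a limit can end. They match the
  clauses of tau and x[th], so facts about these are proved clause by clause.\<close>

lemma lim_nf_induct [consumes 2, case_names rest lim Suc mult exp]:
  assumes "olimit x" "x < epsOm"
   and R: "\<And>a b c. is_nf a b c \<Longrightarrow> olimit c \<Longrightarrow> Om a * b + c < epsOm \<Longrightarrow> c < epsOm \<Longrightarrow> P c \<Longrightarrow> P (Om a * b + c)"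
   and L: "\<And>a b. is_nf a b 0 \<Longrightarrow> olimit b \<Longrightarrow> Om a * b < epsOm \<Longrightarrow> a < epsOm \<Longrightarrow> P (Om a * b)"
   and S: "\<And>a. Om (osucc a) < epsOm \<Longrightarrow> a < epsOm \<Longrightarrow> P (Om (osucc a))"
   and M: "\<And>a b. is_nf a (osucc b) 0 \<Longrightarrow> is_nf a b 0 \<Longrightarrow> a \<noteq> 0 \<Longrightarrow> Om a * osucc b < epsOm \<Longrightarrow> Om a < epsOm \<Longrightarrow> P (Om a) \<Longrightarrow> P (Om a * osucc b)"
   and E: "\<And>a. olimit a \<Longrightarrow> Om a < epsOm \<Longrightarrow> a < epsOm \<Longrightarrow> P a \<Longrightarrow> P (Om a)"
  shows "P x"
  using assms(1,2)
proof (induction x rule: less_induct)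
  case (less x)
  obtain a b c where x: "x = Om a * b + c" and n: "is_nf a b c"
    using nf_ex less.prems olimit_neq_0 by blast
  have lt: "a < x" "c < x" using nf_E_less[OF n] nf_R_less[OF n] less.prems x by auto
  have eps: "a < epsOm" "c < epsOm" using lt less.prems by auto
  show ?case
  proof (cases "c = 0")
    case False
    then have "olimit c" using olimit_nf[OF n] less.prems x by simp
    then show ?thesis using R[OF n, folded x] less lt eps by blast
  next
    case [simp]: True
    have n0: "is_nf a b 0" using n by simp
    show ?thesis
    proof (cases b rule: ord_cases)
      case 1 then show ?thesis using n by (simp add: is_nf_def)
    next
      case 3 then show ?thesis using L[of a b] n less.prems eps x by simp
    next
      case (2 b')
      show ?thesis
      proof (cases "b' = 0")
        case True
        then have [simp]: "x = Om a" using x 2 by simp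
        show ?thesis
        proof (cases a rule: ord_cases)
          case 1 then show ?thesis using less.prems by (auto simp: olimit_def)
        next
          case (2 a')
          have "a' < epsOm" using eps 2 less_osucc order_less_trans by blast
          then show ?thesis using 2 S[of a'] less.prems by simp
        next
          case 3
          show ?thesis using E[OF 3] less.prems eps less.IH[OF lt(1) 3] by simp
        qed
      next
        case False
        have a0: "a \<noteq> 0" using x 2 less.prems by auto
        have "Om a * 1 < Om a * b" using False 2
          by (intro ord_mult_strict_left_mono) (auto simp flip: osucc_0)
        then have "Om a < x" using x by simp
        then have "P (Om a)" using less olimit_Om[OF a0] order_less_trans by blast
        moreover have "is_nf a b' 0" using n 2 False less_osucc order_less_trans by (auto simp: is_nf_def)
        ultimately show ?thesis using M[of a b'] n0 2 False a0 less.prems x \<open>Om a < x\<close> order_less_trans by simp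
      qed
    qed
  qed
qed

lemma tau_fsO_rest: "is_nf a b c \<Longrightarrow> olimit c \<Longrightarrow> Om a * b + c < epsOm \<Longrightarrow>
    tau (Om a * b + c) = tau c \<and> fsO (Om a * b + c) th = Om a * b + fsO c th"
  using tau_nf[of a b c] fsO_unfold[of a b c th] olimit_neq_0[of c] by (simp add: olimit_add)

lemma tau_fsO_lim: "is_nf a b 0 \<Longrightarrow> olimit b \<Longrightarrow> Om a * b < epsOm \<Longrightarrow>
    tau (Om a * b) = b \<and> fsO (Om a * b) th = Om a * th"
  using tau_nf[of a b 0] fsO_unfold[of a b 0 th] by (simp add: olimit_mult_right)

lemma tau_fsO_Suc: "Om (osucc a) < epsOm \<Longrightarrow>
    tau (Om (osucc a)) = Omega \<and> fsO (Om (osucc a)) th = Om a * th"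
  using tau_nf[OF is_nf_Om, of "osucc a"] fsO_unfold[OF is_nf_Om, of "osucc a" th] olimit_Om[of "osucc a"]
  by (simp add: olimit_def)

lemma tau_fsO_exp: "olimit a \<Longrightarrow> Om a < epsOm \<Longrightarrow> tau (Om a) = tau a \<and> fsO (Om a) th = Om (fsO a th)"
  using tau_nf[OF is_nf_Om, of a] fsO_unfold[OF is_nf_Om, of a th] olimit_Om[of a] olimit_neq_0[of a]
  by (simp add: olimit_def)

lemma tau_fsO_mult: "is_nf a (osucc b) 0 \<Longrightarrow> is_nf a b 0 \<Longrightarrow> a \<noteq> 0 \<Longrightarrow> Om a * osucc b < epsOm \<Longrightarrow>
    tau (Om a * osucc b) = tau (Om a) \<and> fsO (Om a * osucc b) th = Om a * b + fsO (Om a) th"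
proof -
  assume n: "is_nf a (osucc b) 0" "is_nf a b 0" "a \<noteq> 0" and e: "Om a * osucc b < epsOm"
  have l: "olimit (Om a * osucc b)" using n olimit_mult_left[OF olimit_Om, of a "osucc b"] by simp
  have "Om a \<le> Om a * osucc b" by simp
  then have e': "Om a < epsOm" using e by (rule order_le_less_trans)
  have b: "osucc b \<noteq> 1" "b \<noteq> 0" using n(2) by (auto simp: is_nf_def one_ord_def)
  show ?thesis
    using tau_nf[OF is_nf_Om, of a] tau_nf[OF n(1)] fsO_unfold[OF n(1)] e e' l olimit_Om[OF n(3)] b
    by (simp add: olimit_def[of 1])
qed

lemma Cset_Om_mult: "is_nf a b 0 \<Longrightarrow> Om a * b < epsOm \<Longrightarrow> Cset (Om a * b) = Cset a \<union> {0, b}"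
  using Cset_nf[of a b 0] by auto

lemma Cset_Om: "Om a < epsOm \<Longrightarrow> Cset (Om a) = Cset a \<union> {0, 1}"
  using Cset_Om_mult[OF is_nf_Om, of a] by simp

lemma tau_limit: "olimit x \<Longrightarrow> x < epsOm \<Longrightarrow>
   tau x = Omega \<or> (olimit (tau x) \<and> tau x < Omega \<and> tau x \<in> Cset x)"
proof (induction x rule: lim_nf_induct)
  case (rest a b c) then show ?case using tau_fsO_rest[of a b c] by (auto simp: Cset_nf)
next
  case (lim a b) then show ?case using tau_fsO_lim[of a b] by (auto simp: Cset_Om_mult is_nf_def)
next
  case (Suc a) then show ?case using tau_fsO_Suc[of a] by auto
next
  case (mult a b)
  have "tau (Om a * osucc b) = tau (Om a)" using tau_fsO_mult[of a b] mult by blast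
  moreover have "Cset (Om a * osucc b) = Cset a \<union> {0, osucc b}" using Cset_Om_mult mult by blast
  moreover have "Cset (Om a) = Cset a \<union> {0, 1}" using Cset_Om mult by blast
  \<comment> \<open>The coefficient 1 of \<open>Om a\<close> is not a limit, so a countable
    \<open>tau (Om a)\<close> comes from \<open>Cset a\<close>.\<close>
  ultimately show ?case using mult.IH by (auto simp: olimit_def simp del: ord_mult_osucc)
next
  case (exp a) then show ?case using tau_fsO_exp[of a] by (auto simp: Cset_Om)
qed

lemma olimit_tau: "olimit x \<Longrightarrow> x < epsOm \<Longrightarrow> olimit (tau x)"
  using tau_limit by fastforce

lemma tau_le_Omega: "x < epsOm \<Longrightarrow> tau x \<le> Omega"
  by (cases x rule: ord_cases)
    (auto simp: tau_succ is_succ_def intro: order_less_imp_le dest: tau_limit)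

lemma fsO_less: "olimit x \<Longrightarrow> x < epsOm \<Longrightarrow> th < tau x \<Longrightarrow> fsO x th < x"
proof (induction x rule: lim_nf_induct)
  case (rest a b c) then show ?case using tau_fsO_rest[of a b c] by simp
next
  case (lim a b) then show ?case using tau_fsO_lim[of a b] by simp
next
  case (Suc a) then show ?case using tau_fsO_Suc[of a] by (simp add: opow_osucc)
next
  case (mult a b) then show ?case using tau_fsO_mult[of a b] by simp
next
  case (exp a) then show ?case using tau_fsO_exp[of a] by simp
qed

lemma nf_less_cases:
  assumes n: "is_nf a b c" and z: "z < Om a * b + c"
  obtains "z < Om a * b" | z' where "z = Om a * b + z'" "z' < c"
  using z less_plus_iff by blast

lemma less_Om_mult_cases:
  assumes z: "z < Om a * b" "z \<noteq> 0" "z < epsOm" and b: "b \<le> Omega"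
  obtains "z < Om a" | d z' where "z = Om a * d + z'" "is_nf a d z'" "d < b" "d \<in> Cset z"
proof -
  obtain d z' where d: "d < b" "z' < Om a" "z = Om a * d + z'" using z less_times_iff by blast
  show ?thesis
  proof (cases "d = 0")
    case True then show ?thesis using d that by simp
  next
    case False
    then have n: "is_nf a d z'" using d b by (auto simp: is_nf_def)
    then have "d \<in> Cset z" using Cset_nf[OF n] d z by auto
    then show ?thesis using n d that by blast
  qed
qed

text \<open>The comparison of z with x follows the normal form down to the place where th is
  inserted. Either z is already smaller before that place, or its coefficient there is less than
  tau(x) and belongs to \<open>Cset z\<close>, so that the premise applies.\<close>

lemma less_fsO:
  "olimit x \<Longrightarrow> x < epsOm \<Longrightarrow> z < x \<Longrightarrow> (\<And>d. d \<in> Cset z \<Longrightarrow> d < tau x \<Longrightarrow> d < th) \<Longrightarrow> z < fsO x th"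
proof (induction x arbitrary: z rule: lim_nf_induct)
  case (rest a b c)
  note t = tau_fsO_rest[OF rest(1,2,3), of th]
  show ?case
  proof (rule nf_less_cases[OF rest(1) rest(6)])
    assume "z < Om a * b"
    then show ?thesis using t by (metis ord_le_add1 order_less_le_trans)
  next
    fix z' assume z: "z = Om a * b + z'" "z' < c"
    then have "is_nf a b z'" using rest(1) by (auto simp: is_nf_def)
    then have "Cset z' \<subseteq> Cset z" using Cset_nf z rest(3,6) order_less_trans by blast
    then have "z' < fsO c th" using rest z t by (intro rest.IH) auto
    then show ?thesis using t z by simp
  qed
next
  case (lim a b)
  note t = tau_fsO_lim[OF lim(1,2,3), of th]
  have ze: "z < epsOm" using lim by (meson order_less_trans)
  \<comment> \<open>0 is a coefficient of every ordinal below \<open>epsOm\<close>, so the premise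
    at d = 0 makes th positive.\<close>
  have th: "0 < th" using lim(6)[of 0] t lim(2) ze olimit_pos by simp
  have b: "b \<le> Omega" using lim(1) by (auto simp: is_nf_def intro: order_less_imp_le)
  show ?case
  proof (cases "z = 0")
    case True then show ?thesis using t th by simp
  next
    case False
    show ?thesis
    proof (rule less_Om_mult_cases[OF lim(5) False ze b])
      assume "z < Om a"
      moreover have "Om a \<le> Om a * th" using th by simp
      ultimately show ?thesis using t by simp
    next
      fix d z' assume d: "z = Om a * d + z'" "is_nf a d z'" "d < b" "d \<in> Cset z"
      then have "d < th" using lim(6) t by simp
      then have "z < Om a * th + 0" unfolding d(1) using d(2) by (intro ord_mult_add_less) (auto simp: is_nf_def)
      then show ?thesis using t by simp
    qed
  qed
next
  case (Suc a)
  note t = tau_fsO_Suc[OF Suc(1), of th]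
  have ze: "z < epsOm" using Suc by (meson order_less_trans)
  have th: "0 < th" using Suc(4)[of 0] t ze by simp
  have zz: "z < Om a * Omega" using Suc(3) by (simp add: opow_osucc)
  show ?case
  proof (cases "z = 0")
    case True then show ?thesis using t th by simp
  next
    case False
    show ?thesis
    proof (rule less_Om_mult_cases[OF zz False ze order_refl])
      assume "z < Om a"
      moreover have "Om a \<le> Om a * th" using th by simp
      ultimately show ?thesis using t by simp
    next
      fix d z' assume d: "z = Om a * d + z'" "is_nf a d z'" "d < Omega" "d \<in> Cset z"
      then have "d < th" using Suc(4) t by simp
      then have "z < Om a * th + 0" unfolding d(1) using d(2) by (intro ord_mult_add_less) (auto simp: is_nf_def)
      then show ?thesis using t by simp
    qed
  qed
next
  case (mult a b)
  note t = tau_fsO_mult[OF mult(1,2,3,4), of th]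
  show ?case
  proof (cases "z < Om a * b")
    case True then show ?thesis using t by (metis ord_le_add1 order_less_le_trans)
  next
    case False
    then obtain z' where z: "z = Om a * b + z'" "z' < Om a"
      using mult(7) ord_less_add_imp by (metis linorder_not_less ord_mult_osucc)
    then have n: "is_nf a b z'" using mult(2) by (auto simp: is_nf_def)
    have "z < epsOm" using mult by (meson order_less_trans)
    then have "Cset z' \<subseteq> Cset z" using Cset_nf[OF n] z by auto
    then have "z' < fsO (Om a) th" using mult z t by (intro mult.IH) auto
    then show ?thesis using t z by simp
  qed
next
  case (exp a)
  note t = tau_fsO_exp[OF exp(1,2), of th]
  show ?case
  proof (cases "z = 0")
    case False
    then obtain a' b' c' where z: "z = Om a' * b' + c'" and n: "is_nf a' b' c'" using nf_ex by blast
    have "a' < a" using nf_E_le[OF n, of a] z exp(5) by simp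
    have "z < epsOm" using exp by (meson order_less_trans)
    then have "Cset a' \<subseteq> Cset z" using Cset_nf[OF n] z by auto
    then have "a' < fsO a th" using exp \<open>a' < a\<close> t by (intro exp.IH) auto
    then show ?thesis using t z nf_E_le[OF n] by simp
  qed (use t in simp)
qed

lemma fsO_pos: "olimit x \<Longrightarrow> x < epsOm \<Longrightarrow> 0 < th \<Longrightarrow> 0 < fsO x th"
  by (rule less_fsO) (auto simp: olimit_neq_0)

text \<open>Adding 1 either raises the last coefficient by 1 or appends a new coefficient 1, which
  is covered by the coefficient 0.\<close>

lemma Cset_osucc: "a < epsOm \<Longrightarrow> \<forall>c\<in>Cset (osucc a). \<exists>d\<in>Cset a. c \<le> osucc d"
proof (induction a rule: nf_induct)
  case zero
  have "Cset (osucc 0) = {0, 1}" by (simp add: osucc_0 Cset_countable)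
  then show ?case by (auto simp: osucc_0)
next
  case (nf a b c)
  show ?case
  proof (cases "a = 0")
    case True
    then have [simp]: "c = 0" "b < Omega" using nf(1) by (auto simp: is_nf_def)
    show ?thesis using True by (auto simp: Cset_countable)
  next
    case False
    then have n': "is_nf a b (osucc c)" using nf(1) olimit_Om[OF False] olimit_succ_less by (auto simp: is_nf_def)
    have "Om a * b + osucc c < epsOm" using nf(2) olimit_succ_less[OF olimit_add_princ[OF add_princ_epsOm]]
      order_less_trans[OF one_less_Omega epsOm_props(1)] by simp
    then have "Cset (osucc (Om a * b + c)) = Cset a \<union> Cset (osucc c) \<union> {b}"
      using Cset_nf[OF n'] by simp
    moreover have "Cset (Om a * b + c) = Cset a \<union> Cset c \<union> {b}" by (rule Cset_nf[OF nf(1,2)])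
    ultimately have C: "Cset (osucc (Om a * b + c)) = Cset a \<union> Cset (osucc c) \<union> {b}"
      "Cset (Om a * b + c) = Cset a \<union> Cset c \<union> {b}" .
    show ?thesis
    proof
      fix y assume "y \<in> Cset (osucc (Om a * b + c))"
      then consider "y \<in> Cset a" | "y \<in> Cset (osucc c)" | "y = b" unfolding C by blast
      then show "\<exists>d\<in>Cset (Om a * b + c). y \<le> osucc d"
      proof cases
        case 2
        then obtain d where "d \<in> Cset c" "y \<le> osucc d" using nf.IH(2) by blast
        then show ?thesis unfolding C by blast
      qed (unfold C, rule bexI[of _ y], auto)+
    qed
  qed
qed

lemma covers_Un:
  assumes "\<forall>c\<in>A. P c \<or> (\<exists>d\<in>D. c \<le> osucc d)"
  shows "\<forall>c\<in>B \<union> A \<union> {b}. P c \<or> (\<exists>d\<in>B \<union> D \<union> {b}. c \<le> osucc d)"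
proof
  fix c assume "c \<in> B \<union> A \<union> {b}"
  then consider "c \<in> B \<union> {b}" | "c \<in> A" by blast
  then show "P c \<or> (\<exists>d\<in>B \<union> D \<union> {b}. c \<le> osucc d)"
  proof cases
    case 1 then show ?thesis by (intro disjI2 bexI[of _ c]) auto
  next
    case 2 then show ?thesis using assms by blast
  qed
qed

text \<open>The set D collects the coefficients of x that survive in x[th].\<close>
lemma Cset_fsO: "olimit x \<Longrightarrow> x < epsOm \<Longrightarrow> \<exists>D. 0 \<in> D \<and> (\<forall>th. 0 < th \<longrightarrow> th < tau x \<longrightarrow> Cset (fsO x th) = insert th D) \<and>
   (\<forall>c\<in>Cset x. (c = tau x \<and> tau x < Omega) \<or> (\<exists>d\<in>D. c \<le> osucc d))"
proof (induction x rule: lim_nf_induct)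
  case (rest a b c)
  note t = tau_fsO_rest[OF rest(1,2,3)]
  obtain D where D: "0 \<in> D" "\<forall>th. 0 < th \<longrightarrow> th < tau c \<longrightarrow> Cset (fsO c th) = insert th D"
   "\<forall>c'\<in>Cset c. (c' = tau c \<and> tau c < Omega) \<or> (\<exists>d\<in>D. c' \<le> osucc d)" using rest.IH by blast
  have "Cset (Om a * b + fsO c th) = Cset a \<union> Cset (fsO c th) \<union> {b}" if "th < tau c" for th
  proof (rule Cset_nf)
    have "fsO c th < c" using fsO_less that rest by blast
    then show "is_nf a b (fsO c th)" using rest(1) by (auto simp: is_nf_def)
    have "Om a * b + fsO c th < Om a * b + c" using \<open>fsO c th < c\<close> by simp
    then show "Om a * b + fsO c th < epsOm" using rest(3) by (rule order_less_trans)
  qed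
  then have A: "\<forall>th. 0 < th \<longrightarrow> th < tau (Om a * b + c) \<longrightarrow>
      Cset (fsO (Om a * b + c) th) = insert th (Cset a \<union> D \<union> {b})"
    using D(2) t by auto
  have C: "Cset (Om a * b + c) = Cset a \<union> Cset c \<union> {b}" by (rule Cset_nf[OF rest(1,3)])
  have B: "\<forall>c'\<in>Cset (Om a * b + c). (c' = tau (Om a * b + c) \<and> tau (Om a * b + c) < Omega) \<or>
      (\<exists>d\<in>Cset a \<union> D \<union> {b}. c' \<le> osucc d)"
    unfolding t[THEN conjunct1] C by (rule covers_Un[where P = "\<lambda>c'. c' = tau c \<and> tau c < Omega"]) (rule D(3))
  show ?case by (intro exI[of _ "Cset a \<union> D \<union> {b}"] conjI A B) (use D(1) in blast)
next
  case (lim a b)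
  note t = tau_fsO_lim[OF lim(1,2,3)]
  have C: "Cset (Om a * th) = Cset a \<union> {0, th}" if "0 < th" "th < b" for th
    using that lim(1) mult_Om_less_epsOm[OF lim(4), of th] less_Omega_epsOm[of th]
    by (intro Cset_Om_mult) (auto simp: is_nf_def)
  moreover have "\<exists>d\<in>Cset a. c \<le> osucc d" if "c \<in> Cset a" for c using that le_osucc by blast
  ultimately show ?case using t zero_in_Cset[OF lim(4)] lim(1) 
    by (intro exI[of _ "Cset a"]) (auto simp: Cset_Om_mult[OF lim(1,3)] is_nf_def)
next
  case (Suc a)
  note t = tau_fsO_Suc[OF Suc(1)]
  have C: "Cset (Om a * th) = Cset a \<union> {0, th}" if "0 < th" "th < Omega" for th
    using that mult_Om_less_epsOm[OF Suc(2), of th] less_Omega_epsOm[of th]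
    by (intro Cset_Om_mult) (auto simp: is_nf_def)
  \<comment> \<open>The coefficient 1 of Omega^(a+1) disappears in Omega^a th; the element 0 of D
    covers it, and \<open>Cset_osucc\<close> covers the coefficients of a + 1.\<close>
  have "1 \<le> osucc 0" by (simp add: osucc_0)
  then show ?case using t C zero_in_Cset[OF Suc(2)] Cset_osucc[OF Suc(2)]
    by (intro exI[of _ "Cset a"]) (auto simp: Cset_Om[OF Suc(1)])
next
  case (mult a b)
  note t = tau_fsO_mult[OF mult(1,2,3,4)]
  obtain D where D: "0 \<in> D" "\<forall>th. 0 < th \<longrightarrow> th < tau (Om a) \<longrightarrow> Cset (fsO (Om a) th) = insert th D"
   "\<forall>c'\<in>Cset (Om a). (c' = tau (Om a) \<and> tau (Om a) < Omega) \<or> (\<exists>d\<in>D. c' \<le> osucc d)" using mult.IH by blast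
  have "Cset (Om a * b + fsO (Om a) th) = Cset a \<union> Cset (fsO (Om a) th) \<union> {b}" if "th < tau (Om a)" for th
  proof (rule Cset_nf)
    have l: "fsO (Om a) th < Om a" using fsO_less that mult olimit_Om by blast
    then show "is_nf a b (fsO (Om a) th)" using mult(2) by (auto simp: is_nf_def)
    have "Om a * b + fsO (Om a) th < Om a * osucc b" using l by simp
    then show "Om a * b + fsO (Om a) th < epsOm" using mult(4) by (rule order_less_trans)
  qed
  then have A: "\<forall>th. 0 < th \<longrightarrow> th < tau (Om a * osucc b) \<longrightarrow>
      Cset (fsO (Om a * osucc b) th) = insert th (Cset a \<union> D \<union> {b})"
    using D(2) t by (auto simp del: ord_mult_osucc)
  have "Cset (Om a * osucc b) = Cset a \<union> {0, osucc b}" by (rule Cset_Om_mult[OF mult(1,4)])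
  \<comment> \<open>Here \<open>osucc b\<close> is lowered to b: one source of the
    \<open>osucc d\<close> in the statement.\<close>
  then have "\<forall>c'\<in>Cset (Om a * osucc b). \<exists>d\<in>Cset a \<union> D \<union> {b}. c' \<le> osucc d"
  proof (intro ballI)
    fix c' assume C: "Cset (Om a * osucc b) = Cset a \<union> {0, osucc b}" and "c' \<in> Cset (Om a * osucc b)"
    then consider "c' \<in> Cset a \<union> {0}" | "c' = osucc b" by blast
    then show "\<exists>d\<in>Cset a \<union> D \<union> {b}. c' \<le> osucc d"
      by cases (use D(1) in \<open>auto intro: bexI[of _ c'] bexI[of _ b]\<close>)
  qed
  then have B: "\<forall>c'\<in>Cset (Om a * osucc b). (c' = tau (Om a * osucc b) \<and> tau (Om a * osucc b) < Omega) \<or>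
      (\<exists>d\<in>Cset a \<union> D \<union> {b}. c' \<le> osucc d)" by blast
  show ?case by (intro exI[of _ "Cset a \<union> D \<union> {b}"] conjI A B) (use D(1) in blast)
next
  case (exp a)
  note t = tau_fsO_exp[OF exp(1,2)]
  obtain D where D: "0 \<in> D" "\<forall>th. 0 < th \<longrightarrow> th < tau a \<longrightarrow> Cset (fsO a th) = insert th D"
   "\<forall>c'\<in>Cset a. (c' = tau a \<and> tau a < Omega) \<or> (\<exists>d\<in>D. c' \<le> osucc d)" using exp.IH by blast
  have "Cset (Om (fsO a th)) = Cset (fsO a th) \<union> {0, 1}" if "th < tau a" for th
    using order_less_trans[OF fsO_less[OF exp(1,3) that] exp(3)] by (intro Cset_Om Om_less_epsOm)
  then have A: "\<forall>th. 0 < th \<longrightarrow> th < tau (Om a) \<longrightarrow> Cset (fsO (Om a) th) = insert th (D \<union> {1})"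
    using D(1,2) t by auto
  have B: "\<forall>c\<in>Cset (Om a). (c = tau (Om a) \<and> tau (Om a) < Omega) \<or> (\<exists>d\<in>D \<union> {1}. c \<le> osucc d)"
    unfolding t[THEN conjunct1] Cset_Om[OF exp(2)]
  proof
    fix c assume "c \<in> Cset a \<union> {0, 1}"
    then consider "c \<in> Cset a" | "c = 0" | "c = 1" by blast
    then show "(c = tau a \<and> tau a < Omega) \<or> (\<exists>d\<in>D \<union> {1}. c \<le> osucc d)"
      by cases (use D in \<open>auto intro: bexI[of _ c]\<close>)
  qed
  show ?case by (intro exI[of _ "D \<union> {1}"] conjI A B) (use D(1) in blast)
qed

subsection \<open>Multiples of Omega\<close>

definition Om_mult :: "ord \<Rightarrow> bool" where
  "Om_mult w \<longleftrightarrow> (\<exists>d. w = Omega * d)"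

lemma omul_eq: "Om_mult w \<Longrightarrow> b < Omega \<Longrightarrow> omul (w + b) = w"
  unfolding omul_def Om_mult_def by (rule the_equality) (auto dest: ord_div_unique)

lemma Om_mult_decomp: "\<exists>w b. x = w + b \<and> Om_mult w \<and> b < Omega"
  using ord_div_ex[OF zero_less_Omega, of x] unfolding Om_mult_def by blast

lemma Om_mult_0 [simp]: "Om_mult 0" unfolding Om_mult_def by (metis ord_mult_0_right)

lemma Om_mult_ge: "Om_mult w \<Longrightarrow> w \<noteq> 0 \<Longrightarrow> Omega \<le> w"
  unfolding Om_mult_def using ord_le_mult_right by auto

lemma Om_mult_less: "Om_mult w \<Longrightarrow> x < w \<Longrightarrow> b < Omega \<Longrightarrow> x + b < w"
proof -
  assume w: "Om_mult w" and x: "x < w" and b: "b < Omega"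
  obtain d where d: "w = Omega * d" using w Om_mult_def by blast
  then obtain e r where e: "e < d" "r < Omega" "x = Omega * e + r" using x less_times_iff by blast
  then show ?thesis using ord_mult_add_less[of e d "r + b" Omega 0] add_less_Omega[OF e(2) b] d
    by (simp add: add.assoc)
qed

lemma olimit_Om_mult: "Om_mult w \<Longrightarrow> w \<noteq> 0 \<Longrightarrow> olimit w"
  unfolding Om_mult_def using olimit_mult_left by auto

lemma Om_mult_Om: "a \<noteq> 0 \<Longrightarrow> Om_mult (Om a * b)"
proof -
  assume "a \<noteq> 0"
  then obtain a' where "a = 1 + a'" using ord_le_iff_add[of 1 a] by (auto simp: ord_one_le)
  then have "Om a * b = Omega * (Om a' * b)" by (simp add: opow_add mult.assoc)
  then show ?thesis unfolding Om_mult_def by blast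
qed

lemma Om_mult_add_iff: "Om_mult u \<Longrightarrow> Om_mult (u + v) \<longleftrightarrow> Om_mult v"
proof
  assume u: "Om_mult u" then obtain d where d: "u = Omega * d" by (auto simp: Om_mult_def)
  show "Om_mult v \<Longrightarrow> Om_mult (u + v)" unfolding Om_mult_def d by (metis ord_distrib_left)
  assume "Om_mult (u + v)"
  then obtain e where e: "u + v = Omega * e" by (auto simp: Om_mult_def)
  have "Omega * d \<le> Omega * e" using e d by (metis ord_le_add1)
  then have "d \<le> e" by simp
  then obtain f where "e = d + f" using ord_le_iff_add by blast
  then have "v = Omega * f" using e d by (simp add: ord_distrib_left)
  then show "Om_mult v" unfolding Om_mult_def by blast
qed

lemma Om_mult_nf: "is_nf a b c \<Longrightarrow> Om_mult (Om a * b + c) \<longleftrightarrow> a \<noteq> 0 \<and> Om_mult c"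
proof -
  assume n: "is_nf a b c"
  show ?thesis
  proof (cases "a = 0")
    case True
    then have "Om a * b + c < Omega" "Om a * b + c \<noteq> 0" using n by (auto simp: is_nf_def)
    then show ?thesis using Om_mult_ge True by (meson linorder_not_less)
  qed (simp add: Om_mult_add_iff[OF Om_mult_Om])
qed

text \<open>A multiple of \<open>Omega\<close> has only nonzero exponents in its normal form, so a
  nonzero b is appended as a new last summand with exponent 0, and for a limit b the fundamental
  sequence acts on b alone.\<close>

lemma Om_mult_add_props:
  assumes "w < epsOm" "Om_mult w" "b < Omega"
  shows "Cset (w + b) = insert b (Cset w) \<and> (olimit b \<longrightarrow> tau (w + b) = b \<and> fsO (w + b) th = w + th)"
  using assms
proof (induction w rule: nf_induct)
  case zero
  then show ?case using tau_fsO_lim[OF is_nf_0, of b th] less_Omega_epsOm[of b]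
    by (auto simp: Cset_countable olimit_neq_0)
next
  case (nf a d c)
  then have a: "a \<noteq> 0" "Om_mult c" using Om_mult_nf by auto
  have "Omega \<le> Om a" using a Om_le_iff[of 1 a] by (simp add: ord_one_le)
  then have "c + b < Om a" using nf(1,8) add_princ_less[OF add_princ_Om, of c a b] by (auto simp: is_nf_def)
  then have n': "is_nf a d (c + b)" using nf(1) by (auto simp: is_nf_def)
  have e: "Om a * d + (c + b) < epsOm" using nf(2,8)
    by (metis add.assoc add_less_epsOm less_Omega_epsOm)
  have "olimit b \<longrightarrow> olimit (c + b)" using olimit_add by blast
  then show ?case
    using nf.IH(2)[OF a(2) nf(8)] tau_fsO_rest[OF n' _ e, of th] Cset_nf[OF n' e] Cset_nf[OF nf(1,2)]
    by (auto simp: add.assoc)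
qed

lemmas Cset_Om_mult_add = Om_mult_add_props[THEN conjunct1]
  and tau_Om_mult_add = Om_mult_add_props[THEN conjunct2, rule_format, THEN conjunct1]
  and fsO_Om_mult_add = Om_mult_add_props[THEN conjunct2, rule_format, THEN conjunct2]

text \<open>A countable tau excludes the clause Omega^(a+1)[th] = Omega^a th, which is countable for
  a = 0; positivity of th keeps the exponent in Omega^(a[th]) nonzero.\<close>

lemma Om_mult_fsO: "olimit w \<Longrightarrow> w < epsOm \<Longrightarrow> Om_mult w \<Longrightarrow> tau w < Omega \<Longrightarrow> 0 < th \<Longrightarrow> Om_mult (fsO w th)"
proof (induction w rule: lim_nf_induct)
  case (rest a b c)
  then have a: "a \<noteq> 0" "Om_mult c" using Om_mult_nf[of a b c] by auto
  then have "Om_mult (fsO c th)" using rest tau_fsO_rest[of a b c th] by simp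
  then show ?case using rest tau_fsO_rest[of a b c th] Om_mult_add_iff[OF Om_mult_Om[OF a(1)]] by simp
next
  case (lim a b)
  then show ?case using tau_fsO_lim[of a b th] Om_mult_nf[of a b 0] Om_mult_Om[of a th] by simp
next
  case (Suc a)
  then show ?case using tau_fsO_Suc[of a th] by simp
next
  case (mult a b)
  have "Om_mult (fsO (Om a) th)" using mult tau_fsO_mult[of a b th] Om_mult_Om[OF mult(3), of 1]
    by (intro mult.IH) (simp_all del: ord_mult_osucc)
  moreover have "fsO (Om a * osucc b) th = Om a * b + fsO (Om a) th" using mult tau_fsO_mult by blast
  ultimately show ?case using Om_mult_add_iff[OF Om_mult_Om[OF mult(3)]] by metis
next
  case (exp a)
  then show ?case using tau_fsO_exp[of a th] fsO_pos[of a th] Om_mult_Om[of "fsO a th" 1] by simp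
qed

subsection \<open>The collapsing functions\<close>

lemma epsOm_neq_0 [simp]: "epsOm \<noteq> 0"
  using zero_less_epsOm by simp

text \<open>Closure is required for countable nonempty subsets; by regularity of
  \<open>Omega\<close> these are just the nonempty subsets bounded below
  \<open>Omega\<close>.\<close>

locale club =
  fixes X :: "ord set"
  assumes club_sub: "x \<in> X \<Longrightarrow> 0 < x \<and> x < Omega"
    and club_unbounded: "x < Omega \<Longrightarrow> \<exists>y\<in>X. x < y"
    and club_closed: "S \<subseteq> X \<Longrightarrow> S \<noteq> {} \<Longrightarrow> countable S \<Longrightarrow> osup S \<in> X"
begin

abbreviation Th :: "ord \<Rightarrow> ord" where "Th \<equiv> Theta X"

lemma Theta_eq: "Th x = (LEAST th. th \<in> X \<and> ostar x < th \<and> (\<forall>z<x. ostar z < th \<longrightarrow> Th z < th))"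
  unfolding Theta_def by (rule ordrec_eq) simp

text \<open>A closing-off argument. Only countably many z have all coefficients below a given t, so
  a step g leads from t to a member of X above t and above the values at these z. The supremum of
  countably many steps starting from \<open>ostar x\<close> lies in X and is closed.\<close>

lemma Theta_ex: "x < epsOm \<Longrightarrow> (\<And>z. z < x \<Longrightarrow> Th z < Omega) \<Longrightarrow>
  \<exists>th. th \<in> X \<and> ostar x < th \<and> (\<forall>z<x. ostar z < th \<longrightarrow> Th z < th)"
proof -
  assume x: "x < epsOm" and IH: "\<And>z. z < x \<Longrightarrow> Th z < Omega"
  have ex: "\<exists>u\<in>X. t < u \<and> (\<forall>z<x. ostar z < t \<longrightarrow> Th z < u)" if t: "t < Omega" for t
  proof -
    let ?S = "insert t (Th ` {z. z < x \<and> ostar z < t})"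
    have "{z. z < x \<and> ostar z < t} \<subseteq> {z. z < epsOm \<and> ostar z < t}" using x by auto
    then have "countable {z. z < x \<and> ostar z < t}" using countable_ostar_less[OF t] by (rule countable_subset)
    then have "countable ?S" by simp
    moreover have "y < Omega" if "y \<in> ?S" for y using that IH t by auto
    ultimately obtain u where u: "u < Omega" "\<forall>y\<in>?S. y \<le> u" using countable_bounded_Omega by metis
    then obtain v where "v \<in> X" "u < v" using club_unbounded by blast
    then show ?thesis using u by (intro bexI[of _ v]) auto
  qed
  define g where "g t = (SOME u. u \<in> X \<and> t < u \<and> (\<forall>z<x. ostar z < t \<longrightarrow> Th z < u))" for t
  have g: "g t \<in> X" "t < g t" "\<And>z. z < x \<Longrightarrow> ostar z < t \<Longrightarrow> Th z < g t" if "t < Omega" for t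
    using someI_ex[of "\<lambda>u. u \<in> X \<and> t < u \<and> (\<forall>z<x. ostar z < t \<longrightarrow> Th z < u)"] ex[OF that]
    unfolding g_def by blast+
  define f where "f n = (g ^^ Suc n) (ostar x)" for n
  have fO: "f n \<in> X \<and> f n < Omega" for n
  proof (induction n)
    case 0 then show ?case using g(1)[OF ostar_less_Omega[OF x]] club_sub by (simp add: f_def)
  next
    case (Suc n) then show ?case using g(1)[of "f n"] club_sub by (simp add: f_def)
  qed
  have f0: "ostar x < f 0" using g(2)[OF ostar_less_Omega[OF x]] by (simp add: f_def)
  have fS: "f n < f (Suc n)" "\<And>z. z < x \<Longrightarrow> ostar z < f n \<Longrightarrow> Th z < f (Suc n)" for n
    using g(2,3)[of "f n"] fO by (auto simp: f_def)
  let ?t = "osup (range f)"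
  have bdd: "bdd_above (range f)" using fO by (intro bdd_above_countable) auto
  have "?t \<in> X" using fO by (intro club_closed) auto
  moreover have le: "f n < ?t" for n using fS(1)[of n] unfolding less_osup_iff[OF bdd] by auto
  have "ostar x < ?t" using f0 le by (rule order_less_trans)
  moreover have "Th z < ?t" if zx: "z < x" and zt: "ostar z < ?t" for z
  proof -
    obtain n where "ostar z < f n" using zt unfolding less_osup_iff[OF bdd] by auto
    then show ?thesis using fS(2)[OF zx] le by (meson order_less_trans)
  qed
  ultimately show ?thesis by blast
qed

lemma Theta_all: "x < epsOm \<Longrightarrow> Th x \<in> X \<and> ostar x < Th x \<and> (\<forall>z<x. ostar z < Th x \<longrightarrow> Th z < Th x)"
proof (induction x rule: less_induct)
  case (less x)
  have "Th z < Omega" if "z < x" for z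
    using that less club_sub by (meson order_less_trans)
  then have ex: "\<exists>th. th \<in> X \<and> ostar x < th \<and> (\<forall>z<x. ostar z < th \<longrightarrow> Th z < th)"
    by (rule Theta_ex[OF less.prems])
  show ?case using LeastI_ex[OF ex] unfolding Theta_eq[of x, symmetric] .
qed

lemma Theta_in: "x < epsOm \<Longrightarrow> Th x \<in> X"
  and ostar_less_Theta: "x < epsOm \<Longrightarrow> ostar x < Th x"
  and Theta_mono: "x < epsOm \<Longrightarrow> z < x \<Longrightarrow> ostar z < Th x \<Longrightarrow> Th z < Th x"
  using Theta_all by blast+

lemma Theta_less_Omega: "x < epsOm \<Longrightarrow> Th x < Omega"
  and Theta_neq_0: "x < epsOm \<Longrightarrow> Th x \<noteq> 0"
  using Theta_in club_sub by fastforce+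

lemma Theta_least: "th \<in> X \<Longrightarrow> ostar x < th \<Longrightarrow> (\<And>z. z < x \<Longrightarrow> ostar z < th \<Longrightarrow> Th z < th) \<Longrightarrow> Th x \<le> th"
  by (subst Theta_eq) (rule Least_le, blast)

lemma Theta_inj: "x < epsOm \<Longrightarrow> y < epsOm \<Longrightarrow> Th x = Th y \<Longrightarrow> x = y"
  by (metis Theta_mono linorder_neqE order_less_irrefl ostar_less_Theta)

text \<open>If z < h, the largest coefficient of z must reach Theta(h), for otherwise
  \<open>Theta_mono\<close> would give Theta(z) < Theta(h). The bounds for values of Theta start
  from this alternative.\<close>

lemma Theta_less_cases:
  assumes "h < epsOm" "z < epsOm" "Th h < Th z"
  obtains "h < z" "ostar h < Th z" | "z < h" "Th h \<le> ostar z"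
proof (cases h z rule: linorder_cases)
  case less
  then show ?thesis using that assms ostar_less_Theta[OF assms(1)] order_less_trans by blast
next
  case equal then show ?thesis using assms by simp
next
  case greater
  then have "\<not> ostar z < Th h" using Theta_mono[OF assms(1)] assms(3) by fastforce
  then show ?thesis using that greater by simp
qed

lemma less_Theta_countable: "x < Omega \<Longrightarrow> x < Th x"
  using ostar_less_Theta[OF less_Omega_epsOm] by simp

text \<open>A countable y is below h and is its own largest coefficient, so Theta(h) is closed under
  Theta on countable ordinals. As y < Theta(y) \<in> X, this makes Theta(h) a limit and a limit
  point of X.\<close>

lemma Theta_big_less: "Omega \<le> h \<Longrightarrow> h < epsOm \<Longrightarrow> y < Th h \<Longrightarrow> Th y < Th h"
proof -
  assume h: "Omega \<le> h" "h < epsOm" "y < Th h"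
  have y: "y < Omega" using h Theta_less_Omega order_less_trans by blast
  then show ?thesis using h by (intro Theta_mono) (auto intro: order_less_le_trans)
qed

lemma Theta_big_limit: "Omega \<le> h \<Longrightarrow> h < epsOm \<Longrightarrow> olimit (Th h)"
proof (rule olimitI)
  assume h: "Omega \<le> h" "h < epsOm"
  then show "0 < Th h" using Theta_neq_0 by simp
  fix y assume y: "y < Th h"
  then have "Th y < Th h" using Theta_big_less h by blast
  moreover have "y < Th y" using y h Theta_less_Omega order_less_trans less_Theta_countable by blast
  ultimately show "osucc y < Th h" by (meson osucc_le_iff order_le_less_trans)
qed

section \<open>Limit points of X and the range of Theta\<close>

lemma Theta_big_lim_pts: "Omega \<le> h \<Longrightarrow> h < epsOm \<Longrightarrow> Th h \<in> lim_pts X"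
proof -
  assume h: "Omega \<le> h" "h < epsOm"
  have "\<exists>p\<in>X. y < p \<and> p < Th h" if "y < Th h" for y
  proof -
    have y: "y < Omega" using that h Theta_less_Omega order_less_trans by blast
    then show ?thesis using that h Theta_big_less less_Theta_countable Theta_in[OF less_Omega_epsOm] by blast
  qed
  then show ?thesis using h Theta_less_Omega Theta_neq_0 by (simp add: lim_pts_def)
qed

lemma lim_pts_in: "x \<in> lim_pts X \<Longrightarrow> x \<in> X"
proof -
  assume x: "x \<in> lim_pts X"
  let ?S = "{z\<in>X. z < x}"
  have "countable {z. z < x}" using x less_Omega_iff by (simp add: lim_pts_def)
  moreover have "?S \<subseteq> {z. z < x}" by auto
  ultimately have c: "countable ?S" by (meson countable_subset)
  have "0 < x" using x by (simp add: lim_pts_def)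
  moreover have "\<forall>y<x. \<exists>z\<in>X. y < z \<and> z < x" using x by (simp add: lim_pts_def)
  ultimately have "?S \<noteq> {}" by blast
  then have "osup ?S \<in> X" using c by (intro club_closed) auto
  moreover have bdd: "bdd_above ?S" by (rule bdd_aboveI[of _ x]) auto
  have "osup ?S = x"
  proof (rule order_antisym)
    show "osup ?S \<le> x" by (rule osup_least) auto
    show "x \<le> osup ?S"
    proof (rule ccontr)
      assume "\<not> x \<le> osup ?S"
      then obtain z where "z \<in> X" "osup ?S < z" "z < x" using x by (auto simp: lim_pts_def not_le)
      then show False using osup_upper[OF bdd, of z] by auto
    qed
  qed
  ultimately show ?thesis by simp
qed

lemma Cset_OmN: "Cset (OmN n) = {0, 1}"
proof (induction n)
  case 0 show ?case by (simp add: Cset_countable)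
next
  case (Suc n) then show ?case using Cset_Om[of "OmN n"] OmN_less_epsOm[of "Suc n"] by simp
qed

lemma ostar_OmN: "ostar (OmN n) = 1"
  by (simp add: ostar_def Cset_OmN max_def)

lemma Theta_OmN_mono: "m < n \<Longrightarrow> Th (OmN m) < Th (OmN n)"
  using ostar_less_Theta[OF OmN_less_epsOm, of n] OmN_strict_mono
  by (intro Theta_mono) (auto simp: ostar_OmN OmN_less_epsOm)

lemma less_ThetaEps_iff: "x < ThetaEps X \<longleftrightarrow> (\<exists>n. x < Th (OmN n))"
proof -
  have "bdd_above (range (\<lambda>n. Th (OmN n)))"
    using Theta_less_Omega OmN_less_epsOm by (intro bdd_above_countable) auto
  then show ?thesis unfolding ThetaEps_def using less_osup_iff by auto
qed

lemma epshat_iff: "x \<in> epshat X \<longleftrightarrow> x < epsOm \<and> ostar x < ThetaEps X"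
  by (simp add: epshat_def)

text \<open>Take the least h with all coefficients below x and x \<le> Theta(h). Minimality says
  Theta(z) < x for all smaller z with coefficients below x, which yields Theta(h) \<le> x. Such h
  exist because the members of the tower \<open>OmN\<close> have largest coefficient 1; for x = 1
  the choice h = 0 serves.\<close>

lemma Theta_surj: "x \<in> X \<Longrightarrow> x < ThetaEps X \<Longrightarrow> \<exists>z\<in>epshat X. Th z = x"
proof -
  assume x: "x \<in> X" "x < ThetaEps X"
  have "\<exists>h. h < epsOm \<and> ostar h < x \<and> x \<le> Th h"
  proof (cases "1 < x")
    case True
    then show ?thesis using x less_ThetaEps_iff ostar_OmN OmN_less_epsOm by (metis order_less_imp_le)
  next
    case False
    then have "x = 1" using club_sub[OF x(1)] by (metis linorder_neqE ord_less_one ord_pos_iff)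
    then show ?thesis using Theta_neq_0[of 0] by (intro exI[of _ 0]) (simp add: ord_one_le)
  qed
  define h where "h = (LEAST h. h < epsOm \<and> ostar h < x \<and> x \<le> Th h)"
  have h: "h < epsOm" "ostar h < x" "x \<le> Th h"
    unfolding h_def using LeastI_ex[OF \<open>\<exists>h. _ h\<close>] by blast+
  have "Th z < x" if "z < h" "ostar z < x" for z
    using not_less_Least[OF that(1)[unfolded h_def]] that h(1) order_less_trans by (meson linorder_not_less)
  then have "Th h \<le> x" using x h by (intro Theta_least)
  then show ?thesis using h x order_less_trans by (intro bexI[of _ h]) (auto simp: epshat_iff)
qed

lemma Theta_inv_Theta: "z \<in> epshat X \<Longrightarrow> Theta_inv X (Th z) = z"
  unfolding Theta_inv_def by (rule the_equality) (auto simp: epshat_iff dest: Theta_inj)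

section \<open>Values and coefficients compared with Theta*\<close>

lemma ThetaStar_succ: "ThetaStar X (osucc z) = Th z"
  by (simp add: ThetaStar_def)

lemma ThetaStar_less_Omega: "z < epsOm \<Longrightarrow> ThetaStar X z < Omega"
proof (cases z rule: ord_cases)
  case (2 y) then show "z < epsOm \<Longrightarrow> ?thesis" using Theta_less_Omega less_osucc order_less_trans
    by (metis ThetaStar_succ)
qed (auto simp: ThetaStar_def FIX_def olimit_def dest: ostar_less_Omega intro: zero_less_Omega)

lemma FIX_D:
  assumes "z \<in> FIX X" "z < epsOm"
  obtains g where "z < g" "g < epsOm" "tau z = Th g" "ostar z = tau z" "ostar (fsO z 1) < tau z"
  using assms by (auto simp: FIX_def)

text \<open>For z = y + 1 the coefficients exceed those of y by at most 1, and those of y are below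
  Theta(y). In the FIX case the largest coefficient of z is tau(z) itself.\<close>

lemma Theta_le_ThetaStar:
  assumes z: "z < epsOm" and s: "ThetaStar X z \<noteq> 0" and le: "t \<le> ostar z"
  shows "t \<le> ThetaStar X z"
proof (cases "is_succ z")
  case True
  then obtain y where y: "z = osucc y" by (auto simp: is_succ_def)
  have ye: "y < epsOm" using z y less_osucc order_less_trans by blast
  obtain d where "d \<in> Cset y" "ostar z \<le> osucc d" using Cset_osucc[OF ye] ostar_in[OF z] y by blast
  then have "ostar z \<le> osucc (ostar y)" using ostar_ge[OF ye] by (meson order_trans osucc_le_osucc_iff)
  also have "\<dots> \<le> Th y" using ostar_less_Theta[OF ye] by (simp add: osucc_le_iff)
  finally show ?thesis using le y by (simp add: ThetaStar_succ)
next
  case False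
  then show ?thesis using s le by (auto simp: ThetaStar_def FIX_def split: if_splits)
qed

lemma ostar_Om_mult_add: "w < epsOm \<Longrightarrow> Om_mult w \<Longrightarrow> b < Omega \<Longrightarrow> ostar (w + b) < t \<longleftrightarrow> ostar w < t \<and> b < t"
  using add_less_epsOm[OF _ less_Omega_epsOm, of w b]
  by (auto simp: ostar_less_iff Cset_Om_mult_add)

text \<open>For a successor b the values Theta(w + d) increase with d up to the predecessor of b.
  For a limit b the ordinal w + b is in FIX, so b = Theta(g) with g > w + b and the coefficients of
  w are below b; monotonicity at g bounds Theta(w + d) by b.\<close>

lemma Theta_below_ThetaStar:
  assumes w: "Om_mult w" "b < Omega" and z: "w + b < epsOm" and s: "ThetaStar X (w + b) \<noteq> 0"
   and h: "w \<le> h" "h < w + b"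
  shows "Th h \<le> ThetaStar X (w + b)"
proof -
  obtain d where d: "h = w + d" "d < b" using ord_less_add_imp[OF h(2,1)] by blast
  have we: "w < epsOm" using h z order_le_less_trans order_less_trans by blast
  have dO: "d < Omega" using d w by auto
  show ?thesis
  proof (cases b rule: ord_cases)
    case 1 then show ?thesis using d by simp
  next
    case (2 e)
    then have e: "e < Omega" "d \<le> e" using w d by (auto simp: less_osucc_iff)
    then have e': "w + e < epsOm" using add_less_epsOm[OF we less_Omega_epsOm] by blast
    have "Th (w + d) \<le> Th (w + e)"
    proof (cases "d = e")
      case False
      then have "w + d < w + e" using e by simp
      moreover have "ostar (w + d) < Th (w + e)"
        using ostar_less_Theta[OF e'] e dO w we by (auto simp: ostar_Om_mult_add)
      ultimately show ?thesis using Theta_mono[OF e'] by (simp add: order_less_imp_le)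
    qed simp
    then show ?thesis using d 2 by (simp add: ThetaStar_succ)
  next
    case 3
    have ns: "\<not> is_succ (w + b)" using olimit_add[OF 3] by (simp add: olimit_def)
    then have "w + b \<in> FIX X" using s by (auto simp: ThetaStar_def split: if_splits)
    then obtain g where g: "w + b < g" "g < epsOm" "tau (w + b) = Th g" "ostar (fsO (w + b) 1) < tau (w + b)"
      using FIX_D z by metis
    have t: "tau (w + b) = b" "fsO (w + b) 1 = w + 1" using tau_Om_mult_add fsO_Om_mult_add we w 3 by auto
    have "ostar w < b" using g(4) ostar_Om_mult_add[OF we w(1) one_less_Omega, of b] unfolding t by simp
    then have "ostar (w + d) < b" using d dO we w by (simp add: ostar_Om_mult_add)
    moreover have "w + d < g" using g(1) h(2) d by (meson order_less_trans)
    ultimately have "Th (w + d) < Th g" using g t by (intro Theta_mono) auto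
    then show ?thesis using g t ns \<open>w + b \<in> FIX X\<close> d by (simp add: ThetaStar_def)
  qed
qed

text \<open>When tau(z) is \<open>Omega\<close>, no coefficient of z is replaced; each drops by at
  most 1 in z[th]. The drop is harmless because h is uncountable and so Theta(h) is a limit.\<close>

lemma Theta_le_ostar_Omega:
  assumes z: "olimit z" "z < epsOm" "tau z = Omega" and h: "z < h" "h < epsOm" "Th h \<le> ostar z"
   and th: "0 < th" "th < Omega"
  shows "Th h \<le> ostar (fsO z th)"
proof -
  obtain D where D: "Cset (fsO z th) = insert th D" "\<forall>c\<in>Cset z. \<exists>d\<in>D. c \<le> osucc d"
    using Cset_fsO[OF z(1,2)] z(3) th by auto
  then obtain d where d: "d \<in> D" "Th h \<le> osucc d" using ostar_in[OF z(2)] h(3) by (meson order_trans)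
  have "Omega \<le> h" using h(1) z
    by (metis fsO_less less_Omega_epsOm linorder_not_less order_less_imp_le order_less_irrefl order_less_trans tau_limit ostar_countable tau_le_Omega Cset_less_Omega h(3) less_Theta_countable order_le_less_trans)
  then have "Th h \<noteq> osucc d" using Theta_big_limit h(2) by fastforce
  then have "Th h \<le> d" using d by (metis less_osucc_iff order_le_less)
  moreover have "fsO z th < epsOm" using fsO_less[OF z(1,2), of th] z th order_less_trans by metis
  then have "d \<le> ostar (fsO z th)" using D d ostar_ge by blast
  ultimately show ?thesis by simp
qed

text \<open>As for \<open>Theta_le_ostar_Omega\<close>, unless the largest coefficient is tau(z) and
  z[1] has only smaller ones. In that situation Theta(h) = tau(z) would put z into FIX, contrary to
  Theta*(z) = 0; so Theta(h) is smaller.\<close>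

lemma Theta_le_ostar_cases:
  assumes z: "olimit z" "z < epsOm" "tau z < Omega" and s: "ThetaStar X z = 0"
   and h: "z < h" "h < epsOm" "Th h \<le> ostar z"
  shows "Th h < tau z \<or> (\<forall>th. 0 < th \<longrightarrow> th < tau z \<longrightarrow> Th h \<le> ostar (fsO z th))"
proof -
  obtain D where D: "\<forall>th. 0 < th \<longrightarrow> th < tau z \<longrightarrow> Cset (fsO z th) = insert th D"
     "\<forall>c\<in>Cset z. (c = tau z \<and> tau z < Omega) \<or> (\<exists>d\<in>D. c \<le> osucc d)"
    using Cset_fsO[OF z(1,2)] by blast
  have tl: "olimit (tau z)" using olimit_tau z by blast
  have big: "Omega \<le> h"
  proof (rule ccontr)
    assume "\<not> Omega \<le> h"
    then have "h < Th h" "ostar z = z" using h(1) less_Theta_countable by auto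
    then show False using h by simp
  qed
  have *: "Th h \<le> ostar (fsO z th)" if "d \<in> D" "Th h \<le> osucc d" "0 < th" "th < tau z" for d th
  proof -
    have "Th h \<noteq> osucc d" using Theta_big_limit[OF big h(2)] by fastforce
    then have "Th h \<le> d" using that by (metis less_osucc_iff order_le_less)
    moreover have "fsO z th < epsOm" using fsO_less[OF z(1,2) that(4)] z order_less_trans by metis
    then have "d \<le> ostar (fsO z th)" using D that ostar_ge by blast
    ultimately show ?thesis by simp
  qed
  have one: "1 < tau z" using tl olimit_succ_less[OF tl olimit_pos[OF tl]] by (simp add: osucc_0)
  from D(2) ostar_in[OF z(2)] consider "ostar z = tau z" | d where "d \<in> D" "ostar z \<le> osucc d" by blast
  then show ?thesis
  proof cases
    case 1
    show ?thesis
    proof (cases "ostar (fsO z 1) < ostar z")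
      case True
      have "Th h \<noteq> tau z"
      proof
        assume "Th h = tau z"
        then have "z \<in> FIX X" using 1 True h by (auto simp: FIX_def)
        then show False using s tl by (auto simp: ThetaStar_def olimit_neq_0 split: if_splits)
          (use z(1) in \<open>simp add: olimit_def\<close>)
      qed
      then show ?thesis using h 1 by auto
    next
      \<comment> \<open>z[1] still has a coefficient that is at least tau(z) > 1. It is not the
        inserted 1, so it lies in D and hence is a coefficient of every z[th].\<close>
      case False
      have "fsO z 1 < epsOm" using fsO_less[OF z(1,2) one] z order_less_trans by metis
      then have "ostar (fsO z 1) \<in> insert 1 D" using ostar_in D(1) one by fastforce
      then consider "ostar (fsO z 1) = 1" | "ostar (fsO z 1) \<in> D" by blast
      then show ?thesis
      proof cases
        case 1 then show ?thesis using False one \<open>ostar z = tau z\<close> by simp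
      next
        case 2
        have "Th h \<le> osucc (ostar (fsO z 1))" using False h by (meson le_osucc linorder_not_less order_trans)
        then show ?thesis using * 2 by blast
      qed
    qed
  next
    case (2 d)
    then show ?thesis using * h by (meson order_trans)
  qed
qed

text \<open>Otherwise the supremum p of the values Theta(x), x < z, is a member of X below Theta(z).
  Since z < p would give Theta(z) \<le> p, p is z. So z is in X and exceeds all Theta(x) with x < z;
  hence z = Theta(g) with g > z, and z is in FIX.\<close>

lemma countable_limit_cases:
  assumes z: "olimit z" "z < Omega" "z \<in> epshat X" "z \<notin> FIX X"
  shows "Th z \<in> lim_pts X"
proof (rule ccontr)
  have ze: "z < epsOm" using z less_Omega_epsOm by blast
  assume "Th z \<notin> lim_pts X"
  then obtain y where y: "y < Th z" "\<And>p. p \<in> X \<Longrightarrow> y < p \<Longrightarrow> p < Th z \<Longrightarrow> False"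
    using Theta_neq_0[OF ze] Theta_less_Omega[OF ze] by (auto simp: lim_pts_def)
  have lt: "Th x < Th z" "Th x \<le> y" "Th x < Th (osucc x)" "x < Th x" if "x < z" for x
  proof -
    have xO: "x < Omega" using that z by auto
    show 1: "Th x < Th z" using that z ze less_Theta_countable[OF z(2)] xO by (intro Theta_mono) auto
    show "Th x \<le> y" using 1 y(2) Theta_in[OF less_Omega_epsOm[OF xO]] by (meson linorder_not_less)
    have "osucc x < Th (osucc x)" using xO less_Theta_countable by simp
    then show "Th x < Th (osucc x)" using xO less_Omega_epsOm
      by (intro Theta_mono) (auto intro: order_less_trans[OF less_osucc])
    show "x < Th x" using less_Theta_countable[OF xO] .
  qed
  let ?S = "Th ` {x. x < z}"
  have cS: "countable ?S" using z less_Omega_iff by auto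
  have bdd: "bdd_above ?S" by (rule bdd_aboveI[of _ y]) (use lt in auto)
  define p where "p = osup ?S"
  have "?S \<subseteq> X" using Theta_in ze by (auto intro: order_less_trans)
  then have pX: "p \<in> X" unfolding p_def using cS olimit_pos[OF z(1)] by (intro club_closed) blast+
  have py: "p \<le> y" unfolding p_def using lt by (intro osup_least) auto
  have Thp: "Th x < p" if "x < z" for x
    using lt[OF that] osup_upper[OF bdd, of "Th (osucc x)"] olimit_succ_less[OF z(1) that] unfolding p_def
    by (metis imageI mem_Collect_eq order_less_le_trans)
  then have zp: "z \<le> p" using lt(4) order_less_trans by (meson linorder_not_less order_less_irrefl)
  have "\<not> z < p"
  proof
    assume "z < p"
    then have "Th z \<le> p" using Thp pX z(2) by (intro Theta_least) auto
    then show False using py y by simp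
  qed
  then have zX: "z \<in> X" and Thz: "\<And>x. x < z \<Longrightarrow> Th x < z" using zp pX Thp by auto
  have "z < ThetaEps X" using z by (simp add: epshat_iff)
  then obtain g where g: "g \<in> epshat X" "Th g = z" using Theta_surj zX by blast
  have "z < g"
  proof (rule ccontr)
    assume "\<not> z < g"
    then consider "g < z" | "g = z" by fastforce
    then show False using Thz g less_Theta_countable[OF z(2)] by cases auto
  qed
  moreover have "tau z = z" "fsO z 1 = 1" using tau_Om_mult_add[of 0 z] fsO_Om_mult_add[of 0 z 1] z by (auto simp: osucc_0)
  moreover have "1 < z" using olimit_succ_less[OF z(1) olimit_pos[OF z(1)]] by (simp add: osucc_0)
  ultimately have "z \<in> FIX X" using g z by (auto simp: FIX_def epshat_iff)
  then show False using z by simp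
qed

text \<open>Theta(z) is the next member of X after Theta*(z): any p in X above Theta*(z) satisfies
  the conditions in the definition of Theta(z).\<close>

lemma countable_jump_cases:
  assumes z: "z < Omega" "ThetaStar X z \<noteq> 0"
  shows "Th z \<notin> lim_pts X"
proof
  have ze: "z < epsOm" using z less_Omega_epsOm by blast
  assume "Th z \<in> lim_pts X"
  moreover have "ThetaStar X z < Th z"
  proof (cases "is_succ z")
    case True
    then obtain y where y: "z = osucc y" by (auto simp: is_succ_def)
    then have "y < Th z" using less_Theta_countable[OF z(1)] less_osucc order_less_trans by blast
    then have "Th y < Th z" using y ze z by (intro Theta_mono) auto
    then show ?thesis using y by (simp add: ThetaStar_succ)
  next
    case False
    then have "ThetaStar X z = ostar z" using z by (auto simp: ThetaStar_def FIX_def split: if_splits)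
    then show ?thesis using ostar_less_Theta[OF ze] by simp
  qed
  ultimately obtain p where p: "p \<in> X" "ThetaStar X z < p" "p < Th z" by (auto simp: lim_pts_def)
  have "z \<le> ThetaStar X z" using Theta_le_ThetaStar[OF ze z(2)] z(1) by simp
  then have "z < p" using p by simp
  have "Th x < p" if "x < z" for x
    using Theta_below_ThetaStar[of 0 z x] that z ze p by (simp add: order_le_less_trans)
  then have "Th z \<le> p" using p \<open>z < p\<close> z by (intro Theta_least) auto
  then show False using p by simp
qed

end

subsection \<open>Coefficients of sums and products\<close>

text \<open>At most one pair of coefficients merges: the leading one of v with that of u at the same
  exponent. Smaller summands of u are absorbed, larger ones are kept.\<close>

lemma Cset_plus:
  "u < epsOm \<Longrightarrow> v < epsOm \<Longrightarrow> d \<in> Cset (u + v) \<Longrightarrow>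
    d \<in> Cset u \<union> Cset v \<or> (\<exists>a\<in>Cset u. \<exists>b\<in>Cset v. d = a + b)"
proof (induction u arbitrary: d rule: nf_induct)
  case zero then show ?case by simp
next
  case (nf a b c)
  note n = nf(1) and Cu = Cset_nf[OF nf(1,2)]
  show ?case
  proof (cases "v < Om a")
    case True
    then have n': "is_nf a b (c + v)" using n add_princ_less[OF add_princ_Om] by (auto simp: is_nf_def)
    have "Om a * b + (c + v) < epsOm" using add_less_epsOm[OF nf(2,7)] by (simp add: add.assoc)
    then have "Cset (Om a * b + c + v) = Cset a \<union> Cset (c + v) \<union> {b}"
      using Cset_nf[OF n'] by (simp add: add.assoc)
    then consider "d \<in> Cset a \<union> {b}" | "d \<in> Cset (c + v)" using nf(8) by blast
    then show ?thesis
    proof cases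
      case 1 then show ?thesis using Cu by blast
    next
      case 2 then show ?thesis using nf.IH(2)[OF nf(7)] Cu by blast
    qed
  next
    case False
    then have "v \<noteq> 0" by auto
    then obtain a' b' c' where v: "v = Om a' * b' + c'" and n': "is_nf a' b' c'" using nf_ex by blast
    have Cv: "Cset v = Cset a' \<union> Cset c' \<union> {b'}" using Cset_nf[OF n'] nf(7) v by blast
    have "a \<le> a'" using False nf_E_le[OF n', of a] v by simp
    then consider "a < a'" | "a = a'" by fastforce
    then show ?thesis
    proof cases
      case 1
      have "Om a * b + c < Om a'" using nf_E_le[OF n] 1 by blast
      moreover have "Om a' \<le> v" using nf_bounds(1)[OF n'] v by simp
      ultimately have "Om a * b + c + v = v" by (rule add_princ_absorb_le[OF add_princ_Om])
      then show ?thesis using nf(8) by simp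
    next
      case 2
      have "c < Om a'" "Om a' \<le> v" using n 2 nf_bounds(1)[OF n'] v by (auto simp: is_nf_def)
      then have "c + v = v" by (rule add_princ_absorb_le[OF add_princ_Om])
      then have eq: "Om a * b + c + v = Om a * (b + b') + c'" using v 2
        by (simp add: add.assoc ord_distrib_left)
      have "is_nf a (b + b') c'" using n n' 2 add_less_Omega by (auto simp: is_nf_def)
      then have "Cset (Om a * b + c + v) = Cset a \<union> Cset c' \<union> {b + b'}"
        using Cset_nf add_less_epsOm[OF nf(2,7)] eq by metis
      then show ?thesis using nf(8) Cu Cv 2 by blast
    qed
  qed
qed

text \<open>Multiplication turns an exponent a of y into x + a, which is new only if a is nonzero,
  and then y is uncountable; the sum merges a coefficient of y with one of z. The cardinality
  conditions serve the count in \<open>denotes_Cset_term\<close>, where each sum of coefficients has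
  to be paid for.\<close>

lemma Cset_Om_times_add:
  assumes "x < epsOm" "y < epsOm" "z < epsOm" "d \<in> Cset (Om x * y + z)"
  shows "d \<in> Cset x \<union> Cset y \<union> Cset z \<or> (Omega \<le> y \<and> (\<exists>a\<in>Cset x. \<exists>b\<in>Cset y. d = a + b)) \<or>
    ((Omega \<le> y \<or> Omega \<le> z \<or> Om x * y + z < Omega) \<and> (\<exists>b\<in>Cset y. \<exists>c\<in>Cset z. d = b + c))"
  using assms(2,1,3,4)
proof (induction y rule: nf_induct)
  case zero then show ?case by simp
next
  case (nf a b c)
  note n = nf(1) and Cy = Cset_nf[OF nf(1,2)]
  have e: "Om x * (Om a * b + c) + z < epsOm" using nf mult_Om_less_epsOm add_less_epsOm by blast
  have eq: "Om x * (Om a * b + c) + z = Om (x + a) * b + (Om x * c + z)"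
    by (simp add: ord_distrib_left opow_add add.assoc mult.assoc)
  have xc: "Om x * c < Om (x + a)" using n by (simp add: opow_add is_nf_def)
  have big: "Omega \<le> Om a * b + c" if "a \<noteq> 0"
    using nf_bounds(1)[OF n] Om_le_iff[of 1 a] that by (simp add: ord_one_le order_trans)
  show ?case
  proof (cases "z < Om (x + a)")
    case True
    have n': "is_nf (x + a) b (Om x * c + z)"
      using n add_princ_less[OF add_princ_Om xc True] by (simp add: is_nf_def)
    have "Cset (Om x * (Om a * b + c) + z) = Cset (x + a) \<union> Cset (Om x * c + z) \<union> {b}"
      using Cset_nf[OF n'] e eq by simp
    then consider "d = b" | "d \<in> Cset (x + a)" | "d \<in> Cset (Om x * c + z)" using nf(9) by blast
    then show ?thesis
    proof cases
      case 1 then show ?thesis using Cy by blast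
    next
      case 2
      show ?thesis
      proof (cases "a = 0")
        case True then show ?thesis using 2 by simp
      next
        case False
        then show ?thesis using Cset_plus[OF nf(7,3) 2] big Cy by blast
      qed
    next
      case 3
      show ?thesis
      proof (cases "a = 0")
        case True
        then have "c = 0" using n by (simp add: is_nf_def)
        then show ?thesis using 3 by simp
      next
        case False
        then show ?thesis using nf.IH(2)[OF nf(7,8) 3] big Cy by blast
      qed
    qed
  next
    case False
    then have "z \<noteq> 0" by auto
    then obtain a' b' c' where z: "z = Om a' * b' + c'" and n': "is_nf a' b' c'" using nf_ex by blast
    have Cz: "Cset z = Cset a' \<union> Cset c' \<union> {b'}" using Cset_nf[OF n'] nf(8) z by blast
    have "x + a \<le> a'" using False nf_E_le[OF n', of "x + a"] z by simp
    then consider "x + a < a'" | "x + a = a'" by fastforce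
    then show ?thesis
    proof cases
      case 1
      have "is_nf (x + a) b (Om x * c)" using n xc by (simp add: is_nf_def)
      then have "Om (x + a) * b + Om x * c < Om a'" using nf_E_le 1 by blast
      moreover have "Om a' \<le> z" using nf_bounds(1)[OF n'] z by simp
      ultimately have "Om (x + a) * b + Om x * c + z = z" by (rule add_princ_absorb_le[OF add_princ_Om])
      then show ?thesis using nf(9) eq by (simp add: add.assoc)
    next
      case 2
      have "Om a' \<le> z" using nf_bounds(1)[OF n'] z by simp
      then have "Om x * c + z = z" using xc 2 by (simp add: add_princ_absorb_le[OF add_princ_Om])
      then have eq': "Om x * (Om a * b + c) + z = Om a' * (b + b') + c'" using z 2 eq
        by (simp add: add.assoc[symmetric] ord_distrib_left)
      have n'': "is_nf a' (b + b') c'" using n n' 2 add_less_Omega by (auto simp: is_nf_def)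
      have "Cset (Om x * (Om a * b + c) + z) = Cset a' \<union> Cset c' \<union> {b + b'}"
        using Cset_nf[OF n''] e eq' by simp
      then consider "d \<in> Cset z" | "d = b + b'" using nf(9) Cz by blast
      then show ?thesis
      proof cases
        case 2
        have "Omega \<le> z \<or> Om x * (Om a * b + c) + z < Omega"
        proof (cases "a' = 0")
          case True
          then have "c' = 0" using n' by (simp add: is_nf_def)
          then show ?thesis using True eq' n'' by (simp add: is_nf_def)
        next
          case False
          then have "Omega \<le> Om a'" using Om_le_iff[of 1 a'] by (simp add: ord_one_le)
          then show ?thesis using \<open>Om a' \<le> z\<close> by (blast intro: order_trans)
        qed
        then show ?thesis using 2 Cy Cz by blast
      qed blast
    qed
  qed
qed

subsection \<open>The two systems\<close>

lemma add_princ_iff: "add_princ p \<longleftrightarrow> (\<exists>e. p = opow omega e)"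
proof
  assume p: "add_princ p"
  then have "0 < p" by (simp add: add_princ_def)
  then obtain b q r where x: "p = opow omega b * q + r" "q \<noteq> 0" "q < omega" "r < opow omega b"
    using opow_nf_ex[OF one_less_omega, of p] by auto
  have "p = opow omega b"
  proof (rule ccontr)
    assume "p \<noteq> opow omega b"
    moreover have "opow omega b \<le> p" using x ord_le_add1 ord_le_mult_right order_trans by (metis ord_pos_iff)
    ultimately have lt: "opow omega b < p" by simp
    have "opow omega b * onat n < p" for n
    proof (induction n)
      case (Suc n) then show ?case using add_princ_less[OF p _ lt] by simp
    qed (use lt in auto)
    moreover obtain n where "q = onat n" using x less_omega_iff by blast
    ultimately have "opow omega b * onat (Suc n) < opow omega b * onat n + r" using x by metis
    then have "opow omega b < r" by simp
    then show False using x by simp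
  qed
  then show "\<exists>e. p = opow omega e" ..
qed (auto intro: add_princ_opow add_princ_omega)

lemma Pset_iff: "x \<in> Pset \<longleftrightarrow> x < Omega \<and> add_princ x"
  by (simp add: Pset_def add_princ_iff)

lemma club_Xof: "club (Xof s)"
proof (cases s)
  case SigmaSys
  have "club Xsig"
  proof
    fix S assume S: "S \<subseteq> Xsig" "S \<noteq> {}" "countable S"
    then have lt: "x < Omega" if "x \<in> S" for x using that by (auto simp: Xsig_def)
    obtain x where x: "x \<in> S" "x \<noteq> 0" using S by (auto simp: Xsig_def)
    then have "x \<le> osup S" using osup_upper[OF bdd_above_countable[OF S(3) lt]] by blast
    then show "osup S \<in> Xsig" using x osup_less_Omega[OF S(3) lt] by (auto simp: Xsig_def)
  qed (auto simp: Xsig_def intro: exI[of _ "osucc _"])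
  then show ?thesis using SigmaSys by simp
next
  case VarthetaSys
  have "club Pset"
  proof
    show "\<exists>y\<in>Pset. x < y" if "x < Omega" for x
      using that le_opow[OF one_less_omega, of "osucc x"] opow_less_Omega[of omega "osucc x"]
      by (intro bexI[of _ "opow omega (osucc x)"]) (auto simp: Pset_def osucc_le_iff)
    fix S assume S: "S \<subseteq> Pset" "S \<noteq> {}" "countable S"
    then have lt: "x < Omega" if "x \<in> S" for x using that by (auto simp: Pset_iff)
    have bdd: "bdd_above S" using bdd_above_countable[OF S(3) lt] .
    obtain x where "x \<in> S" using S by blast
    then have x: "x \<in> S" "x \<noteq> 0" using S by (auto simp: Pset_iff add_princ_def)
    have "x + y < osup S" if xy: "x < osup S" "y < osup S" for x y
    proof -
      obtain u where u: "u \<in> S" "x < u" using xy(1) unfolding less_osup_iff[OF bdd] by blast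
      obtain v where v: "v \<in> S" "y < v" using xy(2) unfolding less_osup_iff[OF bdd] by blast
      obtain m where m: "m \<in> S" "x < m" "y < m" using u v
        by (cases "u \<le> v") (meson order_less_le_trans linorder_not_less order_less_imp_le)+
      then have "x + y < m" using S add_princ_less by (auto simp: Pset_iff)
      then show ?thesis using osup_upper[OF bdd m(1)] by simp
    qed
    moreover have "osup S \<noteq> 0" using osup_upper[OF bdd x(1)] x by auto
    ultimately show "osup S \<in> Pset" using osup_less_Omega[OF S(3) lt] by (auto simp: Pset_iff add_princ_def)
  qed (auto simp: Pset_iff add_princ_def)
  then show ?thesis using VarthetaSys by simp
qed

interpretation sys: club "Xof s" for s by (rule club_Xof)

section \<open>Terms, their sizes and the norms of coefficients\<close>

lemma teval_less_epsOm: "teval (Xof s) t < epsOm"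
  by (induction t) (auto intro: add_less_epsOm mult_Om_less_epsOm less_Omega_epsOm sys.Theta_less_Omega)

lemma tsize_pos: "1 \<le> tsize t"
  by (induction t) auto

text \<open>A bound on the norm without infimum or infinity, in the form the inductions use;
  \<open>denotes_onorm\<close> provides the link.\<close>

definition denotes :: "system \<Rightarrow> nat \<Rightarrow> ord \<Rightarrow> bool" where
  "denotes s k x \<longleftrightarrow> (\<exists>t. allowed s t \<and> teval (Xof s) t = x \<and> tsize t \<le> k)"

lemma denotes_mono: "denotes s k x \<Longrightarrow> k \<le> l \<Longrightarrow> denotes s l x"
  unfolding denotes_def using order_trans by blast

text \<open>Omega^0 x + y is a term of both systems; the additional 2 are its function symbol and
  the term 0 in the exponent.\<close>

lemma denotes_add: "denotes s k x \<Longrightarrow> denotes s l y \<Longrightarrow> denotes s (2 + k + l) (x + y)"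
proof -
  assume "denotes s k x" "denotes s l y"
  then obtain u v where "allowed s u" "teval (Xof s) u = x" "tsize u \<le> k"
    "allowed s v" "teval (Xof s) v = y" "tsize v \<le> l" by (auto simp: denotes_def)
  then show ?thesis unfolding denotes_def by (intro exI[of _ "TOm TZero u v"]) simp
qed

lemma denotes_less_epsOm: "denotes s k x \<Longrightarrow> x < epsOm"
  unfolding denotes_def using teval_less_epsOm by blast

text \<open>The strict bound for uncountable values is what later pays for the carry in
  sums of values of sigma.\<close>
lemma denotes_Cset_term:
  "allowed s t \<Longrightarrow> d \<in> Cset (teval (Xof s) t) \<Longrightarrow>
    denotes s (if Omega \<le> teval (Xof s) t then tsize t - 1 else tsize t) d"
proof (induction t arbitrary: d)
  case TZero
  then show ?case by (auto simp: denotes_def intro: exI[of _ TZero])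
next
  case (TTheta t)
  have "Theta (Xof s) (teval (Xof s) t) < Omega" using sys.Theta_less_Omega teval_less_epsOm by blast
  moreover have "denotes s (Suc (tsize t)) 0" unfolding denotes_def by (intro exI[of _ TZero]) simp
  moreover have "denotes s (Suc (tsize t)) (Theta (Xof s) (teval (Xof s) t))"
    unfolding denotes_def using TTheta by (intro exI[of _ "TTheta t"]) simp
  ultimately show ?case using TTheta.prems by (auto simp: Cset_countable)
next
  case (TPlus u v)
  define x y where "x = teval (Xof s) u" and "y = teval (Xof s) v"
  note IH = TPlus.IH[folded x_def y_def]
  have al: "allowed s u" "allowed s v" using TPlus by auto
  have sz: "1 \<le> tsize u" "1 \<le> tsize v" by (rule tsize_pos)+
  have IH': "denotes s (tsize u) d" if "d \<in> Cset x" for d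
    by (rule denotes_mono[OF IH(1)[OF al(1) that]]) simp
  have IH'': "denotes s (tsize v) d" if "d \<in> Cset y" for d
    by (rule denotes_mono[OF IH(2)[OF al(2) that]]) simp
  have sum: "denotes s (1 + k + l) (a + b)" if h: "denotes s k a" "denotes s l b" for a b k l
  proof -
    obtain t1 t2 where "allowed s t1" "teval (Xof s) t1 = a" "tsize t1 \<le> k"
      "allowed s t2" "teval (Xof s) t2 = b" "tsize t2 \<le> l" using h by (auto simp: denotes_def)
    then show ?thesis unfolding denotes_def using TPlus.prems(1) by (intro exI[of _ "TPlus t1 t2"]) simp
  qed
  have d: "d \<in> Cset x \<union> Cset y \<or> (\<exists>a\<in>Cset x. \<exists>b\<in>Cset y. d = a + b)"
    using Cset_plus TPlus.prems(2) teval_less_epsOm unfolding x_def y_def by simp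
  have "denotes s (if Omega \<le> x + y then tsize u + tsize v else 1 + tsize u + tsize v) d"
    using d
  proof (elim disjE UnE bexE)
    assume "d \<in> Cset x"
    from IH'[OF this] show ?thesis by (rule denotes_mono) simp
  next
    assume "d \<in> Cset y"
    from IH''[OF this] show ?thesis by (rule denotes_mono) simp
  next
    fix a b assume ab: "a \<in> Cset x" "b \<in> Cset y" "d = a + b"
    show ?thesis
    proof (cases "Omega \<le> x + y")
      case False then show ?thesis using sum[OF IH'[OF ab(1)] IH''[OF ab(2)]] ab by simp
    next
      case True
      \<comment> \<open>The uncountable summand has coefficients of norm one less, which pays for
        the symbol +.\<close>
      then have "Omega \<le> x \<or> Omega \<le> y" using add_less_Omega by (meson linorder_not_less)
      then show ?thesis
      proof
        assume "Omega \<le> x"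
        then have "denotes s (tsize u - 1) a" using IH(1)[OF al(1) ab(1)] by simp
        from sum[OF this IH''[OF ab(2)]] show ?thesis using ab True sz by simp
      next
        assume "Omega \<le> y"
        then have "denotes s (tsize v - 1) b" using IH(2)[OF al(2) ab(2)] by simp
        from sum[OF IH'[OF ab(1)] this] show ?thesis using ab True sz by simp
      qed
    qed
  qed
  then show ?case by (simp add: x_def y_def split: if_splits)
next
  case (TOm p u v)
  define w x y where "w = teval (Xof s) p" and "x = teval (Xof s) u" and "y = teval (Xof s) v"
  note IH = TOm.IH[folded w_def x_def y_def]
  have al: "allowed s p" "allowed s u" "allowed s v" using TOm by auto
  have sz: "1 \<le> tsize p" "1 \<le> tsize u" "1 \<le> tsize v" by (rule tsize_pos)+
  have IHw: "denotes s (tsize p) d" if "d \<in> Cset w" for d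
    by (rule denotes_mono[OF IH(1)[OF al(1) that]]) simp
  have IHx: "denotes s (tsize u) d" if "d \<in> Cset x" for d
    by (rule denotes_mono[OF IH(2)[OF al(2) that]]) simp
  have IHy: "denotes s (tsize v) d" if "d \<in> Cset y" for d
    by (rule denotes_mono[OF IH(3)[OF al(3) that]]) simp
  have dd: "d \<in> Cset w \<union> Cset x \<union> Cset y \<or> (Omega \<le> x \<and> (\<exists>a\<in>Cset w. \<exists>b\<in>Cset x. d = a + b)) \<or>
    ((Omega \<le> x \<or> Omega \<le> y \<or> Om w * x + y < Omega) \<and> (\<exists>b\<in>Cset x. \<exists>c\<in>Cset y. d = b + c))"
    using Cset_Om_times_add TOm.prems(2) teval_less_epsOm unfolding w_def x_def y_def by simp
  let ?k = "if Omega \<le> Om w * x + y then tsize p + tsize u + tsize v else Suc (tsize p + tsize u + tsize v)"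
  have k: "tsize p + tsize u + tsize v \<le> ?k" by simp
  have "denotes s ?k d"
    using dd
  proof (elim disjE UnE bexE conjE)
    assume "d \<in> Cset w"
    from IHw[OF this] show ?thesis by (rule denotes_mono) simp
  next
    assume "d \<in> Cset x"
    from IHx[OF this] show ?thesis by (rule denotes_mono) simp
  next
    assume "d \<in> Cset y"
    from IHy[OF this] show ?thesis by (rule denotes_mono) simp
  next
    fix a b assume ab: "a \<in> Cset w" "b \<in> Cset x" "d = a + b" "Omega \<le> x"
    \<comment> \<open>The sum costs 2: one is saved because u has an uncountable value, one because
      v, of size at least 1, does not enter.\<close>
    have "denotes s (tsize u - 1) b" using IH(2)[OF al(2) ab(2)] ab(4) by simp
    from denotes_add[OF IHw[OF ab(1)] this] show ?thesis unfolding ab(3) by (rule denotes_mono) (use sz in simp)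
  next
    fix a b assume ab: "a \<in> Cset x" "b \<in> Cset y" "d = a + b" "Omega \<le> x"
    have "denotes s (tsize u - 1) a" using IH(2)[OF al(2) ab(1)] ab(4) by simp
    from denotes_add[OF this IHy[OF ab(2)]] show ?thesis unfolding ab(3) by (rule denotes_mono) (use sz in simp)
  next
    fix a b assume ab: "a \<in> Cset x" "b \<in> Cset y" "d = a + b" "Omega \<le> y"
    have "denotes s (tsize v - 1) b" using IH(3)[OF al(3) ab(2)] ab(4) by simp
    from denotes_add[OF IHx[OF ab(1)] this] show ?thesis unfolding ab(3) by (rule denotes_mono) (use sz in simp)
  next
    fix a b assume ab: "a \<in> Cset x" "b \<in> Cset y" "d = a + b" "Om w * x + y < Omega"
    have "\<not> Omega \<le> Om w * x + y" using ab(4) by (simp add: not_le)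
    then show ?thesis using denotes_mono[OF denotes_add[OF IHx[OF ab(1)] IHy[OF ab(2)]]] sz ab(3) by simp
  qed
  then show ?case by (simp add: w_def x_def y_def split: if_splits)
qed

lemma denotes_Cset: "denotes s k x \<Longrightarrow> d \<in> Cset x \<Longrightarrow> denotes s k d"
  and denotes_Cset_big: "denotes s k x \<Longrightarrow> Omega \<le> x \<Longrightarrow> d \<in> Cset x \<Longrightarrow> 0 < k \<and> denotes s (k - 1) d"
proof -
  assume x: "denotes s k x" and d: "d \<in> Cset x"
  then obtain t where t: "allowed s t" "teval (Xof s) t = x" "tsize t \<le> k" by (auto simp: denotes_def)
  have 1: "denotes s (if Omega \<le> x then tsize t - 1 else tsize t) d" using denotes_Cset_term[OF t(1)] t d by simp
  then show "denotes s k d" by (rule denotes_mono) (use t in auto)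
  show "0 < k \<and> denotes s (k - 1) d" if "Omega \<le> x"
    using 1 that t tsize_pos[of t] denotes_mono[of s "tsize t - 1" d "k - 1"] by simp
qed

subsection \<open>Cantor normal forms\<close>

lemma osum_list_eq: "osum_list xs = sum_list xs"
proof -
  have "foldl (+) a xs = a + sum_list xs" for a :: ord
    by (induction xs arbitrary: a) (simp_all add: add.assoc)
  then show ?thesis by (simp add: osum_list_def)
qed

abbreviation cnf :: "ord list \<Rightarrow> ord" where
  "cnf as \<equiv> sum_list (map (opow omega) as)"

abbreviation desc :: "ord list \<Rightarrow> bool" where
  "desc \<equiv> sorted_wrt (\<lambda>a b. b \<le> a)"

lemma cnf_less: "(\<forall>a\<in>set as. a \<le> b) \<Longrightarrow> cnf as < opow omega (osucc b)"
proof (induction as)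
  case Nil then show ?case by simp
next
  case (Cons a as)
  have "opow omega a < opow omega (osucc b)"
    using Cons.prems opow_strict_mono[OF one_less_omega, of a "osucc b"] by (simp add: less_osucc_iff)
  then show ?case using Cons add_princ_less[OF add_princ_opow[OF add_princ_omega one_less_omega]] by simp
qed

lemma cnf_unique: "desc as \<Longrightarrow> desc bs \<Longrightarrow> cnf as = cnf bs \<Longrightarrow> as = bs"
proof (induction as arbitrary: bs)
  case Nil
  then show ?case by (cases bs) (auto simp: eq_commute[of "0::ord"])
next
  case (Cons a as)
  then obtain b bs' where bs: "bs = b # bs'" by (cases bs) auto
  have "opow omega a < opow omega (osucc b)" "opow omega b < opow omega (osucc a)"
    using cnf_less[of "a # as" a] cnf_less[of bs b] Cons.prems bs
    by (auto simp: ord_le_add1 intro: order_le_less_trans)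
     (metis ord_le_add1 order_le_less_trans)+
  then have "a = b" by (simp add: opow_less_iff[OF one_less_omega] less_osucc_iff)
  then show ?case using Cons bs by simp
qed

lemma cnf_ex: "\<exists>as. desc as \<and> x = cnf as"
proof (induction x rule: less_induct)
  case (less x)
  show ?case
  proof (cases "x = 0")
    case True then show ?thesis by (intro exI[of _ "[]"]) simp
  next
    case False
    then obtain b q r where x: "x = opow omega b * q + r" "q \<noteq> 0" "q < omega" "r < opow omega b"
      using opow_nf_ex[OF one_less_omega, of x] by auto
    then obtain k where k: "q = onat (Suc k)" using less_omega_iff by (metis onat_0 not0_implies_Suc)
    define y where "y = opow omega b * onat k + r"
    have "onat (Suc k) = 1 + onat k" using onat_add[of 1 k] by (simp add: osucc_0)
    then have xy: "x = opow omega b + y" unfolding x(1) k y_def by (simp add: ord_distrib_left add.assoc)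
    have "y < x" unfolding y_def x(1) k using x(4) by (intro ord_mult_add_less) simp_all
    then obtain as where as: "desc as" "y = cnf as" using less.IH by blast
    have "x < opow omega (osucc b)" using opow_nf_bounds[of omega q r b] x by simp
    have "a \<le> b" if "a \<in> set as" for a
    proof (cases as)
      case (Cons a' as')
      then have "opow omega a' \<le> y" using as by simp
      then have "opow omega a' < opow omega (osucc b)" using \<open>y < x\<close> \<open>x < _\<close> by simp
      then have "a' \<le> b" by (simp add: opow_less_iff[OF one_less_omega] less_osucc_iff)
      then show ?thesis using that Cons as by auto
    qed (use that in simp)
    then show ?thesis using as xy by (intro exI[of _ "b # as"]) simp
  qed
qed

lemma add_princ_cnf: "add_princ (cnf as) \<Longrightarrow> desc as \<Longrightarrow> length as = 1"
proof -
  assume p: "add_princ (cnf as)" and s: "desc as"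
  obtain e where "cnf as = cnf [e]" using p add_princ_iff by auto
  then have "as = [e]" using s by (intro cnf_unique) auto
  then show ?thesis by simp
qed

subsection \<open>The fundamental sequences are well defined\<close>

text \<open>The guards exclude each other; for the two vartheta clauses off the limit points the
  reason is that a value of Theta is additively principal and a Cantor sum of two or more powers is
  not. Within a clause, injectivity of Theta and uniqueness of Cantor normal forms decide.\<close>

lemma fsN_rel_det: "fsN_rel s n x e \<Longrightarrow> fsN_rel s n x e' \<Longrightarrow> e = e'"
proof (induction arbitrary: e' rule: fsN_rel.induct)
  case (fs_zero s n)
  then show ?case by (cases rule: fsN_rel.cases) simp_all
next
  case (fs_big xi s n t)
  note h = fs_big.hyps and IH = fs_big.IH
  from fs_big.prems show ?case
  proof (cases rule: fsN_rel.cases)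
    case (fs_big t') then show ?thesis using IH by blast
  qed (use h in \<open>simp_all add: not_le[symmetric]\<close>)
next
  case (fs_limA xi s z n t)
  note h = fs_limA.hyps and IH = fs_limA.IH
  from fs_limA.prems show ?case
  proof (cases rule: fsN_rel.cases)
    case fs_big then show ?thesis using h by (simp add: not_le[symmetric])
  next
    case (fs_limA z' t')
    then have "z' = z" using h by simp
    then show ?thesis using IH fs_limA by blast
  next
    case (fs_limB z')
    then have "z' = z" using h by simp
    then show ?thesis using h fs_limB by simp
  qed (use h in blast)+
next
  case (fs_limB xi s z n)
  note h = fs_limB.hyps
  from fs_limB.prems show ?case
  proof (cases rule: fsN_rel.cases)
    case fs_big then show ?thesis using h by (simp add: not_le[symmetric])
  next
    case (fs_limA z' t')
    then have "z' = z" using h by simp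
    then show ?thesis using h fs_limA by simp
  next
    case (fs_limB z')
    then have "z' = z" using h by simp
    then show ?thesis using fs_limB by simp
  qed (use h in blast)+
next
  case (fs_sig s xi b n)
  note h = fs_sig.hyps
  from fs_sig.prems show ?case
  proof (cases rule: fsN_rel.cases)
    case fs_big then show ?thesis using h by (simp add: not_le[symmetric])
  next
    case fs_sig
    then show ?thesis using h sys.Theta_inj[OF less_Omega_epsOm less_Omega_epsOm] by metis
  qed (use h in auto)
next
  case (fs_vsum s xi as n t)
  note h = fs_vsum.hyps and IH = fs_vsum.IH
  from fs_vsum.prems show ?case
  proof (cases rule: fsN_rel.cases)
    case fs_big then show ?thesis using h by (simp add: not_le[symmetric])
  next
    case (fs_vsum as' t')
    have "as' = as" using cnf_unique[OF fs_vsum(7) h(6)] h(8) fs_vsum(9) by (simp add: osum_list_eq)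
    then show ?thesis using fs_vsum(1,10) IH by blast
  next
    case (fs_vth b)
    then have "xi \<in> Pset" using sys.Theta_in[OF less_Omega_epsOm, of b VarthetaSys] by simp
    then show ?thesis using add_princ_cnf[of as] h by (simp add: Pset_iff osum_list_eq)
  qed (use h in blast)+
next
  case (fs_vth s xi b n)
  note h = fs_vth.hyps
  from fs_vth.prems show ?case
  proof (cases rule: fsN_rel.cases)
    case fs_big then show ?thesis using h by (simp add: not_le[symmetric])
  next
    case (fs_vsum as t)
    have "xi \<in> Pset" using sys.Theta_in[OF less_Omega_epsOm, of b VarthetaSys] h by simp
    then show ?thesis using add_princ_cnf[of as] fs_vsum by (simp add: Pset_iff osum_list_eq)
  next
    case (fs_vth b')
    then have "b' = b" using h sys.Theta_inj[OF less_Omega_epsOm less_Omega_epsOm] by metis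
    then show ?thesis using fs_vth by simp
  qed (use h in auto)
qed

lemma fsN_eqI: "fsN_rel s n x e \<Longrightarrow> fsN s n x = e"
  unfolding fsN_def using fsN_rel_det by (intro the_equality)

text \<open>A countable tau(w) of a limit w in \<open>epshat\<close> is again of this kind, so these
  are the ordinals on which the recursion for x[n] really runs.\<close>

definition good :: "system \<Rightarrow> ord \<Rightarrow> bool" where
  "good s x \<longleftrightarrow> olimit x \<and> x < Omega \<and> x < ThetaEps (Xof s)"

lemma check_props:
  assumes z: "z \<in> epshat (Xof s)"
  defines "w \<equiv> check (Xof s) z"
  shows "w \<in> epshat (Xof s)" "Cset w \<subseteq> Cset z" "w \<le> z" "w = 0 \<or> olimit w"
    "ThetaStar (Xof s) z \<noteq> 0 \<Longrightarrow> Om_mult w"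
    "ThetaStar (Xof s) z \<noteq> 0 \<Longrightarrow> \<exists>b<Omega. z = w + b"
    "ThetaStar (Xof s) z = 0 \<Longrightarrow> w = z"
proof -
  obtain v b where v: "z = v + b" "Om_mult v" "b < Omega" using Om_mult_decomp by blast
  have ze: "z < epsOm" using z by (simp add: sys.epshat_iff)
  have vz: "v \<le> z" using v by simp
  then have ve: "v < epsOm" using ze by (rule order_le_less_trans)
  have Cv: "Cset v \<subseteq> Cset z" using Cset_Om_mult_add[OF ve v(2,3)] v(1) by auto
  then have oz: "ostar v \<le> ostar z" using ve ze ostar_in ostar_ge by blast
  have w1: "w = v" if "ThetaStar (Xof s) z \<noteq> 0"
    using that omul_eq[OF v(2,3)] v(1) by (simp add: w_def check_def)
  have w2: "w = z" if "ThetaStar (Xof s) z = 0"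
    using that by (simp add: w_def check_def)
  show "w \<in> epshat (Xof s)" "Cset w \<subseteq> Cset z" "w \<le> z"
    using w1 w2 vz ve Cv oz z by (cases "ThetaStar (Xof s) z = 0"; auto simp: sys.epshat_iff)+
  show "w = 0 \<or> olimit w"
  proof (cases "ThetaStar (Xof s) z = 0")
    case True
    \<comment> \<open>Theta*(y + 1) = Theta(y) is never 0.\<close>
    then have "\<not> is_succ z" using sys.Theta_neq_0 ze less_osucc order_less_trans
      by (metis sys.ThetaStar_succ is_succ_def)
    then show ?thesis using w2[OF True] by (auto simp: olimit_def)
  next
    case False then show ?thesis using w1 olimit_Om_mult v by blast
  qed
  show "ThetaStar (Xof s) z \<noteq> 0 \<Longrightarrow> Om_mult w" "ThetaStar (Xof s) z \<noteq> 0 \<Longrightarrow> \<exists>b<Omega. z = w + b"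
    "ThetaStar (Xof s) z = 0 \<Longrightarrow> w = z" using w1 w2 v by blast+
qed

lemma good_tau:
  assumes "w \<in> epshat (Xof s)" "olimit w" "tau w < Omega"
  shows "good s (tau w)" "tau w \<le> ostar w" "tau w \<in> Cset w"
proof -
  have we: "w < epsOm" using assms by (simp add: sys.epshat_iff)
  have 1: "olimit (tau w)" "tau w \<in> Cset w" using tau_limit[OF assms(2) we] assms(3) by auto
  then show 2: "tau w \<le> ostar w" using ostar_ge[OF we] by blast
  show "good s (tau w)" using 1 2 assms by (auto simp: good_def sys.epshat_iff)
  show "tau w \<in> Cset w" by fact
qed

lemma fsN_rel_epshat:
  assumes IH: "\<And>y. good s y \<Longrightarrow> y < x \<Longrightarrow> \<exists>e. fsN_rel s n y e"
   and w: "w \<in> epshat (Xof s)" "w = 0 \<or> olimit w" "ostar w < x" "tau w < Omega"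
  shows "\<exists>e. fsN_rel s n w e"
proof -
  consider "w = 0" | "olimit w" "w < Omega" | "olimit w" "Omega \<le> w" using w(2) by fastforce
  then show ?thesis
  proof cases
    case 1 then show ?thesis using fs_zero by blast
  next
    case 2 then show ?thesis using IH[of w] w by (auto simp: good_def sys.epshat_iff)
  next
    case 3
    have "tau w < x" using good_tau(2)[OF w(1) 3(1) w(4)] w(3) by simp
    then obtain t where "fsN_rel s n (tau w) t" using IH good_tau(1)[OF w(1) 3(1) w(4)] by blast
    then show ?thesis using fs_big[OF 3(2) w(1,4)] by blast
  qed
qed

text \<open>The cases match the clauses for countable ordinals. For sigma every countable limit is a
  limit point of X. For vartheta, a principal x off the limit points is Theta(b) with b countable,
  since uncountable arguments give limit points, and b is a jump by
  \<open>countable_limit_cases\<close>; any other x off the limit points has at least two terms in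
  its Cantor normal form.\<close>

lemma good_Theta_cases:
  assumes x: "good s x"
  obtains (lim) z where "z \<in> epshat (Xof s)" "x = Theta (Xof s) z" "x \<in> lim_pts (Xof s)"
  | (jump) b where "s = VarthetaSys" "x = Theta (Xof s) b" "x \<notin> lim_pts (Xof s)" "b < Omega"
      "b \<in> JUMP (Xof s)" "ThetaStar (Xof s) b \<noteq> 0" "b \<in> epshat (Xof s)"
  | (sum) as where "s = VarthetaSys" "x \<notin> lim_pts (Xof s)" "desc as" "2 \<le> length as" "x = cnf as"
      "good s (opow omega (last as))" "opow omega (last as) < x" "x = cnf (butlast as) + opow omega (last as)"
proof -
  have x': "olimit x" "x < Omega" "x < ThetaEps (Xof s)" using x by (auto simp: good_def)
  show ?thesis
  proof (cases "x \<in> lim_pts (Xof s)")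
    case True
    then show ?thesis using sys.Theta_surj[OF sys.lim_pts_in[OF True] x'(3)] lim by blast
  next
    case nlim: False
    have V: "s = VarthetaSys"
    proof (cases s)
      case SigmaSys
      have "\<exists>z\<in>Xsig. y < z \<and> z < x" if "y < x" for y
        using that x' olimit_succ_less[OF x'(1) that] by (intro bexI[of _ "osucc y"]) (auto simp: Xsig_def)
      then have "x \<in> lim_pts Xsig" using x' olimit_pos by (simp add: lim_pts_def)
      then show ?thesis using nlim SigmaSys by simp
    qed
    show ?thesis
    proof (cases "x \<in> Pset")
      case True
      then obtain b where b: "b \<in> epshat (Xof s)" "Theta (Xof s) b = x"
        using sys.Theta_surj[of x s] x' V by auto
      have be: "b < epsOm" using b by (simp add: sys.epshat_iff)
      have bO: "b < Omega" using sys.Theta_big_lim_pts[of b s] be b nlim by (meson not_le)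
      have b0: "b \<noteq> 0"
      proof
        assume "b = 0"
        have "1 \<in> Pset" by (auto simp: Pset_iff add_princ_def)
        then have "Theta (Xof s) 0 \<le> 1" using V by (intro sys.Theta_least) auto
        then have "x \<le> 1" using b \<open>b = 0\<close> by simp
        then show False using x'(1) by (metis olimit_neq_0 olimit_osucc ord_one_le ord_pos_iff order_antisym osucc_0)
      qed
      have J: "is_succ b \<or> b \<in> FIX (Xof s)"
        using sys.countable_limit_cases[of b s] b bO b0 nlim by (auto simp: olimit_def)
      have "ThetaStar (Xof s) b \<noteq> 0"
      proof (cases "is_succ b")
        case True
        then show ?thesis using be sys.Theta_neq_0 less_osucc order_less_trans
          by (metis is_succ_def sys.ThetaStar_succ)
      next
        case False
        then have "b \<in> FIX (Xof s)" "olimit b" using J b0 by (auto simp: olimit_def)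
        then show ?thesis using False olimit_tau[OF _ be] olimit_neq_0 by (simp add: ThetaStar_def)
      qed
      then show ?thesis using jump[of b] V b bO J nlim by (auto simp: JUMP_def)
    next
      case False
      obtain as where as: "desc as" "x = cnf as" using cnf_ex by blast
      have np: "\<not> add_princ x" using False x' by (simp add: Pset_iff)
      have "as \<noteq> []" using as x'(1) by auto
      moreover have "length as \<noteq> 1"
      proof
        assume "length as = 1"
        then obtain a where "as = [a]" by (metis One_nat_def length_0_conv length_Suc_conv)
        then show False using np as add_princ_iff by auto
      qed
      ultimately have len: "2 \<le> length as" by (cases as) (auto simp: Suc_le_eq)
      define p where "p = opow omega (last as)"
      have "as = butlast as @ [last as]" using \<open>as \<noteq> []\<close> by simp
      then have xp: "x = cnf (butlast as) + p" using as(2) unfolding p_def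
        by (metis (no_types, lifting) add_0_right list.simps(8,9) map_append sum_list.Cons sum_list.Nil sum_list.append)
      have "p \<noteq> x" using np add_princ_iff p_def by blast
      then have px: "p < x" using xp by (metis ord_le_add2 order_le_less)
      have "p \<noteq> 0" by (simp add: p_def)
      then have "olimit p" using x'(1) xp olimit_add_iff by (metis ord_pos_iff)
      then have "good s p" using px x' by (auto simp: good_def)
      then show ?thesis using sum[of as] V as len px xp nlim unfolding p_def by blast
    qed
  qed
qed

lemma fsN_rel_limA:
  assumes "good s x" "z \<in> epshat (Xof s)" "x = Theta (Xof s) z" "x \<in> lim_pts (Xof s)"
    "tau (check (Xof s) z) < Omega" "fsN_rel s n (check (Xof s) z) t"
  shows "fsN_rel s n x (Theta (Xof s) (t + ThetaStar (Xof s) z))"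
  using assms sys.Theta_inv_Theta[OF assms(2)] olimit_neq_0 unfolding good_def
  by (intro fs_limA) auto

lemma fsN_rel_limB:
  assumes "good s x" "z \<in> epshat (Xof s)" "x = Theta (Xof s) z" "x \<in> lim_pts (Xof s)"
    "tau (check (Xof s) z) = Omega"
  shows "fsN_rel s n x (ThetaIter (Xof s) z n)"
  using assms sys.Theta_inv_Theta[OF assms(2)] olimit_neq_0 unfolding good_def
  by (intro fs_limB) auto

lemma fsN_ex: "good s x \<Longrightarrow> \<exists>e. fsN_rel s n x e"
proof (induction x rule: less_induct)
  case (less x)
  from less.prems show ?case
  proof (cases rule: good_Theta_cases)
    case (lim z)
    let ?w = "check (Xof s) z"
    have we: "?w \<in> epshat (Xof s)" "?w = 0 \<or> olimit ?w" using check_props[OF lim(1)] by blast+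
    have ze: "z < epsOm" "?w < epsOm" using lim we by (simp_all add: sys.epshat_iff)
    show ?thesis
    proof (cases "tau ?w = Omega")
      case True then show ?thesis using fsN_rel_limB[OF less.prems lim] by blast
    next
      case False
      then have t: "tau ?w < Omega" using tau_le_Omega[OF ze(2)] by simp
      have "ostar ?w \<le> ostar z" using check_props(2)[OF lim(1)] ostar_in[OF ze(2)] ostar_ge[OF ze(1)] by blast
      then have "ostar ?w < x" using sys.ostar_less_Theta[OF ze(1), of s] lim(2) by simp
      then obtain e where "fsN_rel s n ?w e" using fsN_rel_epshat[of s x n ?w] less.IH we t by blast
      then show ?thesis using fsN_rel_limA[OF less.prems lim t] by blast
    qed
  next
    case (jump b)
    then show ?thesis using fs_vth[of s x b n] less.prems olimit_neq_0 unfolding good_def by blast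
  next
    case (sum as)
    then obtain t where "fsN_rel s n (opow omega (last as)) t" using less.IH by blast
    then show ?thesis using fs_vsum[of s x as n t] less.prems sum olimit_neq_0 unfolding good_def
      by (metis osum_list_eq)
  qed
qed

lemma fsN_rel_fsN: "good s x \<Longrightarrow> fsN_rel s n x (fsN s n x)"
  using fsN_ex fsN_eqI by metis

text \<open>A countable limit w satisfies tau(w) = w and w[t] = t, so the clause for uncountable
  ordinals describes countable ones too, and later proofs can treat both alike.\<close>

lemma fsN_fsO:
  assumes w: "w \<in> epshat (Xof s)" "olimit w" "tau w < Omega"
  shows "fsN s n w = fsO w (fsN s n (tau w))" "fsN_rel s n w (fsN s n w)"
proof -
  have we: "w < epsOm" using w by (simp add: sys.epshat_iff)
  have g: "good s (tau w)" using good_tau(1)[OF w] .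
  have "fsN s n w = fsO w (fsN s n (tau w)) \<and> fsN_rel s n w (fsN s n w)"
  proof (cases "w < Omega")
    case True
    then have "tau w = w" "fsO w t = t" for t
      using tau_Om_mult_add[of 0 w] fsO_Om_mult_add[of 0 w t] w by auto
    then show ?thesis using fsN_rel_fsN g by simp
  next
    case False
    then have "fsN_rel s n w (fsO w (fsN s n (tau w)))" using fsN_rel_fsN[OF g] w by (intro fs_big) auto
    then show ?thesis using fsN_eqI by metis
  qed
  then show "fsN s n w = fsO w (fsN s n (tau w))" "fsN_rel s n w (fsN s n w)" by blast+
qed

lemma fsN_limA:
  assumes "good s (Theta (Xof s) z)" "z \<in> epshat (Xof s)" "Theta (Xof s) z \<in> lim_pts (Xof s)"
    "tau (check (Xof s) z) < Omega" "olimit (check (Xof s) z)"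
  shows "fsN s n (Theta (Xof s) z) = Theta (Xof s) (fsN s n (check (Xof s) z) + ThetaStar (Xof s) z)"
  using fsN_fsO(2) check_props(1) assms by (intro fsN_eqI fsN_rel_limA[OF assms(1,2) refl assms(3,4)]) blast

lemma fsN_limB:
  assumes "good s (Theta (Xof s) z)" "z \<in> epshat (Xof s)" "Theta (Xof s) z \<in> lim_pts (Xof s)"
    "tau (check (Xof s) z) = Omega"
  shows "fsN s n (Theta (Xof s) z) = ThetaIter (Xof s) z n"
  using assms by (intro fsN_eqI fsN_rel_limB[OF assms(1,2) refl assms(3,4)])

lemma fsN_jump:
  assumes "good s x" "s = VarthetaSys" "x = Theta (Xof s) b" "x \<notin> lim_pts (Xof s)" "b < Omega" "b \<in> JUMP (Xof s)"
  shows "fsN s n x = ThetaStar (Xof s) b * onat n"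
  using assms olimit_neq_0 unfolding good_def by (intro fsN_eqI fs_vth) auto

lemma fsN_sum:
  assumes "good s x" "s = VarthetaSys" "x \<notin> lim_pts (Xof s)" "desc as" "2 \<le> length as" "x = cnf as"
      "good s (opow omega (last as))"
  shows "fsN s n x = cnf (butlast as) + fsN s n (opow omega (last as))"
  using assms olimit_neq_0 fsN_rel_fsN[OF assms(7), of n] fs_vsum[of s x as n] unfolding good_def
  by (intro fsN_eqI) (metis osum_list_eq)

text \<open>If \<open>check\<close> gave 0, then either z = 0 and Theta(0) is the least member of X,
  or z is countable with Theta*(z) > 0 and \<open>countable_jump_cases\<close> applies; neither
  value is a limit point.\<close>

lemma olimit_check:
  assumes z: "z \<in> epshat (Xof s)" "Theta (Xof s) z \<in> lim_pts (Xof s)"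
  shows "olimit (check (Xof s) z)"
proof (rule ccontr)
  let ?w = "check (Xof s) z"
  assume "\<not> olimit ?w"
  then have w0: "?w = 0" using check_props(4)[OF z(1)] by blast
  show False
  proof (cases "ThetaStar (Xof s) z = 0")
    case True
    then have "z = 0" using check_props(7)[OF z(1)] w0 by simp
    moreover have "0 < Theta (Xof s) 0" using sys.Theta_neq_0[of 0 s] by simp
    ultimately have "\<exists>p\<in>Xof s. 0 < p \<and> p < Theta (Xof s) 0"
      using z(2) unfolding lim_pts_def by blast
    then obtain p where p: "p \<in> Xof s" "0 < p" "p < Theta (Xof s) 0" by blast
    then have "Theta (Xof s) 0 \<le> p" by (intro sys.Theta_least) auto
    then show False using p by simp
  next
    case False
    then have "z < Omega" using check_props(6)[OF z(1)] w0 by auto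
    then show False using sys.countable_jump_cases[of z s] False z by blast
  qed
qed

subsection \<open>Bounds on the fundamental sequences\<close>

text \<open>Counterpart of \<open>Cset_osucc\<close>: the last coefficient can only grow and the
  others stay.\<close>

lemma Cset_osucc_ge: "a < epsOm \<Longrightarrow> d \<in> Cset a \<Longrightarrow> \<exists>c\<in>Cset (osucc a). d \<le> c"
proof (induction a rule: nf_induct)
  case zero then show ?case by (intro bexI[of _ 0]) (auto simp: Cset_countable)
next
  case (nf a b c)
  show ?case
  proof (cases "a = 0")
    case True
    then have "c = 0" "b < Omega" using nf(1) by (auto simp: is_nf_def)
    then show ?thesis using nf.prems True by (auto simp: Cset_countable)
  next
    case False
    then have n': "is_nf a b (osucc c)" using nf(1) olimit_Om[OF False] olimit_succ_less by (auto simp: is_nf_def)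
    have "Om a * b + osucc c < epsOm" using nf(2) olimit_succ_less[OF olimit_add_princ[OF add_princ_epsOm]]
      order_less_trans[OF one_less_Omega epsOm_props(1)] by simp
    then have C': "Cset (osucc (Om a * b + c)) = Cset a \<union> Cset (osucc c) \<union> {b}"
      using Cset_nf[OF n'] by simp
    have "d \<in> Cset a \<union> {b} \<or> d \<in> Cset c" using nf.prems Cset_nf[OF nf(1,2)] by blast
    then show ?thesis
    proof
      assume "d \<in> Cset a \<union> {b}" then show ?thesis unfolding C' by (intro bexI[of _ d]) auto
    next
      assume "d \<in> Cset c" then show ?thesis unfolding C' using nf.IH(2) by blast
    qed
  qed
qed

lemma Cset_fsO_le:
  "olimit x \<Longrightarrow> x < epsOm \<Longrightarrow> th < tau x \<Longrightarrow> c \<in> Cset (fsO x th) \<Longrightarrow> c \<le> th \<or> (\<exists>d\<in>Cset x. c \<le> d)"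
proof (induction x rule: lim_nf_induct)
  case (rest a b r)
  note t = tau_fsO_rest[OF rest(1,2,3), of th]
  have lt: "fsO r th < r" using fsO_less rest t by simp
  have n': "is_nf a b (fsO r th)" using rest(1) lt by (auto simp: is_nf_def)
  have "Om a * b + fsO r th < Om a * b + r" using lt by simp
  then have "Om a * b + fsO r th < epsOm" using rest(3) by (rule order_less_trans)
  then have "Cset (fsO (Om a * b + r) th) = Cset a \<union> Cset (fsO r th) \<union> {b}" using Cset_nf[OF n'] t by simp
  then have "c \<in> Cset a \<union> {b} \<or> c \<in> Cset (fsO r th)" using rest.prems by blast
  then show ?case
  proof
    assume "c \<in> Cset a \<union> {b}" then show ?thesis using Cset_nf[OF rest(1,3)] by blast
  next
    assume "c \<in> Cset (fsO r th)"
    then have "c \<le> th \<or> (\<exists>d\<in>Cset r. c \<le> d)" using rest.IH rest.prems t by simp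
    then show ?thesis using Cset_nf[OF rest(1,3)] by blast
  qed
next
  case (lim a b)
  note t = tau_fsO_lim[OF lim(1,2,3), of th]
  show ?case
  proof (cases "th = 0")
    case True then show ?thesis using lim.prems t by simp
  next
    case False
    then have n': "is_nf a th 0" using lim t by (auto simp: is_nf_def)
    have "Om a * th < Om a * b" using lim.prems t by simp
    then have "Om a * th < epsOm" using lim(3) by (rule order_less_trans)
    then show ?thesis using Cset_Om_mult[OF n'] Cset_Om_mult[OF lim(1,3)] lim.prems t by auto
  qed
next
  case (Suc a)
  note t = tau_fsO_Suc[OF Suc(1), of th]
  show ?case
  proof (cases "th = 0")
    case True then show ?thesis using Suc.prems t by simp
  next
    case False
    then have n': "is_nf a th 0" using Suc t by (auto simp: is_nf_def)
    have "Om a * th < Om (osucc a)" using Suc.prems t by (simp add: opow_osucc)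
    then have "Om a * th < epsOm" using Suc(1) by (rule order_less_trans)
    then have "c \<in> Cset a \<or> c = 0 \<or> c = th" using Cset_Om_mult[OF n'] Suc.prems t by auto
    then show ?thesis using Cset_osucc_ge[OF Suc(2)] Cset_Om[OF Suc(1)] by auto
  qed
next
  case (mult a b)
  note t = tau_fsO_mult[OF mult(1,2,3,4), of th]
  have lt: "fsO (Om a) th < Om a" using fsO_less[OF olimit_Om[OF mult(3)] mult(5)] mult.prems t by simp
  have n': "is_nf a b (fsO (Om a) th)" using mult(2) lt by (auto simp: is_nf_def)
  have "Om a * b + fsO (Om a) th < Om a * osucc b" using lt by simp
  then have "Om a * b + fsO (Om a) th < epsOm" using mult(4) by (rule order_less_trans)
  then have "Cset (fsO (Om a * osucc b) th) = Cset a \<union> Cset (fsO (Om a) th) \<union> {b}"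
    using Cset_nf[OF n'] t by simp
  then have c: "c \<in> Cset a \<or> c = b \<or> c \<in> Cset (fsO (Om a) th)" using mult.prems by blast
  have C: "Cset (Om a * osucc b) = Cset a \<union> {0, osucc b}" "Cset (Om a) = Cset a \<union> {0, 1}"
    using Cset_Om_mult[OF mult(1,4)] Cset_Om[OF mult(5)] by blast+
  have "1 \<le> osucc b" by (simp add: ord_one_le)
  show ?case using c
  proof (elim disjE)
    assume "c \<in> Cset (fsO (Om a) th)"
    then have "c \<le> th \<or> (\<exists>d\<in>Cset (Om a). c \<le> d)" using mult.IH mult.prems t by simp
    then show ?thesis unfolding C using \<open>1 \<le> osucc b\<close> by (auto intro: order_trans)
  qed (auto simp: C simp del: ord_mult_osucc)
next
  case (exp a)
  note t = tau_fsO_exp[OF exp(1,2), of th]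
  have lt: "fsO a th < a" using fsO_less[OF exp(1,3)] exp.prems t by simp
  then have "fsO a th < epsOm" using exp(3) by (rule order_less_trans)
  then have "Cset (fsO (Om a) th) = Cset (fsO a th) \<union> {0, 1}" using Cset_Om[OF Om_less_epsOm] t by simp
  then have "c \<in> Cset (fsO a th) \<or> c = 0 \<or> c = 1" using exp.prems by blast
  then show ?case
  proof (elim disjE)
    assume "c \<in> Cset (fsO a th)"
    then have "c \<le> th \<or> (\<exists>d\<in>Cset a. c \<le> d)" using exp.IH exp.prems t by simp
    then show ?thesis using Cset_Om[OF exp(2)] by blast
  qed (auto simp: Cset_Om[OF exp(2)])
qed

lemma ThetaStar_less_Theta: "z < epsOm \<Longrightarrow> ThetaStar (Xof s) z < Theta (Xof s) z"
proof (cases "is_succ z")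
  assume z: "z < epsOm"
  case True
  then obtain y where y: "z = osucc y" by (auto simp: is_succ_def)
  have ye: "y < epsOm" using z y less_osucc order_less_trans by blast
  obtain c where "c \<in> Cset z" "ostar y \<le> c" using Cset_osucc_ge[OF ye ostar_in[OF ye]] y by blast
  then have "ostar y \<le> ostar z" using ostar_ge[OF z] order_trans by blast
  then have "ostar y < Theta (Xof s) z" using sys.ostar_less_Theta[OF z] order_le_less_trans by blast
  then show ?thesis using sys.Theta_mono[OF z, of y s] y by (simp add: sys.ThetaStar_succ)
next
  assume z: "z < epsOm"
  case False
  then show ?thesis using sys.ostar_less_Theta[OF z, of s] sys.Theta_neq_0[OF z, of s] z
    by (auto simp: ThetaStar_def FIX_def)
qed

lemma ThetaIter_props:
  assumes z: "z \<in> epshat (Xof s)" "olimit (check (Xof s) z)" "tau (check (Xof s) z) = Omega"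
  shows "ThetaIter (Xof s) z i < Theta (Xof s) z" "ThetaIter (Xof s) z i < Omega"
    "ThetaIter (Xof s) z i < ThetaIter (Xof s) z (Suc i)"
    "fsO (check (Xof s) z) (ThetaIter (Xof s) z i) < check (Xof s) z"
    "fsO (check (Xof s) z) (ThetaIter (Xof s) z i) < epsOm"
proof -
  let ?w = "check (Xof s) z" and ?T = "Theta (Xof s) z"
  have ze: "z < epsOm" using z by (simp add: sys.epshat_iff)
  have w: "?w \<le> z" "Cset ?w \<subseteq> Cset z" using check_props[OF z(1)] by blast+
  then have we: "?w < epsOm" using ze by simp
  have Cw: "c < ?T" if "c \<in> Cset ?w" for c
    using that w(2) ostar_ge[OF ze] sys.ostar_less_Theta[OF ze] by (meson order_le_less_trans subsetD)
  have TO: "?T < Omega" using sys.Theta_less_Omega[OF ze] .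
  have step: "fsO ?w th < ?w \<and> fsO ?w th < epsOm" if "th < Omega" for th
    using fsO_less[OF z(2) we] that z(3) we by (metis order_less_trans)
  have lt: "ThetaIter (Xof s) z i < ?T" for i
  proof (induction i)
    case 0 then show ?case using ThetaStar_less_Theta[OF ze] by simp
  next
    case (Suc i)
    let ?th = "ThetaIter (Xof s) z i"
    have thO: "?th < Omega" using Suc TO by simp
    have f: "fsO ?w ?th < ?w" "fsO ?w ?th < epsOm" using step[OF thO] by blast+
    have "ostar (fsO ?w ?th) < ?T"
      unfolding ostar_less_iff[OF f(2)] using Cset_fsO_le[OF z(2) we, of ?th] thO z(3) Cw Suc
      by (metis order_le_less_trans)
    moreover have "fsO ?w ?th < z" using f(1) w(1) by simp
    ultimately show ?case using sys.Theta_mono[OF ze] by simp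
  qed
  then show "ThetaIter (Xof s) z i < ?T" .
  then show thO: "ThetaIter (Xof s) z i < Omega" using TO by simp
  show f: "fsO ?w (ThetaIter (Xof s) z i) < ?w" and fe: "fsO ?w (ThetaIter (Xof s) z i) < epsOm"
    using step[OF thO] by blast+
  show "ThetaIter (Xof s) z i < ThetaIter (Xof s) z (Suc i)"
  \<comment> \<open>A positive member of the sequence is a coefficient of the next argument, hence
    smaller than the next value.\<close>
  proof (cases "ThetaIter (Xof s) z i = 0")
    case True then show ?thesis using sys.Theta_neq_0[OF fe] by simp
  next
    case False
    then have "ThetaIter (Xof s) z i \<in> Cset (fsO ?w (ThetaIter (Xof s) z i))"
      using Cset_fsO[OF z(2) we] z(3) thO by auto
    then have "ThetaIter (Xof s) z i \<le> ostar (fsO ?w (ThetaIter (Xof s) z i))" using ostar_ge[OF fe] by blast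
    then show ?thesis using sys.ostar_less_Theta[OF fe, of s] by simp
  qed
qed

lemma ThetaIter_mono:
  assumes z: "z \<in> epshat (Xof s)" "olimit (check (Xof s) z)" "tau (check (Xof s) z) = Omega" "i < j"
  shows "ThetaIter (Xof s) z i < ThetaIter (Xof s) z j"
  by (rule lift_Suc_mono_less[OF _ z(4)]) (rule ThetaIter_props(3)[OF z(1-3)])

text \<open>Collects the facts about the argument u + t of x[n] when tau is countable. If t is
  nonzero then u is a multiple of \<open>Omega\<close>, so t enters as a coefficient of its
  own.\<close>

lemma limA_props:
  assumes z: "z \<in> epshat (Xof s)" "olimit (check (Xof s) z)" "tau (check (Xof s) z) < Omega"
    and th: "0 < th" "th < tau (check (Xof s) z)"
  defines "u \<equiv> fsO (check (Xof s) z) th" and "t \<equiv> ThetaStar (Xof s) z"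
  shows "u < check (Xof s) z" "u + t < z" "u + t < epsOm" "u < epsOm"
    "t \<noteq> 0 \<Longrightarrow> Om_mult u" "Cset (u + t) = (if t = 0 then Cset u else insert t (Cset u))"
    "th \<in> Cset u" "ostar (u + t) < Theta (Xof s) z" "t < Omega"
proof -
  let ?w = "check (Xof s) z" and ?T = "Theta (Xof s) z"
  have ze: "z < epsOm" using z by (simp add: sys.epshat_iff)
  have w: "?w \<le> z" "Cset ?w \<subseteq> Cset z" using check_props[OF z(1)] by blast+
  then have we: "?w < epsOm" using ze by simp
  have Cw: "c < ?T" if "c \<in> Cset ?w" for c
    using that w(2) ostar_ge[OF ze] sys.ostar_less_Theta[OF ze] by (meson order_le_less_trans subsetD)
  show u: "u < ?w" unfolding u_def by (rule fsO_less[OF z(2) we th(2)])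
  show ue: "u < epsOm" using u we by simp
  show tO: "t < Omega" unfolding t_def by (rule sys.ThetaStar_less_Omega[OF ze])
  show Om: "t \<noteq> 0 \<Longrightarrow> Om_mult u"
    using Om_mult_fsO[OF z(2) we _ z(3) th(1)] check_props(5)[OF z(1)] unfolding u_def t_def by blast
  show "u + t < z"
  proof (cases "t = 0")
    case True then show ?thesis using u w by simp
  next
    case False
    then have "Om_mult ?w" using check_props(5)[OF z(1)] unfolding t_def by blast
    then have "u + t < ?w" using Om_mult_less u tO by blast
    then show ?thesis using w by simp
  qed
  then show ute: "u + t < epsOm" using ze by simp
  show C: "Cset (u + t) = (if t = 0 then Cset u else insert t (Cset u))"
    using Cset_Om_mult_add[OF ue Om tO] by auto
  show "th \<in> Cset u" unfolding u_def using Cset_fsO[OF z(2) we] th by auto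
  have thT: "th < ?T" using th(2) Cw good_tau(3)[OF check_props(1)[OF z(1)] z(2,3)] by (meson order_less_trans)
  have "c < ?T" if "c \<in> Cset u" for c
    using Cset_fsO_le[OF z(2) we th(2)] that Cw thT unfolding u_def by (metis order_le_less_trans)
  moreover have "t < ?T" unfolding t_def by (rule ThetaStar_less_Theta[OF ze])
  ultimately show "ostar (u + t) < ?T" unfolding ostar_less_iff[OF ute] C by auto
qed

text \<open>The index 0 is excluded because x[0] may be 0: for instance Theta^(0) where Theta* is 0,
  or the product of Theta* with 0.\<close>

lemma fsN_bounds: "good s x \<Longrightarrow> 0 < n \<Longrightarrow> 0 < fsN s n x \<and> fsN s n x < x"
proof (induction x rule: less_induct)
  case (less x)
  from less.prems(1) show ?case
  proof (cases rule: good_Theta_cases)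
    case (lim z)
    let ?w = "check (Xof s) z"
    have l: "Theta (Xof s) z \<in> lim_pts (Xof s)" "good s (Theta (Xof s) z)" using lim less.prems by auto
    have ol: "olimit ?w" by (rule olimit_check[OF lim(1) l(1)])
    have ze: "z < epsOm" using lim by (simp add: sys.epshat_iff)
    have we: "?w < epsOm" using check_props(1)[OF lim(1)] by (simp add: sys.epshat_iff)
    show ?thesis
    proof (cases "tau ?w = Omega")
      case True
      obtain i where n: "n = Suc i" using less.prems(2) by (cases n) auto
      show ?thesis using fsN_limB[OF l(2) lim(1) l(1) True] ThetaIter_props(1)[OF lim(1) ol True, of "Suc i"]
         sys.Theta_neq_0[OF ThetaIter_props(5)[OF lim(1) ol True, of i], of s] unfolding lim(2) n by simp
    next
      case False
      then have t: "tau ?w < Omega" using tau_le_Omega[OF we] by simp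
      have tw: "good s (tau ?w)" "tau ?w \<in> Cset ?w" using good_tau[OF check_props(1)[OF lim(1)] ol t] by blast+
      then have "tau ?w \<in> Cset z" using check_props(2)[OF lim(1)] by blast
      then have "tau ?w < x" using ostar_ge[OF ze] sys.ostar_less_Theta[OF ze, of s] lim(2)
        by (meson order_le_less_trans)
      then have th: "0 < fsN s n (tau ?w)" "fsN s n (tau ?w) < tau ?w" using less.IH tw less.prems by blast+
      note L = limA_props[OF lim(1) ol t th]
      show ?thesis
        using fsN_limA[OF l(2) lim(1) l(1) t ol, of n] fsN_fsO(1)[OF check_props(1)[OF lim(1)] ol t, of n]
          sys.Theta_mono[OF ze L(2,8)] sys.Theta_neq_0[OF L(3), of s] lim(2) by simp
    qed
  next
    case (jump b)
    have be: "b < epsOm" using jump less_Omega_epsOm by blast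
    have f: "fsN s n x = ThetaStar (Xof s) b * onat n" using fsN_jump less.prems jump by blast
    have ap: "add_princ x" using sys.Theta_in[OF be, of s] jump by (simp add: Pset_iff)
    have lt: "ThetaStar (Xof s) b < x" unfolding jump(2) by (rule ThetaStar_less_Theta[OF be])
    have "ThetaStar (Xof s) b * onat m < x" for m
    proof (induction m)
      case 0 then show ?case using less.prems olimit_neq_0 by (simp add: good_def)
    next
      case (Suc m) then show ?case using add_princ_less[OF ap _ lt] by simp
    qed
    moreover have "onat n \<noteq> 0" using less.prems(2) by (cases n) auto
    ultimately show ?thesis using f jump by simp
  next
    case (sum as)
    have "fsN s n x = cnf (butlast as) + fsN s n (opow omega (last as))"
      by (rule fsN_sum[OF less.prems(1) sum(1-6)])
    then show ?thesis using less.IH[OF sum(7,6) less.prems(2)] sum(8) by (metis ord_add_less_cancel_left ord_add_pos)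
  qed
qed

lemma denotes_0: "0 < k \<Longrightarrow> denotes s k 0"
  unfolding denotes_def by (intro exI[of _ TZero]) simp

lemma denotes_pos: "denotes s k x \<Longrightarrow> 0 < k"
  unfolding denotes_def using tsize_pos by (metis One_nat_def Suc_le_lessD order_less_le_trans zero_less_one)

text \<open>The induction hypothesis appears as a premise because the step is taken inside the
  induction, for \<open>check\<close> of an argument, and again at the very end for the ordinal of
  the theorem.\<close>

lemma less_fsN_big:
  assumes v: "v \<in> epshat (Xof s)" "olimit v" "tau v < Omega" and c: "denotes s k c" "c < v" "k \<le> m"
   and IH: "\<And>c x. denotes s k c \<Longrightarrow> good s x \<Longrightarrow> x \<le> ostar v \<Longrightarrow> c < x \<Longrightarrow> c < fsN s m x"
  shows "c < fsN s m v"
proof -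
  have ve: "v < epsOm" using v by (simp add: sys.epshat_iff)
  have "d < fsN s m (tau v)" if "d \<in> Cset c" "d < tau v" for d
    using IH[OF denotes_Cset[OF c(1) that(1)] good_tau(1,2)[OF v] that(2)] .
  then show ?thesis unfolding fsN_fsO(1)[OF v] using less_fsO[OF v(2) ve c(2)] by blast
qed

text \<open>The step shared by both systems. \<open>IH1\<close> comes from the induction on norms
  and is applied to h and its coefficients; \<open>IH2\<close> comes from an induction on the upper
  ordinal for the same Theta(h). The condition \<open>Suc k \<le> n\<close> reserves one index for
  the outer symbol Theta.\<close>

lemma fsN_bound_Theta:
  assumes z: "z \<in> epshat (Xof s)" "good s (Theta (Xof s) z)" "Theta (Xof s) z \<in> lim_pts (Xof s)"
    and h: "denotes s k h" "Theta (Xof s) h < Theta (Xof s) z" "Suc k \<le> n"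
    and IH1: "\<And>c m x. denotes s k c \<Longrightarrow> k \<le> m \<Longrightarrow> good s x \<Longrightarrow> x \<le> Theta (Xof s) z \<Longrightarrow> c < x \<Longrightarrow> c < fsN s m x"
    and IH2: "\<And>x. good s x \<Longrightarrow> x < Theta (Xof s) z \<Longrightarrow> Theta (Xof s) h < x \<Longrightarrow> Theta (Xof s) h < fsN s n x"
  shows "Theta (Xof s) h < fsN s n (Theta (Xof s) z)"
proof -
  let ?Th = "Theta (Xof s)" and ?w = "check (Xof s) z" and ?t = "ThetaStar (Xof s) z"
  have ze: "z < epsOm" using z by (simp add: sys.epshat_iff)
  have he: "h < epsOm" using h denotes_less_epsOm by blast
  have W: "?w \<in> epshat (Xof s)" "Cset ?w \<subseteq> Cset z" "?w \<le> z" using check_props[OF z(1)] by blast+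
  have we: "?w < epsOm" using W by (simp add: sys.epshat_iff)
  have ol: "olimit ?w" by (rule olimit_check[OF z(1,3)])
  have oz: "ostar ?w \<le> ostar z" using ostar_in[OF we] W(2) ostar_ge[OF ze] by blast
  have ozT: "ostar z < ?Th z" by (rule sys.ostar_less_Theta[OF ze])
  have ohT: "ostar h < ?Th z" using sys.ostar_less_Theta[OF he, of s] h(2) by simp
  have star: "ostar h < fsN s m (?Th z)" if "k \<le> m" for m
    using IH1[OF denotes_Cset[OF h(1) ostar_in[OF he]] that z(2) order_refl ohT] .
  have n1: "0 < n" "k \<le> n" using h(3) by auto
  have cases: "\<lbrakk>h < ?w \<Longrightarrow> P; ?t \<noteq> 0 \<Longrightarrow> ?Th h \<le> ?t \<Longrightarrow> P; ?t = 0 \<Longrightarrow> ?w = z \<Longrightarrow> z < h \<Longrightarrow> ?Th h \<le> ostar z \<Longrightarrow> P\<rbrakk> \<Longrightarrow> P" for P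
  proof (rule sys.Theta_less_cases[OF he ze h(2)])
    assume p1: "h < ?w \<Longrightarrow> P" and p2: "?t \<noteq> 0 \<Longrightarrow> ?Th h \<le> ?t \<Longrightarrow> P" and hz: "h < z"
    show P
    proof (cases "h < ?w")
      case False
      then have t: "?t \<noteq> 0" using check_props(7)[OF z(1)] hz by auto
      obtain b where b: "b < Omega" "z = ?w + b" using check_props(6)[OF z(1) t] by blast
      have "?Th h \<le> ?t" using sys.Theta_below_ThetaStar[of ?w b s h] check_props(5)[OF z(1) t] b ze t False hz
        by (metis linorder_not_less)
      then show P using p2 t by blast
    qed (rule p1)
  next
    assume p2: "?t \<noteq> 0 \<Longrightarrow> ?Th h \<le> ?t \<Longrightarrow> P" and p3: "?t = 0 \<Longrightarrow> ?w = z \<Longrightarrow> z < h \<Longrightarrow> ?Th h \<le> ostar z \<Longrightarrow> P"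
      and hz: "z < h" "?Th h \<le> ostar z"
    show P
    proof (cases "?t = 0")
      case True then show P using p3 check_props(7)[OF z(1)] hz by blast
    next
      case False then show P using p2 sys.Theta_le_ThetaStar[OF ze False hz(2)] by blast
    qed
  qed
  show ?thesis
  proof (cases "tau ?w = Omega")
    case True
    obtain n' where n: "n = Suc n'" "k \<le> n'" using h(3) by (cases n) auto
    let ?I = "ThetaIter (Xof s) z"
    note I = ThetaIter_props[OF z(1) ol True, of n']
    have eq: "fsN s m (?Th z) = ?I m" for m by (rule fsN_limB[OF z(2,1,3) True])
    have In: "?I n = ?Th (fsO ?w (?I n'))" by (simp add: n)
    show ?thesis unfolding eq
    proof (rule cases)
      assume "h < ?w"
      \<comment> \<open>The norm of h is at most n', so its coefficients are below the previous
        member of the sequence, which is the one inserted into the argument.\<close>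
      moreover have "d < ?I n'" if "d \<in> Cset h" for d
        using star[OF n(2)] ostar_ge[OF he that] unfolding eq by simp
      ultimately have "h < fsO ?w (?I n')" using less_fsO[OF ol we] by blast
      moreover have "ostar h < ?Th (fsO ?w (?I n'))" using star[OF n1(2)] unfolding eq In .
      ultimately show "?Th h < ?I n" unfolding In using sys.Theta_mono[OF I(5)] by blast
    next
      assume "?Th h \<le> ?t"
      moreover have "?t < ?I n" using ThetaIter_mono[OF z(1) ol True n1(1)] by simp
      ultimately show "?Th h < ?I n" by simp
    next
      assume t: "?t = 0" and [simp]: "?w = z" and hz: "z < h" "?Th h \<le> ostar z"
      have "0 < fsN s n' (?Th z)"
        using IH1[OF denotes_0[OF denotes_pos[OF h(1)]] n(2) z(2) order_refl] z(2) olimit_pos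
        by (auto simp: good_def)
      then have "0 < ?I n'" unfolding eq .
      then have "?Th h \<le> ostar (fsO z (?I n'))"
        using sys.Theta_le_ostar_Omega[OF _ ze _ hz(1) he hz(2) _ I(2)] ol True by simp
      then show "?Th h < ?I n" unfolding In using sys.ostar_less_Theta[OF I(5), of s] by simp
    qed
  next
    case False
    then have t: "tau ?w < Omega" using tau_le_Omega[OF we] by simp
    define th where "th = fsN s n (tau ?w)"
    have gt: "good s (tau ?w)" "tau ?w \<le> ostar ?w" using good_tau[OF W(1) ol t] by blast+
    have th: "0 < th" "th < tau ?w" unfolding th_def using fsN_bounds[OF gt(1) n1(1)] by blast+
    define u where "u = fsO ?w th"
    note L = limA_props[OF z(1) ol t th, folded u_def]
    have uw: "fsN s n ?w = u" unfolding u_def th_def by (rule fsN_fsO[OF W(1) ol t])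
    have eq: "fsN s n (?Th z) = ?Th (u + ?t)"
      using fsN_limA[OF z(2,1,3) t ol, of n] uw by simp
    show ?thesis
    proof (rule cases)
      assume "h < ?w"
      have "h < u" unfolding uw[symmetric]
      proof (rule less_fsN_big[OF W(1) ol t h(1) \<open>h < ?w\<close> n1(2)])
        fix c x assume "denotes s k c" "good s x" "x \<le> ostar ?w" "c < x"
        then show "c < fsN s n x" using IH1[OF _ n1(2)] oz ozT by (meson order_le_less_trans order_less_imp_le)
      qed
      then have "h < u + ?t" by (meson ord_le_add1 order_less_le_trans)
      then show ?thesis unfolding eq using sys.Theta_mono[OF L(3)] star[OF n1(2)] eq by metis
    next
      assume t: "?t \<noteq> 0" and le: "?Th h \<le> ?t"
      have "?t \<in> Cset (u + ?t)" using L(6) t by simp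
      then have "?t \<le> ostar (u + ?t)" using ostar_ge[OF L(3)] by blast
      then show ?thesis unfolding eq using le sys.ostar_less_Theta[OF L(3), of s] by simp
    next
      assume t0: "?t = 0" and wz: "?w = z" and hz: "z < h" "?Th h \<le> ostar z"
      have ols: "olimit z" "tau z < Omega" using ol t wz by simp_all
      have "?Th h \<le> ostar u"
      proof -
        from sys.Theta_le_ostar_cases[OF ols(1) ze ols(2) t0 hz(1) he hz(2)]
        show ?thesis
        proof
          assume "?Th h < tau z"
          moreover have "tau z < ?Th z" using gt(2) ozT wz by simp
          ultimately have "?Th h < th" unfolding th_def using IH2[of "tau z"] gt(1) wz by simp
          moreover have "th \<le> ostar u" using L(7) ostar_ge[OF L(4)] by blast
          ultimately show ?thesis by simp
        next
          assume "\<forall>th. 0 < th \<longrightarrow> th < tau z \<longrightarrow> ?Th h \<le> ostar (fsO z th)"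
          then show ?thesis unfolding u_def wz using th wz by metis
        qed
      qed
      then show ?thesis unfolding eq t0 using sys.ostar_less_Theta[OF L(4), of s] by simp
    qed
  qed
qed

subsection \<open>The system with addition\<close>

text \<open>A collects all but the last power of the Cantor normal form; this offset is the same for
  every n.\<close>

lemma fsN_decomp:
  assumes x: "good VarthetaSys x"
  shows "\<exists>A p. x = A + p \<and> add_princ p \<and> good VarthetaSys p \<and> A < Omega \<and> (\<forall>n. fsN VarthetaSys n x = A + fsN VarthetaSys n p)"
  using x
proof (cases rule: good_Theta_cases)
  case (lim z)
  then have "add_princ x" using sys.Theta_in[of z VarthetaSys] by (simp add: epshat_def Pset_iff)
  then show ?thesis using x by (intro exI[of _ 0] exI[of _ x]) (simp add: zero_less_Omega)
next
  case (jump b)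
  then have "add_princ x" using sys.Theta_in[of b VarthetaSys] by (simp add: epshat_def Pset_iff)
  then show ?thesis using x by (intro exI[of _ 0] exI[of _ x]) (simp add: zero_less_Omega)
next
  case (sum as)
  have "cnf (butlast as) \<le> x" using sum(8) by (metis ord_le_add1)
  then have "cnf (butlast as) < Omega" using x by (auto simp: good_def)
  then show ?thesis using sum fsN_sum[OF x sum(1-6)] add_princ_iff
    by (intro exI[of _ "cnf (butlast as)"] exI[of _ "opow omega (last as)"]) blast
qed

text \<open>If p is a limit point of P, its n-th member is itself in P. Otherwise the members are t
  * n, and indices add up: x < t * k and y < t * l give x + y < t * (k + l). In this way the sizes
  of two summands share the index n.\<close>

lemma fsN_add_closed:
  assumes p: "add_princ p" "good VarthetaSys p" and n: "0 < n" "k + l \<le> n"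
   and x: "x < fsN VarthetaSys n p" "y < fsN VarthetaSys n p"
     "x < fsN VarthetaSys k p" "y < fsN VarthetaSys l p"
  shows "x + y < fsN VarthetaSys n p"
  using p(2)
proof (cases rule: good_Theta_cases)
  case (lim z)
  let ?s = VarthetaSys
  let ?w = "check (Xof ?s) z"
  have l: "Theta (Xof ?s) z \<in> lim_pts (Xof ?s)" "good ?s (Theta (Xof ?s) z)" using lim p by auto
  have ol: "olimit ?w" by (rule olimit_check[OF lim(1) l(1)])
  have we: "?w < epsOm" using check_props(1)[OF lim(1)] by (simp add: epshat_def)
  have "fsN ?s n p \<in> Xof ?s"
  proof (cases "tau ?w = Omega")
    case True
    obtain i where n: "n = Suc i" using n by (cases n) auto
    show ?thesis using fsN_limB[OF l(2) lim(1) l(1) True] sys.Theta_in[OF ThetaIter_props(5)[OF lim(1) ol True, of i], of ?s]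
       unfolding lim(2) n by simp
  next
    case False
    then have t: "tau ?w < Omega" using tau_le_Omega[OF we] by simp
    have tw: "good ?s (tau ?w)" using good_tau[OF check_props(1)[OF lim(1)] ol t] by blast
    have th: "0 < fsN ?s n (tau ?w)" "fsN ?s n (tau ?w) < tau ?w" using fsN_bounds[OF tw n(1)] by blast+
    show ?thesis
      using fsN_limA[OF l(2) lim(1) l(1) t ol, of n] fsN_fsO(1)[OF check_props(1)[OF lim(1)] ol t, of n]
        sys.Theta_in[OF limA_props(3)[OF lim(1) ol t th], of ?s] lim(2) by simp
  qed
  then show ?thesis using x(1,2) add_princ_less by (simp add: Pset_iff)
next
  case (jump b)
  have f: "fsN VarthetaSys m p = ThetaStar (Xof VarthetaSys) b * onat m" for m
    using fsN_jump[OF p(2)] jump by blast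
  let ?t = "ThetaStar (Xof VarthetaSys) b"
  have "x + y < x + ?t * onat l" using x(4) f by simp
  also have "\<dots> \<le> ?t * onat k + ?t * onat l" using x(3) f by (intro ord_add_right_mono) simp
  also have "\<dots> = ?t * onat (k + l)" by (simp add: ord_distrib_left onat_add)
  also have "\<dots> \<le> ?t * onat n"
  proof -
    have "onat (k + l) \<le> onat n" using n(2) onat_add[of "k + l" "n - (k + l)"] by simp
    then show ?thesis by (rule ord_mult_left_mono)
  qed
  finally show ?thesis using f by simp
next
  case (sum as)
  then show ?thesis using p(1) add_princ_cnf[of as] by simp
qed

text \<open>The value of Theta is additively principal: if it exceeds A it absorbs A, and comparing
  it with A + p amounts to comparing it with p.\<close>

lemma Theta_less_add:
  assumes p: "h < epsOm" "Theta (Xof VarthetaSys) h < A + p" "0 < q"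
    and q: "Theta (Xof VarthetaSys) h < p \<Longrightarrow> Theta (Xof VarthetaSys) h < q"
  shows "Theta (Xof VarthetaSys) h < A + q"
proof (cases "Theta (Xof VarthetaSys) h \<le> A")
  case True
  moreover have "A < A + q" using p(3) by simp
  ultimately show ?thesis by (rule order_le_less_trans)
next
  case False
  have ap: "add_princ (Theta (Xof VarthetaSys) h)" using sys.Theta_in[OF p(1), of VarthetaSys] by (simp add: Pset_iff)
  then have "A + Theta (Xof VarthetaSys) h = Theta (Xof VarthetaSys) h"
    using False by (intro add_princ_absorb) simp_all
  then have "Theta (Xof VarthetaSys) h < p" using p(2) by (metis ord_add_less_cancel_left)
  then show ?thesis using q ord_le_add2 order_less_le_trans by blast
qed

text \<open>Reduces a term for Omega^a b + c with countable value to c or to the sum b + c.\<close>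

lemma Om_times_add_countable: "Om a * b + c < Omega \<Longrightarrow> b = 0 \<or> a = 0"
proof (rule ccontr)
  assume l: "Om a * b + c < Omega" and "\<not> (b = 0 \<or> a = 0)"
  then have "Omega \<le> Om a" "Om a \<le> Om a * b" using Om_le_iff[of 1 a] by (auto simp: ord_one_le)
  then show False using l by (meson linorder_not_less ord_le_add1 order_trans)
qed

text \<open>The offset A makes the induction work for sums: if A = u + A', comparing u + v with A +
  p becomes comparing v with A' + p. If u exceeds A, the part beyond A and v both lie below p, and
  \<open>fsN_add_closed\<close> applies.\<close>

lemma vartheta_bound:
  "allowed VarthetaSys t \<Longrightarrow> tsize t \<le> n \<Longrightarrow> add_princ p \<Longrightarrow> good VarthetaSys p \<Longrightarrow> A < Omega \<Longrightarrow>
    teval (Xof VarthetaSys) t < A + p \<Longrightarrow> teval (Xof VarthetaSys) t < A + fsN VarthetaSys n p"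
proof (induction "tsize t" arbitrary: t n p A rule: less_induct)
  case less
  let ?s = VarthetaSys and ?e = "teval (Xof VarthetaSys)"
  have n0: "0 < n" using less.prems(2) tsize_pos[of t] by simp
  have pos: "0 < fsN ?s n p" using fsN_bounds[OF less.prems(4) n0] by blast
  have A: "A < A + fsN ?s n p" using pos by simp
  have ApO: "A + p < Omega" using less.prems(4,5) add_less_Omega by (simp add: good_def)
  have IH: "?e u < B + fsN ?s m q" if "tsize u < tsize t" "allowed ?s u" "tsize u \<le> m" "add_princ q"
     "good ?s q" "B < Omega" "?e u < B + q" for u m q B
    using less.hyps[OF that] .
  have sum: "?e u + ?e v < A + fsN ?s n p"
    if uv: "allowed ?s u" "allowed ?s v" "tsize u + tsize v < tsize t" "?e u + ?e v < A + p" for u v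
  proof -
    have sz: "tsize u < tsize t" "tsize v < tsize t" using uv(3) by auto
    have ua: "?e u < A + p" using uv(4) ord_le_add1 order_le_less_trans by blast
    show ?thesis
    proof (cases "?e u \<le> A")
      case True
      then obtain A' where A': "A = ?e u + A'" using ord_le_iff_add by blast
      then have "?e v < A' + p" using uv(4) by (simp add: add.assoc)
      moreover have "A' < Omega" using A' less.prems(5) ord_le_add2 order_le_less_trans by metis
      ultimately have "?e v < A' + fsN ?s n p" using IH[OF sz(2) uv(2) _ less.prems(3,4)] less.prems(2) sz by simp
      then show ?thesis using A' by (simp add: add.assoc)
    next
      case False
      then obtain x where x: "?e u = A + x" using ord_le_iff_add order_less_imp_le linorder_not_le by metis
      have xv: "x + ?e v < p" using uv(4) unfolding x by (simp add: add.assoc)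
      then have v: "?e v < 0 + p" by (simp add: order_le_less_trans[OF ord_le_add2])
      have u1: "x < fsN ?s m p" if "tsize u \<le> m" for m
        using IH[OF sz(1) uv(1) that less.prems(3,4,5) ua] unfolding x by simp
      have v1: "?e v < fsN ?s m p" if "tsize v \<le> m" for m
        using IH[OF sz(2) uv(2) that less.prems(3,4) zero_less_Omega v] by simp
      have "x + ?e v < fsN ?s n p"
        by (rule fsN_add_closed[OF less.prems(3,4) n0, of "tsize u" "tsize v"])
          (use u1 v1 less.prems(2) uv(3) in auto)
      then show ?thesis unfolding x by (simp add: add.assoc)
    qed
  qed
  show ?case
  proof (cases t)
    case TZero then show ?thesis using pos by simp
  next
    case (TPlus u v) then show ?thesis using sum[of u v] less.prems by simp
  next
    case (TOm a b c)
    have "Om (?e a) * ?e b + ?e c < Omega" using less.prems(6) ApO TOm by simp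
    then consider "?e b = 0" | "?e a = 0" using Om_times_add_countable by blast
    then show ?thesis
    proof cases
      case 1 then show ?thesis using IH[of c n p A] less.prems TOm by simp
    next
      case 2 then show ?thesis using sum[of b c] less.prems TOm by simp
    qed
  next
    case (TTheta u)
    define h where "h = ?e u"
    define k where "k = tsize u"
    have he: "h < epsOm" unfolding h_def by (rule teval_less_epsOm)
    have dh: "denotes ?s k h" unfolding denotes_def h_def k_def using less.prems TTheta by auto
    have kn: "Suc k \<le> n" using less.prems TTheta by (simp add: k_def)
    \<comment> \<open>Inner induction on q with Theta(h) fixed; it supplies \<open>IH2\<close> of
      \<open>fsN_bound_Theta\<close>.\<close>
    have main: "Theta (Xof ?s) h < fsN ?s n q" if "add_princ q" "good ?s q" "Theta (Xof ?s) h < q" for q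
      using that
    proof (induction q rule: less_induct)
      case (less q)
      note prems_q = less.prems and IH_q = less.IH
      from prems_q(2) show ?case
      proof (cases rule: good_Theta_cases)
        case (lim z)
        have IH1: "c < fsN ?s m x" if c: "denotes ?s k c" "k \<le> m" "good ?s x" "c < x" for c m x
        proof -
          obtain B r where x: "x = B + r" "add_princ r" "good ?s r" "B < Omega" "fsN ?s m x = B + fsN ?s m r"
            using fsN_decomp[OF c(3)] by blast
          obtain t' where "allowed ?s t'" "?e t' = c" "tsize t' \<le> k" using c(1) by (auto simp: denotes_def)
          then show ?thesis using IH[of t' m r B] x c TTheta by (simp add: k_def)
        qed
        have IH2: "Theta (Xof ?s) h < fsN ?s n x" if c: "good ?s x" "x < q" "Theta (Xof ?s) h < x" for x
        proof -
          obtain B r where x: "x = B + r" "add_princ r" "good ?s r" "B < Omega" "fsN ?s n x = B + fsN ?s n r"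
            using fsN_decomp[OF c(1)] by blast
          have rq: "r < q" using x(1) c(2) ord_le_add2 order_le_less_trans by blast
          have r0: "0 < fsN ?s n r" using fsN_bounds[OF x(3) n0] by blast
          have "Theta (Xof ?s) h < B + r" using c(3) x(1) by simp
          then show ?thesis unfolding x(5) by (rule Theta_less_add[OF he _ r0]) (rule IH_q[OF rq x(2,3)])
        qed
        show ?thesis unfolding lim(2)
          by (rule fsN_bound_Theta[OF lim(1) _ _ dh _ kn])
            (use IH1 IH2 lim prems_q in blast)+
      next
        case (jump b)
        have be: "b < epsOm" using jump less_Omega_epsOm by blast
        let ?t = "ThetaStar (Xof ?s) b"
        have "Theta (Xof ?s) h < Theta (Xof ?s) b" using prems_q jump by simp
        then have le: "Theta (Xof ?s) h \<le> ?t"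
        proof (rule sys.Theta_less_cases[OF he be])
          assume "h < b" then show ?thesis
            using sys.Theta_below_ThetaStar[of 0 b ?s h] jump be by simp
        next
          assume "Theta (Xof ?s) h \<le> ostar b" then show ?thesis
            using sys.Theta_le_ThetaStar[OF be jump(6)] by blast
        qed
        \<comment> \<open>A term Theta(u) has size at least 2, so n is at least 2 and Theta*(b) is
          strictly below its n-fold multiple.\<close>
        obtain j where j: "n = Suc (Suc j)" using kn denotes_pos[OF dh] by (metis Suc_le_D Suc_pred gr0_conv_Suc Suc_le_mono)
        have "?t * 1 < ?t * onat n" using jump(6) unfolding j
          by (intro ord_mult_strict_left_mono) (auto simp flip: osucc_0)
        then show ?thesis using le fsN_jump[OF prems_q(2) refl jump(2-5)] by simp
      next
        case (sum as) then show ?thesis using prems_q(1) add_princ_cnf[of as] by simp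
      qed
    qed
    have "Theta (Xof ?s) h < A + p" using less.prems(6) TTheta by (simp add: h_def)
    then have "Theta (Xof ?s) h < A + fsN ?s n p"
      by (rule Theta_less_add[OF he _ pos]) (rule main[OF less.prems(3,4)])
    then show ?thesis using TTheta h_def by simp
  qed
qed

lemma fsN_bound_vartheta:
  assumes "denotes VarthetaSys n c" "good VarthetaSys x" "c < x"
  shows "c < fsN VarthetaSys n x"
proof -
  obtain A p where x: "x = A + p" "add_princ p" "good VarthetaSys p" "A < Omega"
    "fsN VarthetaSys n x = A + fsN VarthetaSys n p"
    using fsN_decomp[OF assms(2)] by blast
  obtain t where "allowed VarthetaSys t" "teval (Xof VarthetaSys) t = c" "tsize t \<le> n"
    using assms(1) by (auto simp: denotes_def)
  then show ?thesis using vartheta_bound[of t n p A] x assms(3) by simp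
qed

subsection \<open>The values of sigma below the square of Omega\<close>

lemma ord_less_imp_add: "a < x \<Longrightarrow> \<exists>c. x = a + c \<and> c \<noteq> (0::ord)"
  by (metis add_0_right ord_le_iff_add order_less_imp_le order_less_irrefl)

interpretation sg: club Xsig
  using club_Xof[of SigmaSys] by simp

text \<open>With countable c and t these are the values of sigma at arguments below Omega^2, whose
  interplay with addition can be computed.\<close>

definition sig :: "ord \<Rightarrow> ord \<Rightarrow> ord" where
  "sig c t = Theta Xsig (Omega * c + t)"

lemma Om_mult_Omega: "Om_mult (Omega * c)"
  by (auto simp: Om_mult_def)

lemma Omega_times_eps: "c < Omega \<Longrightarrow> Omega * c < epsOm"
  using mult_Om_less_epsOm[of 1 c] less_Omega_epsOm[of c] less_Omega_epsOm[of 1] by simp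

lemma Omega_times_add_eps: "c < Omega \<Longrightarrow> t < Omega \<Longrightarrow> Omega * c + t < epsOm"
  by (intro add_less_epsOm Omega_times_eps less_Omega_epsOm)

lemma Cset_Omega_times: "c < Omega \<Longrightarrow> Cset (Omega * c) = (if c = 0 then {0} else {0, 1, c})"
  using Cset_Om_mult[of 1 c] Omega_times_eps[of c] by (auto simp: is_nf_def Cset_countable)

lemma Cset_Omega_times_add:
  "c < Omega \<Longrightarrow> t < Omega \<Longrightarrow> Cset (Omega * c + t) = insert t (if c = 0 then {0} else {0, 1, c})"
  using Cset_Om_mult_add[OF Omega_times_eps Om_mult_Omega, of c t] Cset_Omega_times by simp

lemma ostar_Omega_times_add: "c < Omega \<Longrightarrow> t < Omega \<Longrightarrow> ostar (Omega * c + t) < y \<longleftrightarrow> c < y \<and> t < y"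
proof -
  assume h: "c < Omega" "t < Omega"
  have "1 < y" if "c \<noteq> 0" "c < y" using that by (metis ord_one_le ord_pos_iff order_le_less_trans)
  then show ?thesis using h
    by (auto simp: ostar_less_iff[OF Omega_times_add_eps] Cset_Omega_times_add split: if_splits intro: order_le_less_trans[OF ord_zero_le])
qed

lemma Omega_times_mono: "c' < c \<Longrightarrow> t' < Omega \<Longrightarrow> Omega * c' + t' < Omega * c + t"
  by (rule ord_mult_add_less)

lemma less_Omega_times_add:
  assumes "h < Omega * c + t"
  obtains c' t' where "h = Omega * c' + t'" "c' < c" "t' < Omega" | t' where "h = Omega * c + t'" "t' < t"
  using assms less_plus_iff[of h "Omega * c" t] less_times_iff[of h Omega c] by blast

lemma sig_less_Omega: "c < Omega \<Longrightarrow> t < Omega \<Longrightarrow> sig c t < Omega"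
  unfolding sig_def by (intro sg.Theta_less_Omega Omega_times_add_eps)

lemma less_sig: assumes "c < Omega" "t < Omega" shows "c < sig c t" "t < sig c t"
  using sg.ostar_less_Theta[OF Omega_times_add_eps[OF assms]] ostar_Omega_times_add[OF assms]
  unfolding sig_def by blast+

lemma sig_mono: "c < Omega \<Longrightarrow> t < Omega \<Longrightarrow> t' < t \<Longrightarrow> sig c t' < sig c t"
  using less_sig[of c t] ostar_Omega_times_add[of c t' "sig c t"] unfolding sig_def
  by (intro sg.Theta_mono Omega_times_add_eps) auto

lemma sig_mono_le: "c < Omega \<Longrightarrow> t < Omega \<Longrightarrow> t' \<le> t \<Longrightarrow> sig c t' \<le> sig c t"
  using sig_mono by (metis order_le_less)

lemma sig_less_sig_iff: "c < Omega \<Longrightarrow> t < Omega \<Longrightarrow> t' < Omega \<Longrightarrow> sig c t' < sig c t \<longleftrightarrow> t' < t"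
  by (meson sig_mono sig_mono_le linorder_not_less)

lemma sig_mono1: "c < Omega \<Longrightarrow> t < Omega \<Longrightarrow> c' < c \<Longrightarrow> t' < sig c t \<Longrightarrow> sig c' t' < sig c t"
proof -
  assume h: "c < Omega" "t < Omega" "c' < c" "t' < sig c t"
  then have "t' < Omega" "c' < Omega" "c' < sig c t"
    using sig_less_Omega[OF h(1,2)] less_sig(1)[OF h(1,2)] by auto
  then show ?thesis using h ostar_Omega_times_add[of c' t' "sig c t"] unfolding sig_def
    by (intro sg.Theta_mono Omega_times_add_eps Omega_times_mono) auto
qed

text \<open>Specialises \<open>Theta_least\<close>: an argument below Omega c + t has either the
  same c and a smaller t', or a smaller c' and any countable t', for which the coefficient condition
  leaves t' < th.\<close>

lemma sig_least:
  assumes "c < Omega" "t < Omega" "th < Omega" "c < th" "t < th" "\<And>t'. t' < t \<Longrightarrow> sig c t' < th"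
    "\<And>c' t'. c' < c \<Longrightarrow> t' < th \<Longrightarrow> sig c' t' < th"
  shows "sig c t \<le> th"
  unfolding sig_def
proof (rule sg.Theta_least)
  show "th \<in> Xsig" using assms by (auto simp: Xsig_def)
  show "ostar (Omega * c + t) < th" using assms ostar_Omega_times_add by blast
  fix h assume h: "h < Omega * c + t" "ostar h < th"
  from h(1) show "Theta Xsig h < th"
  proof (cases rule: less_Omega_times_add)
    case (1 c' t')
    then have "t' < th" using h(2) ostar_Omega_times_add[of c' t' th] assms(1) by auto
    then show ?thesis using assms(7)[of c' t'] 1 unfolding sig_def by blast
  next
    case (2 t') then show ?thesis using assms(6) unfolding sig_def by blast
  qed
qed

lemma sig_0: "t < Omega \<Longrightarrow> sig 0 t = osucc t"
proof (rule order_antisym)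
  assume t: "t < Omega"
  show "osucc t \<le> sig 0 t" using less_sig(2)[of 0 t] t by (simp add: osucc_le_iff zero_less_Omega)
  show "sig 0 t \<le> osucc t"
    using t
  proof (induction t rule: less_induct)
    case (less t)
    have "sig 0 x < osucc t" if "x < t" for x
      using less.IH[OF that] that less.prems by (metis order_le_less_trans order_less_trans osucc_less_iff)
    then show ?case using less.prems by (intro sig_least) (auto simp: zero_less_Omega)
  qed
qed

text \<open>The guard c' < th is the coefficient condition of Theta. Without it no th < c would
  qualify, although values of sigma at arguments above Omega c can be that small.\<close>

definition sig_closed :: "ord \<Rightarrow> ord \<Rightarrow> bool" where
  "sig_closed c th \<longleftrightarrow> th \<noteq> 0 \<and> th < Omega \<and> (\<forall>c'<c. c' < th \<longrightarrow> (\<forall>t<th. sig c' t < th))"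

lemma sig_closed_D: "sig_closed c th \<Longrightarrow> c' < c \<Longrightarrow> c' < th \<Longrightarrow> t < th \<Longrightarrow> sig c' t < th"
  by (simp add: sig_closed_def)

lemma sig_closed_less_Omega: "sig_closed c th \<Longrightarrow> th < Omega" and sig_closed_neq_0: "sig_closed c th \<Longrightarrow> th \<noteq> 0"
  by (simp_all add: sig_closed_def)

lemma sig_closed_antimono: "sig_closed c th \<Longrightarrow> c' \<le> c \<Longrightarrow> sig_closed c' th"
  unfolding sig_closed_def by (meson order_less_le_trans)

lemma sig_closed_Theta: "h < epsOm \<Longrightarrow> Omega * c \<le> h \<Longrightarrow> sig_closed c (Theta Xsig h)"
  unfolding sig_closed_def
proof (intro conjI allI impI)
  assume h: "h < epsOm" "Omega * c \<le> h"
  show "Theta Xsig h \<noteq> 0" "Theta Xsig h < Omega" using sg.Theta_neq_0 sg.Theta_less_Omega h by blast+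
  fix c' t assume c: "c' < c" "c' < Theta Xsig h" "t < Theta Xsig h"
  have cO: "c' < Omega" "t < Omega" using c sg.Theta_less_Omega[OF h(1)] by auto
  have "Omega * c' + t < Omega * c + 0" by (rule Omega_times_mono[OF c(1) cO(2)])
  then show "sig c' t < Theta Xsig h" unfolding sig_def
    using h c cO ostar_Omega_times_add by (intro sg.Theta_mono) auto
qed

lemma sig_closed_sig: "c < Omega \<Longrightarrow> t < Omega \<Longrightarrow> sig_closed c (sig c t)"
  unfolding sig_def by (intro sig_closed_Theta Omega_times_add_eps) auto

text \<open>If sig c i were i + d with d < c, the induction hypothesis would give i + d \<le> sig d
  i, while sig d i < sig c i.\<close>

lemma add_le_sig: "c < Omega \<Longrightarrow> i < Omega \<Longrightarrow> i + c \<le> sig c i"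
proof (induction c rule: less_induct)
  case (less c)
  show ?case
  proof (rule leI, rule notI)
    assume "sig c i < i + c"
    then obtain d where d: "d < c" "sig c i = i + d"
      using less_sig(2)[OF less.prems] ord_less_add_imp order_less_imp_le by blast
    then have "i + d \<le> sig d i" using less.IH less.prems by auto
    then show False using sig_mono1[OF less.prems d(1) less_sig(2)[OF less.prems]] d by simp
  qed
qed

text \<open>A nonzero remainder r < c would be an admissible first argument: closure gives sig r b <
  b + r, against \<open>add_le_sig\<close>.\<close>

lemma sig_closed_add_ge: "sig_closed c (b + r) \<Longrightarrow> c \<le> b \<Longrightarrow> r \<noteq> 0 \<Longrightarrow> c \<le> r"
proof (rule leI, rule notI)
  assume sig_closed: "sig_closed c (b + r)" and c: "c \<le> b" "r < c" and r: "r \<noteq> 0"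
  have b: "b < b + r" using r by simp
  then have bO: "b < Omega" "r < Omega" using order_less_trans[OF b sig_closed_less_Omega[OF sig_closed]] c by auto
  have "r < b + r" using order_less_trans[OF order_less_le_trans[OF c(2,1)] b] .
  then have "sig r b < b + r" using sig_closed_D[OF sig_closed c(2) _ b] by blast
  then show False using add_le_sig[OF bO(2,1)] by simp
qed

text \<open>As x + b \<le> sig b x, closure under sig b puts every finite multiple of b below r.
  These multiples are the \<open>m k\<close>, and their supremum u is b * omega, which absorbs b; so
  r absorbs b too.\<close>

lemma sig_closed_absorb: "sig_closed (osucc b) r \<Longrightarrow> b < r \<Longrightarrow> b + r = r"
proof -
  assume sig_closed: "sig_closed (osucc b) r" and b: "b < r"
  have bO: "b < Omega" using b sig_closed_less_Omega[OF sig_closed] by simp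
  define m where "m = (\<lambda>k. ((\<lambda>x. x + b) ^^ k) 0)"
  have m: "m 0 = 0" "m (Suc k) = m k + b" for k by (simp_all add: m_def)
  have comm: "b + m k = m (Suc k)" for k
    by (induction k) (simp_all add: m add.assoc[symmetric])
  have lt: "m k < r" for k
  proof (induction k)
    case 0 then show ?case using sig_closed_neq_0[OF sig_closed] by (simp add: m)
  next
    case (Suc k)
    have "sig b (m k) < r" using sig_closed_D[OF sig_closed less_osucc b Suc] .
    moreover have "m k + b \<le> sig b (m k)" using add_le_sig bO Suc sig_closed_less_Omega[OF sig_closed] by (meson order_less_trans)
    ultimately show ?case by (simp add: m)
  qed
  obtain r' where r': "r = b + r'" using ord_less_imp_add[OF b] by blast
  have ge: "m k \<le> r'" for k using lt[of "Suc k"] r' comm[of k] by (metis ord_add_less_cancel_left order_less_imp_le)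
  define u where "u = osup (range m)"
  have bdd: "bdd_above (range m)" using ge by (intro bdd_aboveI[of _ r']) auto
  have "b + u = u"
  proof (rule order_antisym)
    show "b + u \<le> u"
    proof (rule leI, rule notI)
      assume "u < b + u"
      then consider "u < b" | c where "c < u" "u = b + c" using less_plus_iff by blast
      then show False
      proof cases
        case 1
        have "m 1 = b" using m by (metis One_nat_def add_0_left)
        then show False using osup_upper[OF bdd rangeI, of 1] 1 unfolding u_def by simp
      next
        case (2 c)
        then obtain k where "c < m k" unfolding u_def less_osup_iff[OF bdd] by blast
        then have "b + c < m (Suc k)" using comm[of k] by (metis ord_add_less_cancel_left)
        then show False using 2 osup_upper[OF bdd, of "m (Suc k)"] unfolding u_def by auto
      qed
    qed
  qed simp
  moreover have "u \<le> r'" unfolding u_def using ge by (intro osup_least) auto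
  ultimately have "b + r' = r'" by (metis add.assoc ord_le_iff_add)
  then show ?thesis using r' by simp
qed

lemma one_add_le: "1 + t \<le> osucc (t::ord)"
proof (cases "t < omega")
  case True
  then obtain n where n: "t = onat n" using less_omega_iff by blast
  have "1 + t = onat (1 + n)" unfolding n onat_add by (simp add: osucc_0)
  then show ?thesis using n by simp
next
  case False
  then have "1 + t = t" using add_princ_absorb_le[OF add_princ_omega one_less_omega] by simp
  then show ?thesis by simp
qed

lemma sig_closed_limit: "sig_closed c x \<Longrightarrow> c \<noteq> 0 \<Longrightarrow> t < x \<Longrightarrow> osucc t < x"
  using sig_closed_D[of c x 0 t] sig_0[of t] sig_closed_neq_0[of c x] sig_closed_less_Omega[of c x] by auto

text \<open>Write sig c (b + 1 + t) = b + r. The remainder r is closed by \<open>U\<close> and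
  bounds sig c t by leastness. \<open>U\<close> is the content of
  \<open>sig_closed_remainder\<close> at c, whose inductive proof uses the present bound for smaller
  c; hence it is a premise.\<close>

lemma sig_add_aux:
  assumes U: "\<And>b r. sig_closed c (b + r) \<Longrightarrow> r \<noteq> 0 \<Longrightarrow> sig_closed c r"
   and b: "c \<le> b" "b < Omega" "t < Omega"
  shows "b + sig c t \<le> sig c (b + (1 + t))"
  using b(3)
proof (induction t rule: less_induct)
  case (less t)
  have cO: "c < Omega" using b by simp
  have tO: "b + (1 + t) < Omega" using b less.prems add_less_Omega by simp
  let ?y = "sig c (b + (1 + t))"
  have y: "b + (1 + t) < ?y" using less_sig(2)[OF cO tO] .
  then have "b < ?y" by (meson ord_le_add1 order_le_less_trans)
  then obtain r where r: "?y = b + r" "r \<noteq> 0" using ord_less_imp_add by blast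
  have Fr: "sig_closed c r" using U[of b r] sig_closed_sig[OF cO tO] r by simp
  have tr: "1 + t < r" using y r by simp
  have "sig c b < ?y" using sig_mono[OF cO tO, of b] less.prems by simp
  moreover have "b < sig c b" using less_sig(2)[OF cO b(2)] .
  then obtain r0 where r0: "sig c b = b + r0" "r0 \<noteq> 0" using ord_less_imp_add by blast
  moreover have "c \<le> r0" using sig_closed_add_ge[of c b r0] sig_closed_sig[OF cO b(2)] r0 b by simp
  \<comment> \<open>This is what the added 1 is for: sig c b is strictly below the value and already
    leaves a remainder of at least c.\<close>
  ultimately have cr: "c < r" using r by simp
  have "sig c t \<le> r"
  proof (rule sig_least[OF cO less.prems sig_closed_less_Omega[OF Fr] cr])
    show "t < r" using tr by (meson ord_le_add2 order_le_less_trans)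
    fix t' assume t': "t' < t"
    have "b + sig c t' \<le> sig c (b + (1 + t'))" using less t' by auto
    also have "\<dots> < ?y" using t' by (intro sig_mono[OF cO tO]) simp
    finally show "sig c t' < r" using r by simp
  next
    fix c' t' assume "c' < c" "t' < r"
    then show "sig c' t' < r" using sig_closed_D[OF Fr] cr by (meson order_less_trans)
  qed
  then show ?case using r by simp
qed

text \<open>Let c' < c. If b < c', then r is closed under sig b by the induction hypothesis and
  absorbs b, so r = b + r. If c' \<le> b, then b + sig c' t \<le> sig c' (b + 1 + t) < b +
  r.\<close>

lemma sig_closed_remainder: "sig_closed c (b + r) \<Longrightarrow> r \<noteq> 0 \<Longrightarrow> sig_closed c r"
proof (induction c arbitrary: b r rule: less_induct)
  case (less c)
  have O: "b < Omega" "r < Omega" using sig_closed_less_Omega[OF less.prems(1)]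
    by (meson ord_le_add1 ord_le_add2 order_le_less_trans)+
  have "sig c' t < r" if c': "c' < c" "c' < r" "t < r" for c' t
  proof -
    have Fb: "sig_closed c' (b + r)" using sig_closed_antimono less.prems(1) c'(1) by (meson order_less_imp_le)
    show ?thesis
    proof (cases "b < c'")
      case True
      have "sig_closed c' r" using less.IH[OF c'(1) Fb less.prems(2)] .
      then have "sig_closed (osucc b) r" using sig_closed_antimono True by (simp add: osucc_le_iff)
      then have "b + r = r" using sig_closed_absorb True c' order_less_trans by blast
      then show ?thesis using sig_closed_D[OF less.prems(1) c'(1)] c' by simp
    next
      case False
      have lim: "osucc (b + t) < b + r" using sig_closed_limit[OF less.prems(1)] c' by fastforce
      have "b + (1 + t) \<le> b + osucc t" by (simp only: ord_add_le_cancel_left one_add_le)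
      then have bt: "b + (1 + t) < b + r" unfolding ord_add_osucc using lim by (rule order_le_less_trans)
      have "c' < b + r" using c'(2) by (meson ord_le_add2 order_less_le_trans)
      then have "sig c' (b + (1 + t)) < b + r" using sig_closed_D[OF less.prems(1) c'(1)] bt by blast
      moreover have "b + sig c' t \<le> sig c' (b + (1 + t))"
        using False c' O less.IH[OF c'(1)] by (intro sig_add_aux) auto
      ultimately have "b + sig c' t < b + r" by (rule order_le_less_trans[rotated])
      then show ?thesis by simp
    qed
  qed
  then show ?case using less.prems(2) O by (simp add: sig_closed_def)
qed

lemma sig_add: "c \<le> b \<Longrightarrow> b < Omega \<Longrightarrow> t < Omega \<Longrightarrow> b + sig c t \<le> sig c (b + (1 + t))"
  using sig_add_aux sig_closed_remainder by blast

text \<open>For c' < c one shows sig c' (b + s) \<le> b + sig c' s by induction on s: b is closed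
  under sig c', and the right-hand side is \<open>sig_closed c'\<close> by the outer induction, so
  leastness applies. For s < r the bound is below b + r.\<close>

lemma sig_closed_add_closed: "sig_closed c b \<Longrightarrow> c \<le> b \<Longrightarrow> sig_closed c r \<Longrightarrow> c \<le> r \<Longrightarrow> sig_closed c (b + r)"
proof (induction c arbitrary: b r rule: less_induct)
  case (less c)
  have O: "b < Omega" "r < Omega" using less.prems sig_closed_less_Omega by blast+
  have brO: "b + r < Omega" using O add_less_Omega by blast
  have "sig c' t < b + r" if c': "c' < c" "t < b + r" for c' t
  proof -
    have c'b: "c' < b" "c' < r" and c'O: "c' < Omega" using c' less.prems O by auto
    have bE: "sig c' x < b" if "x < b" for x using sig_closed_D[OF less.prems(1) c'(1) c'b(1) that] .
    have *: "sig c' (b + s) \<le> b + sig c' s" if "s < Omega" for s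
      using that
    proof (induction s rule: less_induct)
      case (less s)
      let ?y = "b + sig c' s"
      have sE: "s < sig c' s" "c' < sig c' s" "sig c' s < Omega" using less_sig sig_less_Omega c'O less.prems by blast+
      have Fy: "sig_closed c' ?y"
        using \<open>sig_closed c b\<close> c' sig_closed_sig[OF c'O less.prems] sE c'b
        by (intro \<open>\<And>y b r. y < c \<Longrightarrow> sig_closed y b \<Longrightarrow> y \<le> b \<Longrightarrow> sig_closed y r \<Longrightarrow> y \<le> r \<Longrightarrow> sig_closed y (b + r)\<close>)
          (auto intro: sig_closed_antimono)
      have c'y: "c' < ?y" using c'b by (meson ord_le_add1 order_less_le_trans)
      show ?case
      proof (rule sig_least[OF c'O _ _ c'y])
        show "b + s < Omega" "?y < Omega" using O less.prems sE add_less_Omega by blast+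
        show "b + s < ?y" using sE by simp
        fix x assume "x < b + s"
        then consider "x < b" | s' where "s' < s" "x = b + s'" using less_plus_iff by blast
        then show "sig c' x < ?y"
        proof cases
          case 1 then show ?thesis using bE by (meson ord_le_add1 order_less_le_trans)
        next
          case (2 s')
          then have "sig c' x \<le> b + sig c' s'" using less by auto
          also have "\<dots> < ?y" using sig_mono[OF c'O less.prems 2(1)] by simp
          finally show ?thesis .
        qed
      next
        fix c'' x assume "c'' < c'" "x < ?y"
        then show "sig c'' x < ?y" using sig_closed_D[OF Fy] c'y by (meson order_less_trans)
      qed
    qed
    from c'(2) consider "t < b" | s where "s < r" "t = b + s" using less_plus_iff by blast
    then show ?thesis
    proof cases
      case 1 then show ?thesis using bE by (meson ord_le_add1 order_less_le_trans)
    next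
      case (2 s)
      then have "sig c' t \<le> b + sig c' s" using * O by auto
      also have "\<dots> < b + r" using sig_closed_D[OF less.prems(3) c'(1) c'b(2) 2(1)] by simp
      finally show ?thesis .
    qed
  qed
  then show ?case using less.prems brO by (auto simp: sig_closed_def)
qed

lemma sig_closed_osup:
  assumes "S \<noteq> {}" "\<And>x. x \<in> S \<Longrightarrow> sig_closed c x" "bdd_above S" "osup S < Omega"
  shows "sig_closed c (osup S)"
  unfolding sig_closed_def
proof (intro conjI allI impI)
  obtain x where x: "x \<in> S" using assms(1) by blast
  then show "osup S \<noteq> 0" using osup_upper[OF assms(3) x] sig_closed_neq_0[OF assms(2)[OF x]] by auto
  fix c' t assume c: "c' < c" "c' < osup S" "t < osup S"
  obtain u where u: "u \<in> S" "c' < u" using c(2) unfolding less_osup_iff[OF assms(3)] by blast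
  obtain v where v: "v \<in> S" "t < v" using c(3) unfolding less_osup_iff[OF assms(3)] by blast
  obtain m where m: "m \<in> S" "c' < m" "t < m" using u v
    by (cases "u \<le> v") (meson order_less_le_trans linorder_not_less order_less_imp_le)+
  then have "sig c' t < m" using sig_closed_D[OF assms(2)] c by blast
  then show "sig c' t < osup S" using osup_upper[OF assms(3) m(1)] by simp
qed (rule assms(4))

text \<open>Reduces to a closed b. Let v be the least closed ordinal that is at least c; by
  minimality v absorbs everything below it, and so does r. If b < v this suffices. Otherwise b = b1
  + e with b1 the largest closed ordinal between c and b; then e < v, as b1 + v is closed, and b + r
  = b1 + r.\<close>

lemma sig_closed_add: "c \<le> b \<Longrightarrow> b < Omega \<Longrightarrow> sig_closed c r \<Longrightarrow> c \<le> r \<Longrightarrow> sig_closed c (b + r)"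
proof -
  assume b: "c \<le> b" "b < Omega" and r: "sig_closed c r" "c \<le> r"
  define v where "v = (LEAST v. sig_closed c v \<and> c \<le> v)"
  have v: "sig_closed c v" "c \<le> v" unfolding v_def using LeastI[of "\<lambda>v. sig_closed c v \<and> c \<le> v"] r by blast+
  have vr: "v \<le> r" unfolding v_def using r by (intro Least_le) blast
  have vmin: "x < v \<Longrightarrow> c \<le> x \<Longrightarrow> \<not> sig_closed c x" for x unfolding v_def using not_less_Least by blast
  have absorb: "e + v = v" if "e < v" for e
  proof (cases "e < c")
    case True
    then have "sig_closed (osucc e) v" using sig_closed_antimono[OF v(1)] by (simp add: osucc_le_iff)
    then show ?thesis using sig_closed_absorb that by blast
  next
    case False
    obtain u where u: "v = e + u" "u \<noteq> 0" using ord_less_imp_add[OF \<open>e < v\<close>] by blast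
    then have "sig_closed c u" "c \<le> u" using sig_closed_remainder sig_closed_add_ge[of c e u] v u False by auto
    then have "\<not> u < v" using vmin by blast
    moreover have "u \<le> v" using u by simp
    ultimately have "u = v" by simp
    then show ?thesis using u by simp
  qed
  obtain y where y: "r = v + y" using vr ord_le_iff_add by blast
  have absorb': "e + r = r" if "e < v" for e using absorb[OF that] y by (simp add: add.assoc[symmetric])
  let ?S = "{x. sig_closed c x \<and> x \<le> b \<and> c \<le> x}"
  show ?thesis
  proof (cases "?S = {}")
    case True
    then have "b < v" using v by (auto simp: not_le)
    then show ?thesis using absorb' r by simp
  next
    case False
    have bdd: "bdd_above ?S" by (rule bdd_aboveI[of _ b]) auto
    define b1 where "b1 = osup ?S"
    have b1b: "b1 \<le> b" unfolding b1_def by (intro osup_least) auto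
    have Fb1: "sig_closed c b1" unfolding b1_def using b1b b False bdd unfolding b1_def by (intro sig_closed_osup) auto
    obtain x where "x \<in> ?S" using False by blast
    then have cb1: "c \<le> b1" using osup_upper[OF bdd, of x] unfolding b1_def by auto
    obtain e where e: "b = b1 + e" using b1b ord_le_iff_add by blast
    have "e < v"
    proof (rule ccontr)
      assume "\<not> e < v"
      then have "b1 + v \<le> b" using e by simp
      moreover have "sig_closed c (b1 + v)" "c \<le> b1 + v" using sig_closed_add_closed[OF Fb1 cb1 v] order_trans[OF cb1 ord_le_add1] by blast+
      ultimately have "b1 + v \<le> b1" unfolding b1_def using osup_upper[OF bdd] by auto
      then show False using sig_closed_neq_0[OF v(1)] by (metis ord_less_add_iff linorder_not_less ord_pos_iff)
    qed
    then have "b + r = b1 + r" using e absorb' by (simp add: add.assoc)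
    then show ?thesis using sig_closed_add_closed[OF Fb1 cb1 r] by simp
  qed
qed

text \<open>The estimate opposite to \<open>sig_add\<close>: b + sig c t is closed, so leastness
  bounds a value of sig c by it, where d is the index at which sig c first reaches b.\<close>

lemma sig_least_add:
  assumes b: "c \<le> b" "b < Omega"
  defines "d \<equiv> (LEAST d. b \<le> sig c d)"
  shows "t < Omega \<Longrightarrow> sig c (d + t) \<le> b + sig c t" "b \<le> sig c d" "d \<le> b"
proof -
  have cO: "c < Omega" using b by simp
  have "b \<le> sig c b" using less_sig(2)[OF cO b(2)] by simp
  then show d1: "b \<le> sig c d" and d2: "d \<le> b" unfolding d_def by (auto intro: LeastI Least_le)
  have d3: "sig c x < b" if "x < d" for x using that unfolding d_def using not_less_Least by (meson linorder_not_less)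
  show "t < Omega \<Longrightarrow> sig c (d + t) \<le> b + sig c t"
  proof (induction t rule: less_induct)
    case (less t)
    let ?y = "b + sig c t"
    have tE: "t < sig c t" "c < sig c t" "sig c t < Omega" using less_sig sig_less_Omega cO less.prems by blast+
    have Fy: "sig_closed c ?y" using sig_closed_add[OF b sig_closed_sig[OF cO less.prems]] tE by simp
    have cy: "c < ?y" using tE(2) by (meson ord_le_add2 order_less_le_trans)
    show ?case
    proof (rule sig_least[OF cO _ sig_closed_less_Omega[OF Fy] cy])
      show "d + t < Omega" using d2 b less.prems add_less_Omega by simp
      have "d + t \<le> b + t" using d2 by (rule ord_add_right_mono)
      also have "\<dots> < ?y" using tE by simp
      finally show "d + t < ?y" .
      fix x assume "x < d + t"
      then consider "x < d" | t' where "t' < t" "x = d + t'" using less_plus_iff by blast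
      then show "sig c x < ?y"
      proof cases
        case 1 then show ?thesis using d3 by (meson ord_le_add1 order_less_le_trans)
      next
        case (2 t')
        then have "sig c x \<le> b + sig c t'" using less by auto
        also have "\<dots> < ?y" using sig_mono[OF cO less.prems 2(1)] by simp
        finally show ?thesis .
      qed
    next
      fix c' x assume "c' < c" "x < ?y"
      then show "sig c' x < ?y" using sig_closed_D[OF Fy] cy by (meson order_less_trans)
    qed
  qed
qed

text \<open>Sharpens \<open>sig_add\<close>: the offset b in the argument is replaced by any index d
  at which sig c has passed b. The new difficulty is t < r, which does not follow from d + 1 + t
  being below the value.\<close>

lemma sig_add_shift:
  assumes b: "c \<le> b" "b < sig c d" "d < Omega" "b < Omega" and t: "t < Omega"
  shows "b + sig c t \<le> sig c (d + (1 + t))"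
  using t
proof (induction t rule: less_induct)
  case (less t)
  have cO: "c < Omega" and bO: "b < Omega"
    using b by auto
  have tO: "d + (1 + t) < Omega" using b less.prems add_less_Omega by simp
  let ?y = "sig c (d + (1 + t))"
  have dy: "sig c d < ?y" by (rule sig_mono[OF cO tO]) simp
  then have "b < ?y" using b by simp
  then obtain r where r: "?y = b + r" "r \<noteq> 0" using ord_less_imp_add by blast
  have Fr: "sig_closed c r" using sig_closed_remainder[of c b r] sig_closed_sig[OF cO tO] r by simp
  obtain r0 where r0: "sig c d = b + r0" "r0 \<noteq> 0" using ord_less_imp_add[OF b(2)] by blast
  have "c \<le> r0" using sig_closed_add_ge[of c b r0] sig_closed_sig[OF cO b(3)] r0 b by simp
  then have cr: "c < r" using r r0 dy by simp
  have Er: "sig c t' < r" if t': "t' < t" for t'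
  proof -
    have "b + sig c t' \<le> sig c (d + (1 + t'))" using less t' by auto
    also have "\<dots> < ?y" using t' by (intro sig_mono[OF cO tO]) simp
    finally show "sig c t' < r" using r by simp
  qed
  have "t \<le> r"
  proof (rule leI, rule notI)
    assume "r < t"
    then have "sig c r < r" by (rule Er)
    then show False using less_sig(2)[OF cO, of r] sig_closed_less_Omega[OF Fr] by simp
  qed
  moreover have "t \<noteq> r"
  proof
    \<comment> \<open>Then r would be closed under sig c as well, hence so would b + r; but b + r is
      the value of sig c at an argument below it.\<close>
    assume tr: "t = r"
    have "sig_closed (osucc c) r"
      unfolding sig_closed_def
    proof (intro conjI allI impI)
      fix c' x assume "c' < osucc c" "c' < r" "x < r"
      then show "sig c' x < r" using sig_closed_D[OF Fr, of c' x] Er[of x] tr by (auto simp: less_osucc_iff order_le_less)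
    qed (use sig_closed_neq_0 sig_closed_less_Omega Fr in blast)+
    moreover have "osucc c \<le> r" using cr by (simp add: osucc_le_iff)
    ultimately have Fy: "sig_closed (osucc c) (b + r)"
    proof (cases "b = c")
      case True
      assume "sig_closed (osucc c) r"
      then show ?thesis using sig_closed_absorb cr True by simp
    next
      case False
      assume "sig_closed (osucc c) r" "osucc c \<le> r"
      then show ?thesis using sig_closed_add False b(1) bO by (simp add: osucc_le_iff)
    qed
    have "d + (1 + t) < b + r" using less_sig(2)[OF cO tO] r by simp
    moreover have "c < b + r" using cr by (meson ord_le_add2 order_less_le_trans)
    ultimately have "sig c (d + (1 + t)) < b + r" using sig_closed_D[OF Fy less_osucc] by blast
    then show False using r by simp
  qed
  ultimately have tr: "t < r" by simp
  have "sig c t \<le> r"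
  proof (rule sig_least[OF cO less.prems sig_closed_less_Omega[OF Fr] cr tr Er])
    fix c' t' assume "c' < c" "t' < r"
    then show "sig c' t' < r" using sig_closed_D[OF Fr] cr by (meson order_less_trans)
  qed
  then show ?case using r by simp
qed

subsection \<open>Monotonicity of the fundamental sequences for sigma\<close>

lemma fsO_mono: "olimit x \<Longrightarrow> x < epsOm \<Longrightarrow> a < b \<Longrightarrow> fsO x a < fsO x b"
proof (induction x rule: lim_nf_induct)
  case (rest c d r) then show ?case using tau_fsO_rest[of c d r] by simp
next
  case (lim c d) then show ?case using tau_fsO_lim[of c d] by simp
next
  case (Suc c) then show ?case using tau_fsO_Suc[of c] by simp
next
  case (mult c d)
  have "fsO (Om c * osucc d) th = Om c * d + fsO (Om c) th" for th using tau_fsO_mult mult by blast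
  then show ?case using mult by (simp del: ord_mult_osucc)
next
  case (exp c) then show ?case using tau_fsO_exp[of c] by simp
qed

text \<open>A countable z has the successor z + 1 as its value, so limits come from uncountable
  arguments.\<close>

lemma good_sigma_cases:
  assumes "good SigmaSys x"
  obtains z where "z \<in> epshat Xsig" "x = Theta Xsig z" "x \<in> lim_pts Xsig" "Omega \<le> z"
  using assms
proof (cases rule: good_Theta_cases)
  case (lim z)
  have "Omega \<le> z"
  proof (rule ccontr)
    assume "\<not> Omega \<le> z"
    then have "x = osucc z" using lim(2) sig_0[of z] by (simp add: sig_def)
    then show False using assms by (simp add: good_def)
  qed
  then show ?thesis using that lim by simp
qed simp_all

text \<open>Turns b \<le> x[q] into b + 1 \<le> x[q+1]; in the estimates for sums every such
  successor is charged one index.\<close>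

lemma fsN_mono_sigma: "good SigmaSys x \<Longrightarrow> 0 < q \<Longrightarrow> fsN SigmaSys q x < fsN SigmaSys (Suc q) x"
proof (induction x rule: less_induct)
  case (less x)
  let ?s = SigmaSys
  obtain z where z: "z \<in> epshat (Xof ?s)" "x = Theta (Xof ?s) z" "x \<in> lim_pts (Xof ?s)"
    using good_sigma_cases[OF less.prems(1)] by auto
  have l: "Theta (Xof ?s) z \<in> lim_pts (Xof ?s)" "good ?s (Theta (Xof ?s) z)" using z less.prems by auto
  let ?w = "check (Xof ?s) z" and ?t = "ThetaStar (Xof ?s) z"
  have ol: "olimit ?w" by (rule olimit_check[OF z(1) l(1)])
  have we: "?w < epsOm" using check_props(1)[OF z(1)] by (simp add: epshat_def)
  have ze: "z < epsOm" using z(1) by (simp add: epshat_def)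
  show ?case
  proof (cases "tau ?w = Omega")
    case True
    show ?thesis unfolding z(2) fsN_limB[OF l(2) z(1) l(1) True] by (rule ThetaIter_props(3)[OF z(1) ol True])
  next
    case False
    then have t: "tau ?w < Omega" using tau_le_Omega[OF we] by simp
    have gt: "good ?s (tau ?w)" "tau ?w \<le> ostar ?w" using good_tau[OF check_props(1)[OF z(1)] ol t] by blast+
    have "ostar ?w \<le> ostar z" using ostar_in[OF we] check_props(2)[OF z(1)] ostar_ge[OF ze] by blast
    then have tx: "tau ?w < x" using gt(2) sys.ostar_less_Theta[OF ze, of ?s] z(2)
      by (meson order_le_less_trans)
    let ?a = "fsN ?s q (tau ?w)" and ?b = "fsN ?s (Suc q) (tau ?w)"
    have ab: "?a < ?b" by (rule less.IH[OF tx gt(1) less.prems(2)])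
    have a: "0 < ?a" "?a < tau ?w" using fsN_bounds[OF gt(1) less.prems(2)] by blast+
    have b: "0 < ?b" "?b < tau ?w" using fsN_bounds[OF gt(1), of "Suc q"] by blast+
    note La = limA_props[OF z(1) ol t a] and Lb = limA_props[OF z(1) ol t b]
    define u v where "u = fsO ?w ?a" and "v = fsO ?w ?b"
    note La = La[folded u_def] and Lb = Lb[folded v_def]
    have uv: "u < v" unfolding u_def v_def by (rule fsO_mono[OF ol we ab])
    have "u + ?t < v + ?t"
    proof (cases "?t = 0")
      case False
      then have "u + ?t < v" using Om_mult_less[OF Lb(5)[OF False] uv La(9)] by blast
      then show ?thesis by (meson ord_le_add1 order_less_le_trans)
    qed (use uv in simp)
    moreover have "ostar (u + ?t) < Theta (Xof ?s) (v + ?t)"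
    proof -
      \<comment> \<open>The two arguments share the coefficients in D and differ only in the members
        of the sequence for tau.\<close>
      obtain D where D: "\<forall>th. 0 < th \<longrightarrow> th < tau ?w \<longrightarrow> Cset (fsO ?w th) = insert th D"
        using Cset_fsO[OF ol we] by blast
      then have C: "Cset u = insert ?a D" "Cset v = insert ?b D" unfolding u_def v_def using a b by blast+
      have T: "c < Theta (Xof ?s) (v + ?t)" if "c \<in> Cset (v + ?t)" for c
        using that ostar_ge[OF Lb(3)] sys.ostar_less_Theta[OF Lb(3)] by (meson order_le_less_trans)
      have "?a < Theta (Xof ?s) (v + ?t)" using T[of ?b] ab C(2) Lb(6) by (auto split: if_splits)
      then show ?thesis unfolding ostar_less_iff[OF La(3)] La(6) using T C Lb(6) by (auto split: if_splits)
    qed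
    ultimately have "Theta (Xof ?s) (u + ?t) < Theta (Xof ?s) (v + ?t)" by (rule sys.Theta_mono[OF Lb(3)])
    then show ?thesis
      unfolding z(2) fsN_limA[OF l(2) z(1) l(1) t ol] fsN_fsO(1)[OF check_props(1)[OF z(1)] ol t]
        u_def v_def .
  qed
qed

subsection \<open>Sums of values of sigma\<close>

text \<open>The system for sigma has no addition, but its terms for Omega^0 b + c denote the sums of
  countable b and c.\<close>

lemma Theta_less_fsN_sigma:
  assumes z: "z \<in> epshat Xsig" "good SigmaSys (Theta Xsig z)" "Theta Xsig z \<in> lim_pts Xsig"
    and h: "h < check Xsig z" "\<And>d. d \<in> Cset h \<Longrightarrow> d < fsN SigmaSys q (Theta Xsig z)" and q: "0 < q"
    and t: "tau (check Xsig z) < Omega \<Longrightarrow> h < fsO (check Xsig z) (fsN SigmaSys (Suc q) (tau (check Xsig z)))"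
  shows "Theta Xsig h < fsN SigmaSys (Suc q) (Theta Xsig z)"
proof -
  let ?s = SigmaSys
  let ?w = "check Xsig z" and ?t = "ThetaStar Xsig z"
  have z': "z \<in> epshat (Xof ?s)" "good ?s (Theta (Xof ?s) z)" "Theta (Xof ?s) z \<in> lim_pts (Xof ?s)" using z by simp_all
  have ol: "olimit ?w" using olimit_check[OF z'(1,3)] by simp
  have we: "?w < epsOm" using check_props(1)[OF z'(1)] by (simp add: epshat_def)
  have he: "h < epsOm" using h(1) we by simp
  have mono: "fsN ?s q (Theta Xsig z) < fsN ?s (Suc q) (Theta Xsig z)" using fsN_mono_sigma z(2) q by simp
  have oh: "ostar h < fsN ?s (Suc q) (Theta Xsig z)"
    unfolding ostar_less_iff[OF he] using h(2) mono order_less_trans by blast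
  show ?thesis
  proof (cases "tau ?w = Omega")
    case True
    have eq: "fsN ?s m (Theta Xsig z) = ThetaIter Xsig z m" for m using fsN_limB[OF z'(2,1,3)] True by simp
    have "h < fsO ?w (ThetaIter Xsig z q)" using less_fsO[OF ol we h(1)] h(2) unfolding eq by blast
    moreover have "fsO ?w (ThetaIter Xsig z q) < epsOm" using ThetaIter_props(5)[OF z'(1)] ol True by simp
    ultimately show ?thesis using oh sg.Theta_mono unfolding eq by simp
  next
    case False
    then have t': "tau ?w < Omega" using tau_le_Omega[OF we] by simp
    let ?u = "fsO ?w (fsN ?s (Suc q) (tau ?w))"
    have gt: "good ?s (tau ?w)" using good_tau[OF check_props(1)[OF z'(1)]] ol t' by simp
    have b: "0 < fsN ?s (Suc q) (tau ?w)" "fsN ?s (Suc q) (tau ?w) < tau ?w"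
      using fsN_bounds[OF gt, of "Suc q"] by blast+
    have eq: "fsN ?s (Suc q) (Theta Xsig z) = Theta Xsig (?u + ?t)"
      using fsN_limA[OF z'(2,1,3)] fsN_fsO(1)[OF check_props(1)[OF z'(1)]] ol t' by simp
    have e: "?u + ?t < epsOm" using limA_props(3)[OF z'(1)] ol t' b by simp
    have "h < ?u + ?t" using t[OF t'] by (meson ord_le_add1 order_less_le_trans)
    then show ?thesis using oh sg.Theta_mono[OF e] unfolding eq by blast
  qed
qed

text \<open>Either Theta* starts the iteration, which increases, or it is a coefficient of the
  argument of the n-th member.\<close>

lemma ThetaStar_less_fsN:
  assumes z: "z \<in> epshat (Xof s)" "good s (Theta (Xof s) z)" "Theta (Xof s) z \<in> lim_pts (Xof s)"
    "0 < n" "ThetaStar (Xof s) z \<noteq> 0"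
  shows "ThetaStar (Xof s) z < fsN s n (Theta (Xof s) z)"
proof -
  let ?w = "check (Xof s) z" and ?t = "ThetaStar (Xof s) z"
  have ol: "olimit ?w" by (rule olimit_check[OF z(1,3)])
  have we: "?w < epsOm" using check_props(1)[OF z(1)] by (simp add: sys.epshat_iff)
  show ?thesis
  proof (cases "tau ?w = Omega")
    case True
    show ?thesis using ThetaIter_mono[OF z(1) ol True z(4)] unfolding fsN_limB[OF z(2,1,3) True] by simp
  next
    case False
    then have t: "tau ?w < Omega" using tau_le_Omega[OF we] by simp
    have gt: "good s (tau ?w)" by (rule good_tau[OF check_props(1)[OF z(1)] ol t])
    have b: "0 < fsN s n (tau ?w)" "fsN s n (tau ?w) < tau ?w" using fsN_bounds[OF gt z(4)] by blast+
    note L = limA_props[OF z(1) ol t b]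
    have "?t \<in> Cset (fsO ?w (fsN s n (tau ?w)) + ?t)" using L(6) z(5) by simp
    then have "?t \<le> ostar (fsO ?w (fsN s n (tau ?w)) + ?t)" using ostar_ge[OF L(3)] by blast
    then show ?thesis using sys.ostar_less_Theta[OF L(3), of s]
      unfolding fsN_limA[OF z(2,1,3) t ol] fsN_fsO(1)[OF check_props(1)[OF z(1)] ol t] by simp
  qed
qed

lemma Cset_Omega_times_add_subset:
  "c < Omega \<Longrightarrow> t < Omega \<Longrightarrow> d \<in> Cset (Omega * c + t) \<Longrightarrow> d = t \<or> d = c \<or> d \<le> 1"
  by (auto simp: Cset_Omega_times_add split: if_splits)

text \<open>The bound for b + sigma(h) with h uncountable. \<open>M\<close> and \<open>S\<close> are
  the induction hypotheses for terms of size at most k, without and with an offset;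
  \<open>Mr\<close> bounds r alone, and \<open>Sr\<close> is the sum bound for the same r at smaller
  y. The offset b is known only through its index m.\<close>

lemma sigma_sum_bound:
  fixes x :: ord
  assumes x: "good SigmaSys x"
    and h: "denotes SigmaSys k h" "Omega \<le> h" and r: "r = Theta Xsig h"
    and b: "\<And>q. m \<le> q \<Longrightarrow> b \<le> fsN SigmaSys q x" "b + r < x" and m: "0 < m"
    and M: "\<And>c q y. denotes SigmaSys k c \<Longrightarrow> k \<le> q \<Longrightarrow> good SigmaSys y \<Longrightarrow> c < y \<Longrightarrow> c < fsN SigmaSys q y"
    and Mr: "\<And>q y. Suc k \<le> q \<Longrightarrow> good SigmaSys y \<Longrightarrow> r < y \<Longrightarrow> r < fsN SigmaSys q y"
    and S: "\<And>j c y b m q. denotes SigmaSys j c \<Longrightarrow> j \<le> k \<Longrightarrow> good SigmaSys y \<Longrightarrow> 0 < m \<Longrightarrow>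
       (\<And>q. m \<le> q \<Longrightarrow> b \<le> fsN SigmaSys q y) \<Longrightarrow> b + c < y \<Longrightarrow> m + j \<le> q \<Longrightarrow> b + c < fsN SigmaSys q y"
    and Sr: "\<And>y b m q. y < x \<Longrightarrow> good SigmaSys y \<Longrightarrow> 0 < m \<Longrightarrow>
       (\<And>q. m \<le> q \<Longrightarrow> b \<le> fsN SigmaSys q y) \<Longrightarrow> b + r < y \<Longrightarrow> m + Suc k \<le> q \<Longrightarrow> b + r < fsN SigmaSys q y"
    and p: "m + Suc k \<le> p"
  shows "b + r < fsN SigmaSys p x"
proof -
  let ?fs = "\<lambda>q. fsN SigmaSys q x"
  obtain z where z: "z \<in> epshat Xsig" "x = Theta Xsig z" "x \<in> lim_pts Xsig" "Omega \<le> z"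
    using good_sigma_cases[OF x] .
  have z': "z \<in> epshat (Xof SigmaSys)" "good SigmaSys (Theta (Xof SigmaSys) z)"
    "Theta (Xof SigmaSys) z \<in> lim_pts (Xof SigmaSys)" using z x by simp_all
  have zz: "good SigmaSys (Theta Xsig z)" "Theta Xsig z \<in> lim_pts Xsig" using z x by simp_all
  let ?w = "check Xsig z" and ?t = "ThetaStar Xsig z"
  have ol: "olimit ?w" using olimit_check[OF z'(1,3)] by simp
  have ze: "z < epsOm" and we: "?w < epsOm" using z check_props(1)[OF z'(1)] by (simp_all add: epshat_def)
  have he: "h < epsOm" using h denotes_less_epsOm by blast
  \<comment> \<open>Coefficients are compared with x[p'], so that an argument formed from them has
    its value below x[p].\<close>
  obtain p' where p': "p = Suc p'" "m + k \<le> p'" using p by (cases p) auto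
  have k: "0 < k" using denotes_pos h by blast
  have p0: "0 < p'" using p' k by simp
  have xO: "x < Omega" using x by (simp add: good_def)
  have rO: "r < Omega" unfolding r by (rule sg.Theta_less_Omega[OF he])
  have bx: "b < x" using b(2) by (meson ord_le_add1 order_le_less_trans)
  have rx: "r < x" using b(2) by (meson ord_le_add2 order_le_less_trans)
  have bO: "b < Omega" using bx xO by simp
  have mono: "?fs q < ?fs (Suc q)" if "0 < q" for q by (rule fsN_mono_sigma[OF x that])
  have bs: "b < ?fs (Suc q)" if "m \<le> q" for q using b(1)[OF that] mono[of q] m that by simp
  have bp': "b < ?fs p'" using bs[of "p' - 1"] p' k by simp
  have rp: "r < ?fs q" if "Suc k \<le> q" for q by (rule Mr[OF that x rx])
  have rp': "r < ?fs p'" using rp p'(2) m by simp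
  have one: "1 < ?fs p'"
  proof -
    have "Omega \<le> h" by fact
    then have "olimit r" unfolding r using he by (rule sg.Theta_big_limit)
    then have "1 < r" using olimit_succ_less[of r 0] olimit_pos by (simp add: osucc_0)
    then show ?thesis using rp' by simp
  qed
  have coef: "d < ?fs p'" if "c < Omega" "t < Omega" "c < ?fs p'" "t < ?fs p'" "d \<in> Cset (Omega * c + t)" for c t d
    using Cset_Omega_times_add_subset[OF that(1,2,5)] that(3,4) one by auto
  \<comment> \<open>Crude bounds of b + r by one value of sig, this one for z above Omega^2 and the
    next one for r < c.\<close>
  have bigsum: "b + r \<le> sig (max b r) (max b r)"
  proof -
    have "b + r \<le> max b r + max b r" by (intro ord_add_mono) simp_all
    also have "\<dots> \<le> sig (max b r) (max b r)" using bO rO by (intro add_le_sig) auto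
    finally show ?thesis .
  qed
  have rsum: "b + r \<le> sig r (max b r)"
  proof -
    have "b + r \<le> max b r + r" by (intro ord_add_right_mono) simp
    also have "\<dots> \<le> sig r (max b r)" using bO rO by (intro add_le_sig) auto
    finally show ?thesis .
  qed
  have mx: "max b r < Omega" "max b r < ?fs p'" using bO rO bp' rp' by auto
  have absorbed: ?thesis if "b + r = r" unfolding that by (rule rp) (use p in simp)
  have Theta_p: "Theta Xsig y < ?fs p"
    if "y < ?w" "\<And>d. d \<in> Cset y \<Longrightarrow> d < ?fs p'"
     "tau ?w < Omega \<Longrightarrow> y < fsO ?w (fsN SigmaSys p (tau ?w))" for y
    using Theta_less_fsN_sigma[OF z(1) zz that(1) _ p0] that(2,3) unfolding p'(1) z(2) by blast
  show ?thesis
  proof (cases "Omega * Omega \<le> z")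
    case True
    have Ow: "Omega * Omega \<le> ?w"
    proof (cases "?t = 0")
      case True then show ?thesis using check_props(7)[OF z'(1)] \<open>Omega * Omega \<le> z\<close> by simp
    next
      case False
      then obtain e where "e < Omega" "z = ?w + e" using check_props(6)[OF z'(1)] by auto
      then show ?thesis using Om_mult_less[OF Om_mult_Omega, of ?w Omega e] True by (metis linorder_not_less)
    qed
    let ?y = "Omega * max b r + max b r"
    have y: "?y < Omega * Omega" using Omega_times_mono[OF mx(1) mx(1), of 0] by simp
    have "Theta Xsig ?y < ?fs p"
    proof (rule Theta_p)
      show "?y < ?w" using y Ow by simp
      show "d < ?fs p'" if "d \<in> Cset ?y" for d using coef[OF mx(1,1,2,2) that] .
      assume t: "tau ?w < Omega"
      have Om2: "Omega * Omega = Om (osucc 1)" by (simp add: opow_osucc)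
      have 2: "osucc 1 < Omega" by simp
      have C2: "Cset (Omega * Omega) = {0, 1, osucc 1}"
        unfolding Om2 using Cset_Om[OF Om_less_epsOm[OF less_Omega_epsOm[OF 2]]] Cset_countable[OF 2] by auto
      have "tau (Omega * Omega) = Omega"
        unfolding Om2 using tau_fsO_Suc[OF Om_less_epsOm[OF less_Omega_epsOm[OF 2]]] by blast
      then have "Omega * Omega < ?w" using Ow t by (metis order_le_less order_less_irrefl)
      \<comment> \<open>The inequality with w is strict because tau(Omega^2) is
        \<open>Omega\<close>. The coefficients 0, 1, 2 of Omega^2 have norm at most 3, and a term
        with uncountable value has at least that size.\<close>
      then have "Omega * Omega < fsO ?w (fsN SigmaSys p (tau ?w))"
      proof (rule less_fsO[OF ol we])
        fix d assume d: "d \<in> Cset (Omega * Omega)" "d < tau ?w"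
        have "d < r"
        proof -
          have "olimit r" unfolding r using h(2) he by (rule sg.Theta_big_limit)
          then have "onat 2 < r" by (rule onat_less_olimit)
          moreover have "onat 2 = osucc 1" by (simp add: numeral_2_eq_2 osucc_0)
          moreover have "d \<le> osucc 1" using d C2 by (auto simp: ord_one_le)
          ultimately show ?thesis by simp
        qed
        have gt: "good SigmaSys (tau ?w)" using good_tau[OF check_props(1)[OF z'(1)]] ol t by simp
        have "3 \<le> k"
        proof -
          obtain u where u: "allowed SigmaSys u" "teval (Xof SigmaSys) u = h" "tsize u \<le> k" using h by (auto simp: denotes_def)
          have "3 \<le> tsize u"
          proof (cases u)
            case TZero then show ?thesis using u h by simp
          next
            case (TTheta v)
            then have "h < Omega" using u sg.Theta_less_Omega teval_less_epsOm[of SigmaSys v] by auto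
            then show ?thesis using h by simp
          next
            case (TOm v1 v2 v3) then show ?thesis using tsize_pos[of v1] tsize_pos[of v2] by simp
          next
            case (TPlus v1 v2) then show ?thesis using u by simp
          qed
          then show ?thesis using u by simp
        qed
        moreover have "denotes SigmaSys 3 d"
        proof -
          have E0: "Theta Xsig 0 = 1" "Theta Xsig 1 = osucc 1" using sig_0[of 0] sig_0[of 1] by (simp_all add: sig_def osucc_0 zero_less_Omega)
          from d C2 consider "d = 0" | "d = 1" | "d = osucc 1" by blast
          then show ?thesis
          proof cases
            case 1 then show ?thesis using denotes_0 by simp
          next
            case 2 then show ?thesis unfolding denotes_def by (intro exI[of _ "TTheta TZero"]) (simp add: E0)
          next
            case 3 then show ?thesis unfolding denotes_def by (intro exI[of _ "TTheta (TTheta TZero)"]) (simp add: E0)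
          qed
        qed
        ultimately have "denotes SigmaSys k d" using denotes_mono by blast
        then show "d < fsN SigmaSys p (tau ?w)" using M[OF _ _ gt d(2)] p by simp
      qed
      then show "?y < fsO ?w (fsN SigmaSys p (tau ?w))" using y by simp
    qed
    then show ?thesis using bigsum unfolding sig_def by simp
  next
    case False
    then have "z < Omega * Omega" by simp
    then obtain c be where c: "c < Omega" "be < Omega" "z = Omega * c + be" using less_times_iff by blast
    have c0: "c \<noteq> 0" using c z(4) by auto
    have wz: "?w = Omega * c \<or> (?w = z \<and> ?t = 0)"
    proof (cases "?t = 0")
      case True then show ?thesis using check_props(7)[OF z'(1)] by simp
    next
      case False
      then have "?w = omul z" by (simp add: check_def)
      then show ?thesis using omul_eq[OF Om_mult_Omega c(2)] c(3) by simp
    qed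
    have wc: "Omega * c \<le> ?w" using wz c(3) by auto
    have oz: "ostar z < x" unfolding z(2) by (rule sg.ostar_less_Theta[OF ze])
    have cx: "c < x" "be < x" using oz ostar_Omega_times_add[OF c(1,2)] c(3) by auto
    have ozE: "ostar z < ThetaEps Xsig" using z(1) by (simp add: epshat_def)
    have cE: "c < ThetaEps Xsig" "be < ThetaEps Xsig" using ozE ostar_Omega_times_add[OF c(1,2)] c(3) by auto
    have xE: "x = sig c be" using z(2) c(3) by (simp add: sig_def)
    \<comment> \<open>Discharges the last premise of \<open>Theta_p\<close>. If w = Omega c has a
      countable tau, then c is a limit and w[p] = Omega c[p]; otherwise w = z, and z[p] keeps the
      part Omega c.\<close>
    have small: "y < fsO ?w (fsN SigmaSys p (tau ?w))"
      if y: "y = Omega * c' + t'" "c' < c" "t' < Omega" "tau ?w < Omega"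
        "\<And>v. good SigmaSys v \<Longrightarrow> c' < v \<Longrightarrow> c' < fsN SigmaSys p v" for y c' t'
    proof (cases "?w = Omega * c")
      case True
      have ct: "olimit c"
      proof (cases c rule: ord_cases)
        case (2 e)
        have "tau (Omega * c) = Omega"
        proof (cases "e = 0")
          case True
          then have "Omega * c = Om (osucc 0)" using 2 by (simp add: osucc_0)
          then show ?thesis using tau_fsO_Suc[of 0] Omega_times_eps[OF c(1)] by metis
        next
          case False
          have n: "is_nf 1 (osucc e) 0" "is_nf 1 e 0" using False 2 c(1) by (auto simp: is_nf_def)
          have "Om 1 * osucc e < epsOm" using Omega_times_eps[OF c(1)] 2 by simp
          then have "tau (Om 1 * osucc e) = tau (Om 1)" using tau_fsO_mult[OF n] by auto
          moreover have "tau (Om 1) = Omega" using tau_fsO_Suc[of 0] epsOm_props(1) by (simp add: osucc_0)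
          ultimately show ?thesis using 2 by simp
        qed
        then show ?thesis using y(4) True by simp
      qed (use c0 in auto)
      have "is_nf 1 c 0" using c0 c(1) by (auto simp: is_nf_def)
      then have tf: "tau ?w = c \<and> fsO ?w th = Omega * th" for th
        using tau_fsO_lim[of 1 c th] ct Omega_times_eps[OF c(1)] True by simp
      have "good SigmaSys c" using ct c cE by (simp add: good_def)
      then have "c' < fsN SigmaSys p c" using y(2,5) by blast
      then have "y < Omega * fsN SigmaSys p c + 0" unfolding y(1) using y(3) by (intro Omega_times_mono)
      then show ?thesis using tf by simp
    next
      case False
      then have w: "?w = z" using wz by blast
      have "be \<noteq> 0" using w False c(3) by auto
      then have be: "olimit be" using ol w c(3) olimit_add_iff by (metis ord_pos_iff)
      have "fsO ?w th = Omega * c + th" for th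
        using fsO_Om_mult_add[OF Omega_times_eps[OF c(1)] Om_mult_Omega c(2) be] w c(3) by simp
      moreover have "y < Omega * c + th" for th unfolding y(1) using y by (intro Omega_times_mono)
      ultimately show ?thesis by simp
    qed
    \<comment> \<open>Settles the cases in which b + r is bounded by some sig c' t' with c' < c and
      both arguments below x[p'].\<close>
    have via: ?thesis if "c' < c" "t' < ?fs p'" "c' < ?fs p'" "t' < Omega"
       "\<And>v. good SigmaSys v \<Longrightarrow> c' < v \<Longrightarrow> c' < fsN SigmaSys p v" "b + r \<le> sig c' t'" for c' t'
    proof -
      have c'O: "c' < Omega" using that c by simp
      have lt: "Omega * c' + t' < ?w" using Omega_times_mono[OF that(1,4), of 0] wc by simp
      have "Theta Xsig (Omega * c' + t') < ?fs p"
        by (rule Theta_p[OF lt]) (use coef[OF c'O that(4,3,2)] small[OF refl that(1,4) _ that(5)] in blast)+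
      then show ?thesis using that(6) unfolding sig_def by simp
    qed
    \<comment> \<open>The saved unit: h is uncountable, so its coefficients have norm at most k -
      1.\<close>
    have hk: "denotes SigmaSys (k - 1) d" if "d \<in> Cset h" for d
      using denotes_Cset_big[OF h that] by blast
    show ?thesis
    proof (cases "h < Omega * c")
      case True
      then obtain c' b' where h': "h = Omega * c' + b'" "c' < c" "b' < Omega" using less_times_iff by blast
      have c'O: "c' < Omega" using h' c by simp
      have c'0: "c' \<noteq> 0" using h h' by auto
      have Ch: "c' \<in> Cset h" "b' \<in> Cset h" using Cset_Omega_times_add[OF c'O h'(3)] h' c'0 by auto
      have rE: "r = sig c' b'" by (simp add: r h' sig_def)
      have Fr: "sig_closed c' r" unfolding rE by (rule sig_closed_sig[OF c'O h'(3)])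
      show ?thesis
      proof (cases "b < c'")
        case True
        then have "sig_closed (osucc b) r" using sig_closed_antimono[OF Fr] by (simp add: osucc_le_iff)
        then have "b + r = r" using sig_closed_absorb less_sig(1)[OF c'O h'(3)] True rE by auto
        then show ?thesis by (rule absorbed)
      next
        case False
        then have cb: "c' \<le> b" by simp
        have le: "b + r \<le> sig c' (b + (1 + b'))" unfolding rE by (rule sig_add[OF cb bO h'(3)])
        have "1 + b' \<le> osucc b'" by (rule one_add_le)
        also have "\<dots> \<le> r" using less_sig(2)[OF c'O h'(3)] rE by (simp add: osucc_le_iff)
        finally have "b + (1 + b') \<le> b + r" by simp
        then have "b + (1 + b') < x" using b(2) by (rule order_le_less_trans)
        then have lt: "osucc b + b' < x" by (simp add: add.assoc flip: ord_add_1)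
        have bq: "osucc b \<le> ?fs q" if "Suc m \<le> q" for q
          using bs[of "q - 1"] that by (simp add: osucc_le_iff)
        \<comment> \<open>The successor moves the index of the offset to m + 1 and b' has norm at
          most k - 1, so m + 1 + (k - 1) \<le> p' is enough.\<close>
        have "osucc b + b' < ?fs p'"
          by (rule S[OF hk[OF Ch(2)] _ x _ bq lt]) (use p' k in auto)
        then have y: "b + (1 + b') < ?fs p'" by (simp add: add.assoc flip: ord_add_1)
        have yO: "b + (1 + b') < Omega" using bO h'(3) add_less_Omega by simp
        have "denotes SigmaSys k c'" using denotes_mono[OF hk[OF Ch(1)]] by simp
        then have "c' < fsN SigmaSys p v" if "good SigmaSys v" "c' < v" for v using M[OF _ _ that] p by simp
        then show ?thesis using via[OF h'(2) y _ yO _ le] cb bp' by simp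
      qed
    next
      case False
      then have hc: "Omega * c \<le> h" by simp
      have Fr: "sig_closed c r" unfolding r by (rule sig_closed_Theta[OF he hc])
      show ?thesis
      proof (cases "r < c")
        case True
        have "Suc k \<le> p" using p by simp
        then show ?thesis by (intro via[OF True mx(2) rp' mx(1) Mr rsum])
      next
        case False
        then have cr: "c \<le> r" by simp
        show ?thesis
        proof (cases "b < c")
          case True
          then have "sig_closed (osucc b) r" using sig_closed_antimono[OF Fr] by (simp add: osucc_le_iff)
          then have "b + r = r" using sig_closed_absorb True cr by auto
          then show ?thesis by (rule absorbed)
        next
          case False
          then have cb: "c \<le> b" by simp
          \<comment> \<open>Since c is at most b and at most r, the sum is closed and can be placed
            among the values of sig c.\<close>
          have Fbr: "sig_closed c (b + r)" by (rule sig_closed_add[OF cb bO Fr cr])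
          have r0: "r \<noteq> 0" using sig_closed_neq_0[OF Fr] .
          have bbr: "b < b + r" using r0 by simp
          have cbr: "c < b + r" by (rule order_le_less_trans[OF cb bbr])
          have brO: "b + r < Omega" using bO rO add_less_Omega by blast
          show ?thesis
          proof (cases "?t = 0")
            case False
            \<comment> \<open>A closed b + r above Theta*(z) would exceed all earlier values of sig
              c, and leastness would give x \<le> b + r.\<close>
            have "b + r \<le> ?t"
            proof (rule leI, rule notI)
              assume lt: "?t < b + r"
              have bet: "be \<le> ?t"
              proof (rule sg.Theta_le_ThetaStar[OF ze False])
                have "be \<in> Cset z" using Cset_Omega_times_add[OF c(1,2)] c(3) by simp
                then show "be \<le> ostar z" using ostar_ge[OF ze] by blast
              qed
              have "sig c be \<le> b + r"
              proof (rule sig_least[OF c(1,2) brO cbr])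
                show "be < b + r" using bet lt by simp
                fix t' assume t': "t' < be"
                have "Theta Xsig (Omega * c + t') \<le> ThetaStar Xsig (Omega * c + be)"
                  using ze False t' c by (intro sg.Theta_below_ThetaStar Om_mult_Omega) auto
                then show "sig c t' < b + r" using lt c(3) by (simp add: sig_def)
              next
                fix c' t' assume "c' < c" "t' < b + r"
                then show "sig c' t' < b + r" using sig_closed_D[OF Fbr] cbr by (meson order_less_trans)
              qed
              then show False using b(2) xE by simp
            qed
            moreover have "?t < ?fs p" using ThetaStar_less_fsN[OF z', of p] False p'(1) z(2) by simp
            ultimately show ?thesis by simp
          next
            case t0: True
            have wz': "?w = z" using check_props(7)[OF z'(1)] t0 by simp
            show ?thesis
            proof (cases "be = 0")
              case True
              \<comment> \<open>x = sig c 0 is the least ordinal above c that is closed, so no such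
                b + r lies below it.\<close>
              have "sig c be \<le> b + r"
              proof (rule sig_least[OF c(1,2) brO cbr])
                fix c' t' assume "c' < c" "t' < b + r"
                then show "sig c' t' < b + r" using sig_closed_D[OF Fbr] cbr by (meson order_less_trans)
              qed (use True brO r0 in auto)
              then show ?thesis using b(2) xE by simp
            next
              case False
              have bel: "olimit be" using ol wz' c(3) olimit_add_iff False by (metis ord_pos_iff)
              have tz: "tau z = be" "\<And>th. fsO z th = Omega * c + th"
                using tau_Om_mult_add fsO_Om_mult_add Omega_times_eps[OF c(1)] Om_mult_Omega c(2,3) bel by auto
              have gbe: "good SigmaSys be" using bel c cE by (simp add: good_def)
              have fs: "?fs q = sig c (fsN SigmaSys q be)" for q
              proof -
                have "?fs q = Theta Xsig (fsN SigmaSys q z)"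
                  using fsN_limA[OF z'(2,1,3)] ol wz' t0 tz(1) c(2) z(2) by simp
                also have "fsN SigmaSys q z = fsO z (fsN SigmaSys q be)"
                  using fsN_fsO(1)[OF z'(1)] ol wz' tz(1) c(2) by simp
                finally show ?thesis using tz(2) by (simp add: sig_def)
              qed
              have fO: "fsN SigmaSys q be < Omega" if "0 < q" for q
                using fsN_bounds[OF gbe that] c(2) by (meson order_less_trans)
              have Emono: "sig c t1 < sig c (fsN SigmaSys q be)" if "t1 < fsN SigmaSys q be" "0 < q" for t1 q
                by (rule sig_mono[OF c(1) fO[OF that(2)] that(1)])
              \<comment> \<open>d marks the place of b among the values of sig c. Comparing b + sig
                c t with x = sig c be becomes comparing d + t with be, up to two successors.\<close>
              define d where "d = (LEAST d. b \<le> sig c d)"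
              note dl = sig_least_add[OF cb bO, folded d_def]
              have dO: "d < Omega" using dl(3) bO rO by (meson order_le_less_trans)
              have dq: "d \<le> fsN SigmaSys q be" if "m \<le> q" for q
                unfolding d_def using b(1)[OF that] fs[of q] by (intro Least_le) simp
              have monob: "fsN SigmaSys q be < fsN SigmaSys (Suc q) be" if "0 < q" for q
                by (rule fsN_mono_sigma[OF gbe that])
              have Eupper: "b + sig c t1 \<le> sig c (osucc d + (1 + t1))" if "t1 < Omega" for t1
              proof (rule sig_add_shift[OF cb _ _ bO that])
                show "b < sig c (osucc d)" using dl(2) sig_mono[OF c(1) _ less_osucc, of d] dO by (simp add: order_le_less_trans)
                show "osucc d < Omega" using dO by simp
              qed
              have assoc: "osucc d + (1 + t1) = osucc (osucc d) + t1" for t1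
                by (simp add: add.assoc flip: ord_add_1)
              have assoc': "osucc d + (1 + t1) = d + (1 + (1 + t1))" for t1
                by (simp add: add.assoc flip: ord_add_1)
              show ?thesis
              proof (cases "h < Omega * osucc c")
                case True
                then obtain b' where h': "h = Omega * c + b'" "b' < Omega" using hc
                  by (metis linorder_not_less ord_less_add_imp ord_mult_osucc)
                have Ch: "b' \<in> Cset h" using Cset_Omega_times_add[OF c(1) h'(2)] h' by simp
                have rE: "r = sig c b'" by (simp add: r h' sig_def)
                have "sig c (d + b') \<le> b + r" using dl(1)[OF h'(2)] rE by simp
                then have "sig c (d + b') < sig c be" using b(2) xE by simp
                then have "d + b' < be" using sig_less_sig_iff[OF c(1,2)] dO h'(2) add_less_Omega by blast
                then have l2: "osucc (osucc (d + b')) < be" using bel olimit_succ_less by blast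
                have "1 + (1 + b') \<le> 1 + osucc b'" by (simp only: ord_add_le_cancel_left one_add_le)
                also have "\<dots> \<le> osucc (osucc b')" by (rule one_add_le)
                finally have "d + (1 + (1 + b')) \<le> osucc (osucc (d + b'))"
                  by (metis ord_add_le_cancel_left ord_add_osucc)
                then have lt: "osucc (osucc d) + b' < be" using l2 assoc assoc' by (metis order_le_less_trans)
                have dq2: "osucc (osucc d) \<le> fsN SigmaSys q be" if q: "Suc (Suc m) \<le> q" for q
                proof -
                  obtain j where j: "q = Suc (Suc j)" "m \<le> j" using q by (metis Suc_le_D Suc_le_mono)
                  have "osucc d \<le> fsN SigmaSys (Suc j) be" using order_le_less_trans[OF dq[OF j(2)] monob[of j]] m j(2)
                    by (simp add: osucc_le_iff)
                  then have "osucc d < fsN SigmaSys q be" unfolding j(1) using monob[of "Suc j"]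
                    by (rule order_le_less_trans) simp
                  then show ?thesis by (simp only: osucc_le_iff)
                qed
                \<comment> \<open>Two successors and a coefficient of norm k - 1 use exactly the
                  index m + 2 + (k - 1) = m + k + 1.\<close>
                have "osucc (osucc d) + b' < fsN SigmaSys p be"
                proof (rule S[OF hk[OF Ch] _ gbe _ dq2 lt])
                  show "Suc (Suc m) + (k - 1) \<le> p" using p k by simp
                qed auto
                then have "sig c (osucc d + (1 + b')) < ?fs p" unfolding fs assoc using p by (intro Emono) auto
                then show ?thesis using Eupper[OF h'(2)] rE by simp
              next
                case False
                \<comment> \<open>Now r is closed under sig c too, instead of being a value of it,
                  and d + r has to be located directly.\<close>
                then have Fr': "sig_closed (osucc c) r" unfolding r by (intro sig_closed_Theta[OF he]) simp
                show ?thesis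
                proof (cases "r = c")
                  case True
                  \<comment> \<open>A member of the sequence above b is closed, so its remainder
                    over b is at least c = r.\<close>
                  obtain s where s: "?fs p' = b + s" "s \<noteq> 0" using ord_less_imp_add[OF bp'] by blast
                  have "sig_closed c (?fs p')" unfolding fs by (rule sig_closed_sig[OF c(1) fO[OF p0]])
                  then have "c \<le> s" using sig_closed_add_ge[OF _ cb s(2)] s(1) by simp
                  then have "b + r \<le> ?fs p'" using s(1) True by simp
                  then show ?thesis using mono[OF p0] p'(1) by simp
                next
                  case False
                  then have cr': "c < r" using cr by simp
                  have Er: "sig c t1 < r" if "t1 < r" for t1 using sig_closed_D[OF Fr' less_osucc cr' that] .
                  have dt: "d + t1 < be" if "t1 < r" for t1
                  proof -
                    have tO: "t1 < Omega" using that rO by simp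
                    have "sig c (d + t1) \<le> b + sig c t1" using dl(1)[OF tO] .
                    also have "\<dots> < b + r" using Er[OF that] by simp
                    also have "\<dots> < sig c be" using b(2) xE by simp
                    finally show ?thesis using sig_less_sig_iff[OF c(1,2)] dO tO add_less_Omega by blast
                  qed
                  have "d + r \<le> be"
                  proof (rule leI, rule notI)
                    assume "be < d + r"
                    then consider "be < d" | t1 where "t1 < r" "be = d + t1" using less_plus_iff by blast
                    then show False
                    proof cases
                      case 1
                      have "d < be" using dt[of 0] r0 by simp
                      then show False using 1 by simp
                    next
                      case (2 t1) then show False using dt[of t1] by simp
                    qed
                  qed
                  \<comment> \<open>If d + r = be, then be is closed under sig c, so be = Theta(g)
                    with g \<ge> Omega (c + 1) > z. This puts z into FIX and makes Theta*(z)
                    nonzero.\<close>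
                  moreover have "d + r \<noteq> be"
                  proof
                    assume eq: "d + r = be"
                    have Fbe: "sig_closed (osucc c) be"
                    proof (cases "d \<le> c")
                      case True
                      then have "sig_closed (osucc d) r" using sig_closed_antimono[OF Fr'] by simp
                      then have "d + r = r" using sig_closed_absorb True cr' by auto
                      then show ?thesis using eq Fr' by simp
                    next
                      case False
                      then have "sig_closed (osucc c) (d + r)" using cr' dO Fr' by (intro sig_closed_add) (auto simp: osucc_le_iff)
                      then show ?thesis using eq by simp
                    qed
                    have cbe: "c < be" using cr' eq by (metis ord_le_add2 order_less_le_trans)
                    have "be \<in> Xsig" using c(2) False bel olimit_neq_0 by (auto simp: Xsig_def)
                    then obtain g where g: "g \<in> epshat Xsig" "Theta Xsig g = be" using sg.Theta_surj cE(2) by blast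
                    have ge: "g < epsOm" using g by (simp add: epshat_def)
                    have "Omega * osucc c \<le> g"
                    proof (rule leI, rule notI)
                      assume "g < Omega * osucc c"
                      then obtain c2 t2 where g2: "c2 < osucc c" "t2 < Omega" "g = Omega * c2 + t2"
                        using less_times_iff by blast
                      have c2O: "c2 < Omega" using g2 c(1) by (auto simp: less_osucc_iff)
                      have "c2 < be \<and> t2 < be"
                        using sg.ostar_less_Theta[OF ge] ostar_Omega_times_add[OF c2O g2(2)] g2(3) g(2) by simp
                      then have "sig c2 t2 < be" using sig_closed_D[OF Fbe g2(1)] by blast
                      then show False using g(2) g2(3) by (simp add: sig_def)
                    qed
                    moreover have "z < Omega * osucc c" using Omega_times_mono[OF less_osucc c(2), of c 0] c(3) by simp
                    ultimately have zg: "z < g" by simp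
                    have ozb: "ostar z = be"
                    proof (rule order_antisym)
                      show "ostar z \<le> be"
                        using ostar_Omega_times_add[OF c(1,2), of "osucc be"] cbe c(3)
                        by (simp add: less_osucc_iff order_less_imp_le)
                      have "be \<in> Cset z" using Cset_Omega_times_add[OF c(1,2)] c(3) by simp
                      then show "be \<le> ostar z" using ostar_ge[OF ze] by blast
                    qed
                    have "1 < be" using olimit_succ_less[OF bel olimit_pos[OF bel]] by (simp add: osucc_0)
                    then have "ostar (fsO z 1) < be" using tz(2) ostar_Omega_times_add[OF c(1) one_less_Omega] cbe by simp
                    then have "z \<in> FIX Xsig" using ozb tz(1) g zg ge by (auto simp: FIX_def)
                    moreover have "\<not> is_succ z" using ol wz' by (simp add: olimit_def)
                    ultimately have "?t = be" using tz(1) by (simp add: ThetaStar_def)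
                    then show False using t0 False bel olimit_neq_0 by simp
                  qed
                  ultimately have dr: "d + r < be" by simp
                  \<comment> \<open>As be < x, the inner induction applies, with d as the new offset
                    and the same index m.\<close>
                  have "d + r < fsN SigmaSys p be" by (rule Sr[OF cx(2) gbe m dq dr p])
                  then have lt: "sig c (d + r) < ?fs p" unfolding fs using p by (intro Emono) auto
                  \<comment> \<open>Otherwise sig c (d + r) = b + s with s < r. As r is a limit, the
                    two successors in the upper bound for b + sig c s still leave an argument below
                    d + r.\<close>
                  have "b + r \<le> sig c (d + r)"
                  proof (rule leI, rule notI)
                    assume lt': "sig c (d + r) < b + r"
                    have drO: "d + r < Omega" using dO rO add_less_Omega by blast
                    have "b \<le> sig c (d + r)" using dl(2) sig_mono_le[OF c(1) drO, of d] by simp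
                    then obtain s where s: "sig c (d + r) = b + s" "s < r" using ord_less_add_imp[OF lt'] by blast
                    have sO: "s < Omega" using s rO by simp
                    have lim: "osucc y < r" if "y < r" for y using sig_closed_limit[OF Fr' _ that] by simp
                    have "1 + (1 + s) \<le> 1 + osucc s" by (simp only: ord_add_le_cancel_left one_add_le)
                    also have "\<dots> \<le> osucc (osucc s)" by (rule one_add_le)
                    also have "\<dots> < r" using lim s by blast
                    finally have le: "d + (1 + (1 + s)) < d + r" by simp
                    have "b + s < b + sig c s" using less_sig(2)[OF c(1) sO] by simp
                    also have "\<dots> \<le> sig c (osucc d + (1 + s))" by (rule Eupper[OF sO])
                    also have "\<dots> < sig c (d + r)" unfolding assoc' by (rule sig_mono[OF c(1) drO le])
                    finally show False using s by simp
                  qed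
                  then show ?thesis using lt by simp
                qed
              qed
            qed
          qed
        qed
      qed
    qed
  qed
qed

text \<open>The offset b is described by its behaviour and not by a term. It may thus be a partial
  sum, with m accounting for the sizes already spent, and one summand after another can be
  handled.\<close>

definition sum_bounded :: "nat \<Rightarrow> ord \<Rightarrow> ord \<Rightarrow> bool" where
  "sum_bounded k c x \<longleftrightarrow> (\<forall>b m q. 0 < m \<longrightarrow> (\<forall>q\<ge>m. b \<le> fsN SigmaSys q x) \<longrightarrow> b + c < x \<longrightarrow>
     m + k \<le> q \<longrightarrow> b + c < fsN SigmaSys q x)"

lemma sum_boundedD:
  "sum_bounded k c x \<Longrightarrow> 0 < m \<Longrightarrow> (\<And>q. m \<le> q \<Longrightarrow> b \<le> fsN SigmaSys q x) \<Longrightarrow> b + c < x \<Longrightarrow>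
    m + k \<le> q \<Longrightarrow> b + c < fsN SigmaSys q x"
  unfolding sum_bounded_def by blast

text \<open>Both parts are proved together: the plain bound for Omega^0 u + v is the sum bound for v
  with offset u, and the sum bound for sigma(u) uses plain bounds for u and its
  coefficients.\<close>

lemma sigma_bound:
  "allowed SigmaSys t \<Longrightarrow>
   (\<forall>n x. tsize t \<le> n \<longrightarrow> good SigmaSys x \<longrightarrow> teval Xsig t < x \<longrightarrow> teval Xsig t < fsN SigmaSys n x) \<and>
   (\<forall>x. good SigmaSys x \<longrightarrow> sum_bounded (tsize t) (teval Xsig t) x)"
proof (induction "tsize t" arbitrary: t rule: less_induct)
  case less
  let ?e = "teval Xsig"
  have IHM: "?e u < fsN SigmaSys n x"
    if "tsize u < tsize t" "allowed SigmaSys u" "tsize u \<le> n" "good SigmaSys x" "?e u < x" for u n x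
    using less.hyps[OF that(1,2)] that by blast
  have IHS: "sum_bounded (tsize u) (?e u) x"
    if "tsize u < tsize t" "allowed SigmaSys u" "good SigmaSys x" for u x
    using less.hyps[OF that(1,2)] that by blast
  have mono: "fsN SigmaSys q x < fsN SigmaSys (Suc q) x" if "good SigmaSys x" "0 < q" for q x
    by (rule fsN_mono_sigma[OF that])
  show ?case
  proof (cases t)
    case TZero
    \<comment> \<open>The summand 0 has size 1, and this index is spent on making the bound for b
      strict.\<close>
    have "b < fsN SigmaSys q x" if "good SigmaSys x" "0 < m" "\<forall>q\<ge>m. b \<le> fsN SigmaSys q x" "m + 1 \<le> q" for b m q x
    proof -
      obtain q' where q': "q = Suc q'" "m \<le> q'" using \<open>m + 1 \<le> q\<close> by (cases q) auto
      then have "b \<le> fsN SigmaSys q' x" using that by blast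
      moreover have "fsN SigmaSys q' x < fsN SigmaSys q x" using mono[of x q'] that q' by simp
      ultimately show ?thesis by (rule order_le_less_trans)
    qed
    then show ?thesis using TZero fsN_bounds[of SigmaSys] by (auto simp: sum_bounded_def)
  next
    case (TPlus u v) then show ?thesis using less.prems by simp
  next
    case (TOm a u v)
    have al: "allowed SigmaSys u" "allowed SigmaSys v" using less.prems TOm by auto
    have sz: "tsize u < tsize t" "tsize v < tsize t" "tsize u + tsize v < tsize t" using TOm by auto
    have cases: "?e u = 0 \<or> ?e a = 0" if "?e t < x" "good SigmaSys x" for x
    proof -
      have "Om (?e a) * ?e u + ?e v < Omega" using that TOm by (auto simp: good_def)
      then show ?thesis using Om_times_add_countable by blast
    qed
    have sum: "b + (?e u + ?e v) < fsN SigmaSys q x"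
      if "good SigmaSys x" "0 < m" "\<forall>q\<ge>m. b \<le> fsN SigmaSys q x" "b + (?e u + ?e v) < x" "m + tsize t \<le> q" for b m q x
    proof -
      have lt: "b + ?e u + ?e v < x" using that by (simp add: add.assoc)
      then have "b + ?e u < x" by (meson ord_le_add1 order_le_less_trans)
      then have "b + ?e u < fsN SigmaSys q' x" if "m + tsize u \<le> q'" for q'
        using sum_boundedD[OF IHS[OF sz(1) al(1) \<open>good SigmaSys x\<close>] \<open>0 < m\<close> _ _ that]
          \<open>\<forall>q\<ge>m. b \<le> fsN SigmaSys q x\<close> by blast
      \<comment> \<open>The offset grows to b plus the value of u, and its index by the size of
        u.\<close>
      then have "b + ?e u + ?e v < fsN SigmaSys q x"
        using that(2,5) sz(3)
        by (intro sum_boundedD[OF IHS[OF sz(2) al(2) that(1)] _ _ lt, of "m + tsize u"]) (auto intro: order_less_imp_le)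
      then show ?thesis by (simp add: add.assoc)
    qed
    have M: "?e t < fsN SigmaSys n x" if h: "tsize t \<le> n" "good SigmaSys x" "?e t < x" for n x
    proof -
      from cases[OF h(3,2)] show ?thesis
      proof
        assume "?e u = 0"
        then have "?e t = ?e v" using TOm by simp
        then show ?thesis using IHM[OF sz(2) al(2) _ h(2)] h sz by simp
      next
        assume "?e a = 0"
        then have et: "?e t = ?e u + ?e v" using TOm by simp
        then have lu: "?e u < x" using h(3) by (metis ord_le_add1 order_le_less_trans)
        show ?thesis unfolding et
        proof (rule sum_boundedD[OF IHS[OF sz(2) al(2) h(2)]])
          show "0 < tsize u" using tsize_pos[of u] by simp
          show "?e u \<le> fsN SigmaSys q x" if "tsize u \<le> q" for q
            using IHM[OF sz(1) al(1) that h(2) lu] by simp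
          show "?e u + ?e v < x" using h(3) et by simp
          show "tsize u + tsize v \<le> n" using h(1) sz(3) by simp
        qed
      qed
    qed
    have "sum_bounded (tsize t) (?e t) x" if x: "good SigmaSys x" for x
      unfolding sum_bounded_def
    proof (intro allI impI)
      fix b m q assume h: "0 < m" "\<forall>q\<ge>m. b \<le> fsN SigmaSys q x" "b + ?e t < x" "m + tsize t \<le> q"
      have "?e t < x" using h(3) by (meson ord_le_add2 order_le_less_trans)
      then consider "?e u = 0" | "?e a = 0" using cases[OF _ x] by blast
      then show "b + ?e t < fsN SigmaSys q x"
      proof cases
        case 1
        then have "?e t = ?e v" using TOm by simp
        moreover have "m + tsize v \<le> q" using h(4) sz(2) by simp
        ultimately show ?thesis using sum_boundedD[OF IHS[OF sz(2) al(2) x] h(1), of b q] h(2,3) by simp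
      next
        case 2
        then have "?e t = ?e u + ?e v" using TOm by simp
        then show ?thesis using sum[OF x h(1,2) _ h(4)] h(3) by simp
      qed
    qed
    then show ?thesis using M by blast
  next
    case (TTheta u)
    define h where "h = ?e u"
    define k where "k = tsize u"
    define r where "r = Theta Xsig h"
    have et: "?e t = r" and st: "tsize t = Suc k" using TTheta by (simp_all add: r_def h_def k_def)
    have au: "allowed SigmaSys u" using less.prems TTheta by simp
    have dh: "denotes SigmaSys k h" unfolding denotes_def h_def k_def using au by auto
    have he: "h < epsOm" using denotes_less_epsOm[OF dh] .
    have dM: "c < fsN SigmaSys n x" if d: "denotes SigmaSys k c" "k \<le> n" "good SigmaSys x" "c < x" for c n x
    proof -
      obtain u' where u': "allowed SigmaSys u'" "?e u' = c" "tsize u' \<le> k" using d(1) by (auto simp: denotes_def)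
      then show ?thesis using IHM[of u' n x] d st by simp
    qed
    have M: "r < fsN SigmaSys n x" if "Suc k \<le> n" "good SigmaSys x" "r < x" for n x
      using that(2,3)
    proof (induction x rule: less_induct)
      case (less x)
      obtain z where z: "z \<in> epshat Xsig" "x = Theta Xsig z" "x \<in> lim_pts Xsig"
        using good_sigma_cases[OF less.prems(1)] by blast
      have "Theta (Xof SigmaSys) h < fsN SigmaSys n (Theta (Xof SigmaSys) z)"
        by (rule fsN_bound_Theta[OF _ _ _ dh _ that(1)])
          (use z less dM in \<open>auto simp: r_def\<close>)
      then show ?case using z by (simp add: r_def)
    qed
    have dS: "b + c < fsN SigmaSys q y"
      if d: "denotes SigmaSys j c" "j \<le> k" "good SigmaSys y" "0 < m" "\<And>q. m \<le> q \<Longrightarrow> b \<le> fsN SigmaSys q y"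
       "b + c < y" "m + j \<le> q" for j c y b m q
    proof -
      obtain u' where u': "allowed SigmaSys u'" "?e u' = c" "tsize u' \<le> j" using d(1) by (auto simp: denotes_def)
      then have "sum_bounded (tsize u') c y" using IHS[of u' y] d st by simp
      moreover have "m + tsize u' \<le> q" using u' d by simp
      ultimately show ?thesis using sum_boundedD d(4-6) by blast
    qed
    have "sum_bounded (Suc k) r x" if "good SigmaSys x" for x
      using that
    proof (induction x rule: less_induct)
      case (less x)
      show ?case
        unfolding sum_bounded_def
      proof (intro allI impI)
        fix b m q assume b: "0 < m" "\<forall>q\<ge>m. b \<le> fsN SigmaSys q x" "b + r < x" "m + Suc k \<le> q"
        show "b + r < fsN SigmaSys q x"
        proof (cases "Omega \<le> h")
          case True
          show ?thesis
            by (rule sigma_sum_bound[OF less.prems dh True r_def _ b(3,1) dM M dS _ b(4)])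
              (use b(2) less.IH in \<open>auto simp: sum_bounded_def\<close>)
        next
          case False
          \<comment> \<open>For countable h the value sigma(h) is h + 1; the successor uses the
            index provided by the symbol sigma.\<close>
          then have r: "r = osucc h" using sig_0[of h] by (simp add: r_def sig_def)
          obtain q' where q': "q = Suc q'" "m + k \<le> q'" using b(4) by (cases q) auto
          have "b + h < x" using b(3) r by (simp add: order_less_trans[OF less_osucc])
          then have "b + h < fsN SigmaSys q' x"
            using dS[OF dh order_refl less.prems b(1) _ _ q'(2)] b(2) by blast
          then have "b + r \<le> fsN SigmaSys q' x" using r by (simp add: osucc_le_iff)
          then show ?thesis using mono[OF less.prems, of q'] q' b(1) by simp
        qed
      qed
    qed
    then show ?thesis using M et st by auto
  qed
qed


section \<open>Both systems together and the passage from norms to terms\<close>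

lemma fsN_bound_countable:
  assumes "denotes s n c" "good s x" "c < x" shows "c < fsN s n x"
proof (cases s)
  case SigmaSys
  obtain t where "allowed s t" "teval (Xof s) t = c" "tsize t \<le> n" using assms(1) by (auto simp: denotes_def)
  then show ?thesis using sigma_bound[of t] assms SigmaSys by auto
next
  case VarthetaSys
  then show ?thesis using fsN_bound_vartheta assms by blast
qed

text \<open>An infimum of natural numbers is attained, so a finite norm yields a term of that size;
  without any term the norm would be infinite.\<close>

lemma denotes_onorm: "onorm s x \<le> enat n \<Longrightarrow> denotes s n x"
proof -
  let ?A = "(\<lambda>t. enat (tsize t)) ` {t. allowed s t \<and> teval (Xof s) t = x}"
  assume n: "onorm s x \<le> enat n"
  have "?A \<noteq> {}"
  proof
    assume "?A = {}"
    then have "onorm s x = \<infinity>" unfolding onorm_def by (simp only: Inf_empty top_enat_def)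
    then show False using n by simp
  qed
  then have "Inf ?A \<in> ?A" unfolding Inf_enat_def by (auto intro: LeastI)
  then show ?thesis using n unfolding onorm_def denotes_def by auto
qed

theorem theorem9p6:
  fixes s :: system and zeta xi :: ord and n :: nat
  assumes "zeta < xi"
    and "xi \<in> epshat (Xof s)"
    and "olimit xi"
    and "tau xi < Omega"
    and "onorm s zeta \<le> enat n"
  shows "zeta \<le> fsN s n xi"
proof -
  have "denotes s n zeta" by (rule denotes_onorm[OF assms(5)])
  then have "zeta < fsN s n xi"
    using assms(1-4) fsN_bound_countable by (intro less_fsN_big[of xi s n]) auto
  then show ?thesis by simp
qed

end
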